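(* Let $\mathbf{X}$ be a random vector with a density function $f(\mathbf{x})$ on a support $\Omega\subset\mathbb{R}^m$, let $g$ and $h$ be real-valued functions with $h$ continuous, and suppose that $h(\mathbf{x})$ is continuously differentiable for almost all $\mathbf{x}\in\Omega$ up to a Lebesgue null set. Let $(c_0,c_1)$ be the interval in which $h(\mathbf{x})$ may take values for $\mathbf{x}\in\Omega$ ($c_0=-\infty$ and $c_1=\infty$ allowed), let $\xi\in(c_0,c_1)$, and set $$\alpha(\xi)=\mathrm{E}\left[g(\mathbf{X})\cdot 1_{\{h(\mathbf{X})\le\xi\}}\right],\qquad \alpha'(\xi)=\frac{d}{d\xi}\alpha(\xi).$$ Consider mappings $$u:\mathbf{x}\in\Omega\mapsto(u_1(\mathbf{x}),\dots,u_m(\mathbf{x}),h(\mathbf{x}))\in\mathbb{R}^{m+1},\qquad \varphi:\mathbf{y}=(y_1,\dots,y_{m+1})\in u\{\Omega\}\mapsto(y_1,\dots,y_m),$$ where $u_1,\dots,u_m$ are continuously differentiable functions of $\mathbf{x}$, and suppose that $u$ is one-to-one and continuously differentiable, that $J_m^u(\mathbf{x})\ne0$ for almost all $\mathbf{x}\in\Omega$, and that $\mathcal{H}^1(\varphi^{-1}\{\mathbf{z}\})>0$ for almost all $\mathbf{z}\in\varphi\{u\{\Omega\}\}$. Then $$\alpha(\xi)=\mathrm{E}\left[w\big(\varphi(u(\mathbf{X}));\xi\big)\right],$$ where $$w(\mathbf{z};\xi)=\left.\int_{c_0}^{\xi}\frac{g(u^{-1}(\mathbf{z},t))f(u^{-1}(\mathbf{z},t))}{J_m^u(u^{-1}(\mathbf{z},t))}\,dt\right/\int_{c_0}^{c_1}\frac{f(u^{-1}(\mathbf{z},t))}{J_m^u(u^{-1}(\mathbf{z},t))}\,dt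 .$$ If, in addition, $w(\varphi(u(\mathbf{X}));\cdot)$ satisfies a Lipschitz continuity condition with respect to $\xi$, i.e., there exists a random variable $K$ with $\mathrm{E}(K)<\infty$ such that for all small enough $\Delta$, $$|w(\varphi(u(\mathbf{X}));\xi+\Delta)-w(\varphi(u(\mathbf{X}));\xi)|\le K|\Delta|\quad\text{with probability }1,$$ then $$\alpha'(\xi)=\mathrm{E}\left[\nu(\varphi(u(\mathbf{X}));\xi)\right],$$ where $$\nu(\mathbf{z};\xi)=\left.\frac{g(u^{-1}(\mathbf{z},\xi))f(u^{-1}(\mathbf{z},\xi))}{J_m^u(u^{-1}(\mathbf{z},\xi))}\right/\int_{c_0}^{c_1}\frac{f(u^{-1}(\mathbf{z},t))}{J_m^u(u^{-1}(\mathbf{z},t))}\,dt .$$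
   Context: For a mapping $u$, $u\{A\}$ denotes the set of images of the set $A$; $u^{-1}$ is the inverse of $u$ on $u\{\Omega\}$, and $\varphi^{-1}\{\mathbf{z}\}=\{(\mathbf{z},t)\in u\{\Omega\}:t\in(c_0,c_1)\}$. Expressions involving $u^{-1}(\mathbf{z},t)$ are taken to be $0$ when $(\mathbf{z},t)\notin u\{\Omega\}$. "Almost all $\mathbf{x}\in\Omega$" is with respect to Lebesgue measure, and "almost all $\mathbf{z}$" is with respect to $\mathcal{H}^{m-1}$, where $\mathcal{H}^s$ denotes $s$-dimensional Hausdorff measure. The $m$-dimensional Jacobian $J_m^u(\mathbf{x})$ is $0$ if the matrix $Du(\mathbf{x})$ of partial derivatives has rank less than $m$; otherwise it is the square root of the sum of squares of the determinants of the $m\times m$ submatrices of $Du(\mathbf{x})$. It is assumed that the expectation defining $\alpha$ exists. No smoothness is required of $g$, which may be discontinuous.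
   Formalization: The formula for α'(ξ) is shown for almost every ξ satisfying the Lipschitz condition, and for every such ξ at which ν(φ(u(X));·) is also almost surely continuous; at an arbitrary fixed ξ it fails, e.g. g=1_{h=ξ}. *)

theory Defs
  imports "HOL-Probability.Probability"
begin

text \<open>
  Hausdorff measure with the usual normalisation. Since \<open>0 powr 0 = 0\<close> in HOL, the case \<open>s = 0\<close>
  is treated separately, so that the zero-dimensional measure is the counting measure. Covering sets
  are required to be bounded because \<^const>\<open>diameter\<close> is unspecified on unbounded sets.
\<close>

definition hausdorff_gauge :: "real \<Rightarrow> 'a::metric_space set \<Rightarrow> real" where
  "hausdorff_gauge s C =
     (if C = {} then 0 else if s = 0 then 1 else unit_ball_vol s * (diameter C / 2) powr s)"

definition hausdorff_premeasure :: "real \<Rightarrow> real \<Rightarrow> 'a::metric_space set \<Rightarrow> ennreal" where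
  "hausdorff_premeasure s \<delta> A =
     Inf {\<Sum>i. ennreal (hausdorff_gauge s (C i)) | C :: nat \<Rightarrow> 'a set.
            A \<subseteq> (\<Union>i. C i) \<and> (\<forall>i. bounded (C i) \<and> diameter (C i) \<le> \<delta>)}"

definition hausdorff_measure :: "real \<Rightarrow> 'a::metric_space set \<Rightarrow> ennreal" where
  "hausdorff_measure s A = (SUP \<delta>\<in>{0<..}. hausdorff_premeasure s \<delta> A)"

text \<open>
  Continuous differentiability on a set that need not be open: there is an open neighbourhood on
  which the function is continuously differentiable. For open \<open>S\<close> one can take \<open>U = S\<close>.
\<close>

definition C1_on :: "('a::real_normed_vector \<Rightarrow> 'b::real_normed_vector) \<Rightarrow> 'a set \<Rightarrow> bool" where
  "C1_on F S \<longleftrightarrow> (\<exists>U. \<exists>F' :: 'a \<Rightarrow> 'a \<Rightarrow>\<^sub>L 'b. open U \<and> S \<subseteq> U \<and>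
      (\<forall>x\<in>U. (F has_derivative blinfun_apply (F' x)) (at x)) \<and> continuous_on U F')"

text \<open>
  The space \<open>\<real>\<^sup>m\<^sup>+\<^sup>1\<close> is rendered as \<open>\<real>\<^sup>m \<times> \<real>\<close> (with the Euclidean norm). The rows of the matrix of
  partial derivatives of a map into it are indexed by \<open>'m option\<close>: row \<open>Some i\<close> belongs to the
  \<open>i\<close>-th component, row \<open>None\<close> to the last one.
\<close>

definition partials_matrix ::
    "(real^'m \<Rightarrow> (real^'m) \<times> real) \<Rightarrow> real^'m \<Rightarrow> real^'m^('m option)" where
  "partials_matrix u x =
     (\<chi> j k. let d = frechet_derivative u (at x) (axis k 1)
             in case j of Some i \<Rightarrow> fst d $ i | None \<Rightarrow> snd d)"

text \<open>
  The \<open>m \<times> m\<close> submatrices arise by omitting one row \<open>j\<close>; the map \<open>i \<mapsto> (if Some i = j then None else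
  Some i)\<close> enumerates the remaining rows. Their order affects only the sign of the determinant.
\<close>

definition omit_row :: "'m option \<Rightarrow> real^'m^('m option) \<Rightarrow> real^'m^'m" where
  "omit_row j A = (\<chi> i. A $ (if Some i = j then None else Some i))"

definition jacobian_m :: "(real^'m \<Rightarrow> (real^'m) \<times> real) \<Rightarrow> real^'m \<Rightarrow> real" where
  "jacobian_m u x =
     (if rank (partials_matrix u x) < CARD('m) then 0
      else sqrt (\<Sum>j\<in>UNIV. (det (omit_row j (partials_matrix u x)))\<^sup>2))"

definition fibre ::
    "(real^'m) set \<Rightarrow> (real^'m \<Rightarrow> (real^'m) \<times> real) \<Rightarrow> ereal \<Rightarrow> ereal \<Rightarrow> real^'m
       \<Rightarrow> ((real^'m) \<times> real) set" where
  "fibre \<Omega> u c0 c1 z = {(z', t) \<in> u ` \<Omega>. z' = z \<and> c0 < ereal t \<and> ereal t < c1}"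

text \<open>\<open>F (u\<^sup>-\<^sup>1 y)\<close>, with the convention that it is \<open>0\<close> off the image of \<open>u\<close>.\<close>

definition at_inverse :: "'a set \<Rightarrow> ('a \<Rightarrow> 'b) \<Rightarrow> ('a \<Rightarrow> real) \<Rightarrow> 'b \<Rightarrow> real" where
  "at_inverse \<Omega> u F y = (if y \<in> u ` \<Omega> then F (the_inv_into \<Omega> u y) else 0)"

text \<open>
  The integrals over \<open>t\<close> are Lebesgue integrals with respect to the completed measure
  \<^const>\<open>lebesgue\<close>, so that no Borel measurability of images under \<open>u\<close> is presupposed.
\<close>

definition fibre_mass ::
    "(real^'m) set \<Rightarrow> (real^'m \<Rightarrow> (real^'m) \<times> real) \<Rightarrow> (real^'m \<Rightarrow> real) \<Rightarrow> ereal \<Rightarrow> ereal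
       \<Rightarrow> real^'m \<Rightarrow> real" where
  "fibre_mass \<Omega> u f c0 c1 z =
     interval_lebesgue_integral lebesgue c0 c1
       (\<lambda>t. at_inverse \<Omega> u (\<lambda>x. f x / jacobian_m u x) (z, t))"

definition w_fun ::
    "(real^'m) set \<Rightarrow> (real^'m \<Rightarrow> (real^'m) \<times> real) \<Rightarrow> (real^'m \<Rightarrow> real) \<Rightarrow> (real^'m \<Rightarrow> real)
       \<Rightarrow> ereal \<Rightarrow> ereal \<Rightarrow> real^'m \<Rightarrow> real \<Rightarrow> real" where
  "w_fun \<Omega> u f g c0 c1 z \<xi> =
     interval_lebesgue_integral lebesgue c0 (ereal \<xi>)
       (\<lambda>t. at_inverse \<Omega> u (\<lambda>x. g x * f x / jacobian_m u x) (z, t))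
     / fibre_mass \<Omega> u f c0 c1 z"

definition nu_fun ::
    "(real^'m) set \<Rightarrow> (real^'m \<Rightarrow> (real^'m) \<times> real) \<Rightarrow> (real^'m \<Rightarrow> real) \<Rightarrow> (real^'m \<Rightarrow> real)
       \<Rightarrow> ereal \<Rightarrow> ereal \<Rightarrow> real^'m \<Rightarrow> real \<Rightarrow> real" where
  "nu_fun \<Omega> u f g c0 c1 z \<xi> =
     at_inverse \<Omega> u (\<lambda>x. g x * f x / jacobian_m u x) (z, \<xi>) / fibre_mass \<Omega> u f c0 c1 z"

text \<open>The quantifier over \<open>\<Delta>\<close> is outside the almost-sure quantifier, and \<open>K\<close> may depend on \<open>\<xi>\<close>.\<close>

definition stochastic_lipschitz_at :: "'w measure \<Rightarrow> ('w \<Rightarrow> real \<Rightarrow> real) \<Rightarrow> real \<Rightarrow> bool" where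
  "stochastic_lipschitz_at M W \<xi> \<longleftrightarrow>
     (\<exists>K. integrable M K \<and>
        (\<exists>\<delta>>0. \<forall>\<Delta>. \<bar>\<Delta>\<bar> < \<delta> \<longrightarrow> (AE \<omega> in M. \<bar>W \<omega> (\<xi> + \<Delta>) - W \<omega> \<xi>\<bar> \<le> K \<omega> * \<bar>\<Delta>\<bar>)))"

end

theory Submission
  imports Defs
begin

text \<open>
  The formula for \<open>w\<close> is a disintegration of Lebesgue measure on \<open>\<Omega>\<close> along the fibres of \<open>v\<close>. It follows from
  a symmetry that needs no measure on \<open>v ` \<Omega>\<close>: writing \<open>\<Phi>\<^sub>G z\<close> for the integral of \<open>G / J\<close> over the fibre above \<open>z\<close>,
  the integral of \<open>F \<cdot> \<Phi>\<^sub>G \<circ> v\<close> over \<open>\<Omega>\<close> is symmetric in \<open>F\<close> and \<open>G\<close>.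
  Locally, replacing the \<open>i\<close>-th component of \<open>v\<close> by \<open>h\<close> gives coordinates in which \<open>u\<close> is a graph, and
  the symmetry is an exchange of two fibre parameters; the two Jacobian factors agree because the gradient of
  the difference of two graph functions vanishes almost everywhere on its zero set. The hypothesis on the fibres makes \<open>D v\<close>
  singular almost everywhere and \<open>\<Phi>\<^sub>f \<circ> v\<close> positive almost everywhere on \<open>{f > 0}\<close>. Choosing
  \<open>F = f / \<Phi>\<^sub>f \<circ> v\<close>, whose fibre integral is \<open>1\<close>, yields the first claim.

  Exchanging integrals shows that \<open>\<alpha>\<close> is the indefinite integral of the claimed derivative, so Lebesgue's differentiation
  theorem gives the claim for almost every \<open>\<xi>\<close>. At a point where \<open>\<nu>\<close> is almost surely continuous the claim follows
  by dominated convergence.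
\<close>


section \<open>Change of variables for arbitrary finite index types\<close>

text \<open>Behind the symmetry stands a product structure: where D v is singular and D u injective,
  the tangent space of the surface u(\<Omega>) contains the vertical direction, so its surface
  measure is (m-1)-dimensional measure on v(\<Omega>) times length on the fibres. Both sides of the
  symmetry would then be the integral over v(\<Omega>) of the product of the two fibre integrals.
  Proving the symmetry alone avoids an area formula on the image. Measurability shapes the rest:
  neither \<open>at_inverse\<close> nor a fibre integral is known to be measurable from its
  definition. Both are replaced by Borel functions of a point x of \<Omega> (and a level t) that
  agree almost everywhere, and the final expectations are taken over the completion of
  \<open>M\<close>. The derivative is asserted for almost every \<xi> or under continuity of \<nu>
  because changing g on a null level set {h = \<xi>} may alter \<nu> at \<xi> but neither \<alpha>
  nor w; a single arbitrary \<xi> therefore cannot be controlled by \<alpha> and w.\<close>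

text \<open>The preimage of a box is a box with permuted side lengths. Two different Euclidean
  spaces are allowed, since the lemma serves both the passage to another index type and the exchange
  of a coordinate of \<open>real^'n\<close> with an additional real coordinate.\<close>

lemma lborel_distr_permute_coordinates:
  fixes s :: "'a::euclidean_space \<Rightarrow> 'b::euclidean_space"
  assumes \<pi>: "bij_betw \<pi> (Basis :: 'b set) (Basis :: 'a set)"
    and s: "\<And>x b. b \<in> Basis \<Longrightarrow> s x \<bullet> b = x \<bullet> \<pi> b"
    and meas: "s \<in> borel_measurable borel"
  shows "distr lborel borel s = lborel"
proof (rule sym, rule lborel_eqI)
  fix l u :: 'b
  assume lu: "\<And>b. b \<in> Basis \<Longrightarrow> l \<bullet> b \<le> u \<bullet> b"
  define \<rho> where "\<rho> = inv_into Basis \<pi>"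
  have \<rho>: "\<rho> b \<in> Basis" "\<pi> (\<rho> b) = b" if "b \<in> Basis" for b
    using that \<pi> unfolding \<rho>_def
    by (metis bij_betw_imp_surj_on inv_into_into, metis bij_betw_inv_into_right)
  have \<pi>B: "\<pi> b \<in> Basis" if "b \<in> Basis" for b
    using that \<pi> by (auto simp: bij_betw_def)
  have \<rho>\<pi>: "\<rho> (\<pi> b) = b" if "b \<in> Basis" for b
    using that \<pi> unfolding \<rho>_def by (simp add: bij_betw_def)
  define l' u' where "l' = (\<Sum>b\<in>Basis. (l \<bullet> \<rho> b) *\<^sub>R b)" and "u' = (\<Sum>b\<in>Basis. (u \<bullet> \<rho> b) *\<^sub>R b)"
  have l': "l' \<bullet> b = l \<bullet> \<rho> b" "u' \<bullet> b = u \<bullet> \<rho> b" if "b \<in> Basis" for b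
    using that by (simp_all add: l'_def u'_def inner_sum_left_Basis)
  have pre: "s -` box l u = box l' u'"
  proof (intro set_eqI iffI)
    fix x assume "x \<in> s -` box l u"
    then have *: "l \<bullet> b < x \<bullet> \<pi> b \<and> x \<bullet> \<pi> b < u \<bullet> b" if "b \<in> Basis" for b
      using that by (auto simp: mem_box s)
    show "x \<in> box l' u'"
      unfolding mem_box
    proof
      fix b :: 'a assume b: "b \<in> Basis"
      show "l' \<bullet> b < x \<bullet> b \<and> x \<bullet> b < u' \<bullet> b"
        using *[OF \<rho>(1)[OF b]] b by (simp add: l' \<rho>)
    qed
  next
    fix x assume x: "x \<in> box l' u'"
    have "l \<bullet> b < x \<bullet> \<pi> b \<and> x \<bullet> \<pi> b < u \<bullet> b" if "b \<in> Basis" for b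
      using x[unfolded mem_box, rule_format, OF \<pi>B[OF that]] that by (simp add: l' \<pi>B \<rho>\<pi>)
    then show "x \<in> s -` box l u" by (auto simp: mem_box s)
  qed
  have "emeasure (distr lborel borel s) (box l u) = emeasure lborel (box l' u')"
    using meas by (subst emeasure_distr) (simp_all add: pre)
  also have "\<dots> = (\<Prod>b\<in>Basis. (u' - l') \<bullet> b)"
    using lu \<rho> by (subst emeasure_lborel_box) (auto simp: l')
  also have "(\<Prod>b\<in>Basis. (u' - l') \<bullet> b) = (\<Prod>b\<in>Basis. (u - l) \<bullet> b)"
    by (rule prod.reindex_bij_betw[OF \<pi>, symmetric, THEN trans]) (simp add: inner_diff_left l' \<pi>B \<rho>\<pi>)
  finally show "emeasure (distr lborel borel s) (box l u) = (\<Prod>b\<in>Basis. (u - l) \<bullet> b)" .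
qed simp

text \<open>
  The library states change of variables and Sard's theorem for well-ordered index types only; they
  are transferred to arbitrary finite index types along a well-ordered copy.
\<close>

typedef 'n ordered_copy = "UNIV :: 'n set" morphisms of_copy to_copy by simp

lemma of_copy_to_copy [simp]: "of_copy (to_copy i) = i" "to_copy (of_copy j) = j"
  by (simp_all add: to_copy_inverse of_copy_inverse)

lemma bij_of_copy: "bij of_copy" and bij_to_copy: "bij to_copy"
  by (rule bij_betw_byWitness[where f'=to_copy]; simp) (rule bij_betw_byWitness[where f'=of_copy]; simp)

instance ordered_copy :: (finite) finite
proof
  show "finite (UNIV :: 'a ordered_copy set)"
    using bij_betw_finite[of to_copy UNIV "UNIV :: 'a ordered_copy set"] bij_to_copy by simp
qed

instantiation ordered_copy :: (finite) wellorder
begin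

text \<open>Any well-order serves, as no conclusion refers to it; an injection into the naturals,
  which exists by finiteness, provides one.\<close>

definition copy_index :: "'a ordered_copy \<Rightarrow> nat" where
  "copy_index = (SOME f. inj f)"

definition less_eq_ordered_copy :: "'a ordered_copy \<Rightarrow> 'a ordered_copy \<Rightarrow> bool" where
  "x \<le> y \<longleftrightarrow> copy_index x \<le> copy_index y"

definition less_ordered_copy :: "'a ordered_copy \<Rightarrow> 'a ordered_copy \<Rightarrow> bool" where
  "x < y \<longleftrightarrow> copy_index x < copy_index y"

instance
proof
  have inj: "inj (copy_index :: 'a ordered_copy \<Rightarrow> nat)"
    unfolding copy_index_def
    using finite_imp_inj_to_nat_seg[OF finite[of "UNIV :: 'a ordered_copy set"]]
    by (intro someI_ex[where P=inj]) blast
  fix x y z :: "'a ordered_copy" and P :: "'a ordered_copy \<Rightarrow> bool"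
  show "x < y \<longleftrightarrow> x \<le> y \<and> \<not> y \<le> x" "x \<le> x" "x \<le> y \<or> y \<le> x"
    "x \<le> y \<Longrightarrow> y \<le> z \<Longrightarrow> x \<le> z"
    by (auto simp: less_eq_ordered_copy_def less_ordered_copy_def)
  show "x \<le> y \<Longrightarrow> y \<le> x \<Longrightarrow> x = y"
    using inj by (auto simp: less_eq_ordered_copy_def inj_def)
  assume step: "\<And>x. (\<And>y. y < x \<Longrightarrow> P y) \<Longrightarrow> P x"
  show "P x"
  proof (rule measure_induct_rule[of copy_index P])
    fix x assume "\<And>y. copy_index y < copy_index x \<Longrightarrow> P y"
    then show "P x" unfolding less_ordered_copy_def[symmetric] by (rule step)
  qed
qed

end

definition vec_copy :: "real^'n \<Rightarrow> real^('n ordered_copy)" where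
  "vec_copy x = (\<chi> i. x $ of_copy i)"

definition vec_uncopy :: "real^('n ordered_copy) \<Rightarrow> real^'n" where
  "vec_uncopy x = (\<chi> i. x $ to_copy i)"

lemma vec_copy_uncopy [simp]: "vec_copy (vec_uncopy y) = y" "vec_uncopy (vec_copy x) = x"
  by (simp_all add: vec_copy_def vec_uncopy_def vec_eq_iff)

lemma bounded_linear_vec_copy: "bounded_linear (vec_copy :: real^'n \<Rightarrow> _)"
  and bounded_linear_vec_uncopy: "bounded_linear (vec_uncopy :: _ \<Rightarrow> real^'n)"
  by (auto intro!: linear_conv_bounded_linear[THEN iffD1] linearI
      simp: vec_copy_def vec_uncopy_def vec_eq_iff)

lemma borel_measurable_vec_copy [measurable]: "vec_copy \<in> borel_measurable borel"
  and borel_measurable_vec_uncopy [measurable]: "vec_uncopy \<in> borel_measurable borel"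
  by (auto intro!: borel_measurable_continuous_onI linear_continuous_on
      bounded_linear_vec_copy bounded_linear_vec_uncopy)

lemma distr_lborel_vec_copy: "distr lborel borel (vec_copy :: real^'n \<Rightarrow> _) = lborel"
proof (rule lborel_distr_permute_coordinates)
  let ?\<pi> = "\<lambda>b :: real^('n ordered_copy). vec_uncopy b"
  have ax: "vec_uncopy (axis i r) = axis (of_copy i) r" "vec_copy (axis j r) = axis (to_copy j) r" for i j r
    by (auto simp: vec_uncopy_def vec_copy_def axis_def vec_eq_iff)
  have *: "vec_uncopy b \<in> Basis" if "b \<in> Basis" for b :: "real^('n ordered_copy)"
    using that by (auto simp: Basis_vec_def ax)
  have **: "vec_copy b \<in> Basis" if "b \<in> Basis" for b :: "real^'n"
    using that by (auto simp: Basis_vec_def ax)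
  show "bij_betw ?\<pi> Basis Basis"
    by (rule bij_betw_byWitness[where f'=vec_copy]) (auto intro: * **)
  show "vec_copy x \<bullet> b = x \<bullet> vec_uncopy b" for x :: "real^'n" and b
    unfolding inner_vec_def vec_copy_def vec_uncopy_def
    using sum.reindex_bij_betw[OF bij_to_copy, of "\<lambda>i. x $ of_copy i \<bullet> b $ i"] by simp
qed simp

text \<open>Conjugation by \<open>b\<close> is a sign-preserving bijection between the permutations
  of the two index types, so the Leibniz sums agree term by term. No sign appears because rows and
  columns are relabelled by the same bijection.\<close>

lemma det_reindex:
  fixes A :: "'a::comm_ring_1^'n^'n" and B :: "'a^'k^'k"
  assumes b: "bij b" and AB: "\<And>i j. B $ i $ j = A $ b i $ b j"
  shows "det B = det A"
proof -
  let ?m = "map_permutation UNIV b"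
  have surj: "range b = UNIV" and inj: "inj b" using b by (auto simp: bij_def)
  have m: "?m p (b i) = b (p i)" if "p permutes UNIV" for p i
    using b by (simp add: map_permutation_def restrict_id_def bij_is_inj)
  have "bij_betw ?m {p. p permutes UNIV} {p. p permutes UNIV}"
  proof (rule bij_betw_byWitness[where f'="map_permutation UNIV (inv b)"])
    show "\<forall>p\<in>{p. p permutes UNIV}. map_permutation UNIV (inv b) (?m p) = p"
      using b by (auto simp: map_permutation_compose[of b UNIV UNIV] bij_imp_bij_inv bij_is_inj)
    show "\<forall>p\<in>{p. p permutes UNIV}. ?m (map_permutation UNIV (inv b) p) = p"
      using b bij_imp_bij_inv[OF b]
      by (auto simp: map_permutation_compose[of "inv b" UNIV UNIV] bij_is_inj bij_is_surj surj_iff[THEN iffD1])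
    show "?m ` {p. p permutes UNIV} \<subseteq> {p. p permutes UNIV}"
      using map_permutation_permutes[of b UNIV UNIV] b by auto
    show "map_permutation UNIV (inv b) ` {p. p permutes UNIV} \<subseteq> {p. p permutes UNIV}"
      using map_permutation_permutes[of "inv b" UNIV UNIV] bij_imp_bij_inv[OF b] by auto
  qed
  from sum.reindex_bij_betw[OF this, of "\<lambda>p. of_int (sign p) * prod (\<lambda>i. A$i$p i) UNIV"]
  have "det A = (\<Sum>p | p permutes UNIV. of_int (sign (?m p)) * (\<Prod>i\<in>UNIV. A $ i $ ?m p i))"
    by (simp add: det_def)
  also have "\<dots> = (\<Sum>p | p permutes UNIV. of_int (sign p) * (\<Prod>i\<in>UNIV. B $ i $ p i))"
  proof (rule sum.cong[OF refl])
    fix p :: "'k \<Rightarrow> 'k" assume "p \<in> {p. p permutes UNIV}"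
    then have p: "p permutes UNIV" by simp
    have "(\<Prod>i\<in>UNIV. A $ i $ ?m p i) = (\<Prod>i\<in>UNIV. A $ b i $ ?m p (b i))"
      using prod.reindex_bij_betw[OF b, of "\<lambda>i. A $ i $ ?m p i"] by simp
    then show "of_int (sign (?m p)) * (\<Prod>i\<in>UNIV. A $ i $ ?m p i) = of_int (sign p) * (\<Prod>i\<in>UNIV. B $ i $ p i)"
      using p inj by (simp add: m AB sign_map_permutation)
  qed
  finally show ?thesis by (simp add: det_def)
qed

lemma det_matrix_copy:
  fixes L :: "real^'n \<Rightarrow> real^'n"
  shows "det (matrix (vec_copy \<circ> L \<circ> vec_uncopy)) = det (matrix L)"
proof (rule det_reindex[OF bij_of_copy])
  have "vec_uncopy (axis j 1) = axis (of_copy j) 1" for j :: "'n ordered_copy"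
    by (auto simp: vec_uncopy_def axis_def vec_eq_iff)
  then show "matrix (vec_copy \<circ> L \<circ> vec_uncopy) $ i $ j = matrix L $ of_copy i $ of_copy j" for i j
    by (simp add: matrix_def vec_copy_def)
qed

lemma has_derivative_copy:
  assumes "(g has_derivative g') (at x within S)"
  shows "((vec_copy \<circ> g \<circ> vec_uncopy) has_derivative (vec_copy \<circ> g' \<circ> vec_uncopy))
           (at (vec_copy x) within vec_copy ` S)"
proof -
  have 1: "(vec_uncopy has_derivative vec_uncopy) (at (vec_copy x) within vec_copy ` S)"
    by (rule bounded_linear_imp_has_derivative[OF bounded_linear_vec_uncopy])
  have "vec_uncopy ` vec_copy ` S = S" by (simp add: image_image)
  with assms have 2: "(g has_derivative g') (at (vec_uncopy (vec_copy x)) within vec_uncopy ` vec_copy ` S)"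
    by simp
  have 3: "(vec_copy has_derivative vec_copy) (at ((g \<circ> vec_uncopy) (vec_copy x)) within T)" for T
    by (rule bounded_linear_imp_has_derivative[OF bounded_linear_vec_copy])
  show ?thesis
    using diff_chain_within[OF diff_chain_within[OF 1 2] 3] by (simp add: comp_def)
qed

text \<open>Change of variables comes in the form: one side has the finite value \<open>b\<close>
  iff the other does. Ranging over all finite \<open>b\<close> also settles the infinite case, since
  then neither side has a finite value.\<close>

lemma ennreal_eqI_real:
  fixes x y :: ennreal
  assumes *: "\<And>b. 0 \<le> b \<Longrightarrow> x = ennreal b \<longleftrightarrow> y = ennreal b"
  shows "x = y"
proof (cases x)
  case (real r)
  with *[of r] show ?thesis by simp
next
  case top
  with * show ?thesis by (cases y) auto
qed

lemma nn_integral_substitution_ordered: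
  fixes g :: "real^'n::{finite,wellorder} \<Rightarrow> real^'n::_" and F :: "real^'n::_ \<Rightarrow> real"
  assumes S: "S \<in> sets borel" and gS: "g ` S \<in> sets borel"
    and der: "\<And>x. x \<in> S \<Longrightarrow> (g has_derivative g' x) (at x within S)"
    and inj: "inj_on g S"
    and F: "F \<in> borel_measurable borel" and F_nonneg: "\<And>y. 0 \<le> F y"
    and G: "(\<lambda>x. indicator S x * (\<bar>det (matrix (g' x))\<bar> * F (g x))) \<in> borel_measurable borel"
  shows "(\<integral>\<^sup>+x. ennreal (indicator S x * (\<bar>det (matrix (g' x))\<bar> * F (g x))) \<partial>lborel) =
         (\<integral>\<^sup>+y. ennreal (indicator (g ` S) y * F y) \<partial>lborel)"
proof -
  \<comment> \<open>The change of variables theorem concerns vector-valued integrands, so scalar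
    functions are embedded into \<open>real^1\<close> and read back by the equivalence
    \<open>lift\<close>.\<close>
  define f1 :: "real^'n::_ \<Rightarrow> real^1" where "f1 = (\<lambda>y. vec (F y))"
  let ?D = "\<lambda>x. \<bar>det (matrix (g' x))\<bar>"
  have cov: "(\<lambda>x. ?D x *\<^sub>R f1 (g x)) absolutely_integrable_on S \<and> integral S (\<lambda>x. ?D x *\<^sub>R f1 (g x)) = b
     \<longleftrightarrow> f1 absolutely_integrable_on (g ` S) \<and> integral (g ` S) f1 = b" for b
    by (rule has_absolute_integral_change_of_variables) (use S der inj in auto)
  have vec: "vec a = a *\<^sub>R (1 :: real^1)" for a
    by (simp add: vec_eq_iff)
  have bl: "bounded_linear (\<lambda>a :: real. vec a :: real^1)" "bounded_linear (\<lambda>x :: real^1. x $ 1)"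
    unfolding vec by (rule bounded_linear_scaleR_left) (rule bounded_linear_vec_nth)
  have lift: "(\<lambda>x. vec (f x) :: real^1) absolutely_integrable_on T \<and> integral T (\<lambda>x. vec (f x) :: real^1) = vec b
      \<longleftrightarrow> f absolutely_integrable_on T \<and> integral T f = b" for f :: "real^'n::_ \<Rightarrow> real" and T b
  proof -
    have "(\<lambda>x. vec (f x) :: real^1) absolutely_integrable_on T \<longleftrightarrow> f absolutely_integrable_on T"
      using absolutely_integrable_linear[OF _ bl(1), of T f] absolutely_integrable_linear[OF _ bl(2), of T "\<lambda>x. vec (f x)"]
      by (auto simp: comp_def)
    moreover have "integral T (\<lambda>x. vec (f x) :: real^1) = vec (integral T f)" if "f absolutely_integrable_on T"
      using integral_linear[OF set_lebesgue_integral_eq_integral(1)[OF that] bl(1)] by (simp add: comp_def)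
    ultimately show ?thesis by (auto simp: vec_eq_iff)
  qed
  have cov': "(\<lambda>x. ?D x * F (g x)) absolutely_integrable_on S \<and> integral S (\<lambda>x. ?D x * F (g x)) = b
     \<longleftrightarrow> F absolutely_integrable_on (g ` S) \<and> integral (g ` S) F = b" for b
    using cov[of "vec b"] lift[where f="\<lambda>x. ?D x * F (g x)" and T=S and b=b] lift[where f=F and T="g ` S" and b=b]
    by (simp add: f1_def vec)
  have nn: "(\<integral>\<^sup>+x. ennreal (indicator T x * f x) \<partial>lborel) = ennreal b \<longleftrightarrow> f absolutely_integrable_on T \<and> integral T f = b"
    if "(\<lambda>x. indicator T x * f x) \<in> borel_measurable borel" "\<And>x. 0 \<le> f x" "0 \<le> b"
    for f :: "real^'n::_ \<Rightarrow> real" and T b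
  proof
    assume *: "(\<integral>\<^sup>+x. ennreal (indicator T x * f x) \<partial>lborel) = ennreal b"
    have "((\<lambda>x. indicator T x * f x) has_integral b) UNIV"
      using that * by (intro nn_integral_has_integral) auto
    moreover have "(\<lambda>x. indicator T x * f x) = (\<lambda>x. if x \<in> T then f x else 0)"
      by (auto simp: indicator_def)
    ultimately have "(f has_integral b) T"
      using has_integral_restrict_UNIV[of T f b] by simp
    then show "f absolutely_integrable_on T \<and> integral T f = b"
      using that(2) by (auto intro!: nonnegative_absolutely_integrable_1 simp: integral_unique integrable_on_def)
  next
    assume *: "f absolutely_integrable_on T \<and> integral T f = b"
    then have "(f has_integral b) T"
      using set_lebesgue_integral_eq_integral(1) has_integral_integral by blast
    from nn_integral_has_integral_lebesgue[OF _ this] that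
    show "(\<integral>\<^sup>+x. ennreal (indicator T x * f x) \<partial>lborel) = ennreal b" 
      by (simp add: ac_simps)
  qed
  let ?L = "\<integral>\<^sup>+x. ennreal (indicator S x * (?D x * F (g x))) \<partial>lborel"
  let ?R = "\<integral>\<^sup>+y. ennreal (indicator (g ` S) y * F y) \<partial>lborel"
  have mR: "(\<lambda>y. indicator (g ` S) y * F y) \<in> borel_measurable borel"
    using gS F by simp
  have "?L = ennreal b \<longleftrightarrow> ?R = ennreal b" if "0 \<le> b" for b
    using nn[OF G _ that] nn[OF mR F_nonneg that] cov'[of b] F_nonneg by simp
  then show ?thesis by (rule ennreal_eqI_real)
qed

text \<open>Derivatives are taken within \<open>S\<close>, so \<open>S\<close> may be any Borel
  piece of a chart. Measurability of the integrand is a separate hypothesis because \<open>g\<close>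
  and \<open>g'\<close> are controlled only on \<open>S\<close>.\<close>

lemma nn_integral_substitution:
  fixes g :: "real^'n \<Rightarrow> real^'n" and F :: "real^'n \<Rightarrow> real"
  assumes S: "S \<in> sets borel" and gS: "g ` S \<in> sets borel"
    and der: "\<And>x. x \<in> S \<Longrightarrow> (g has_derivative g' x) (at x within S)"
    and inj: "inj_on g S"
    and F: "F \<in> borel_measurable borel" and F_nonneg: "\<And>y. 0 \<le> F y"
    and G: "(\<lambda>x. indicator S x * (\<bar>det (matrix (g' x))\<bar> * F (g x))) \<in> borel_measurable borel"
  shows "(\<integral>\<^sup>+x. ennreal (indicator S x * (\<bar>det (matrix (g' x))\<bar> * F (g x))) \<partial>lborel) =
         (\<integral>\<^sup>+y. ennreal (indicator (g ` S) y * F y) \<partial>lborel)"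
proof -
  let ?g = "vec_copy \<circ> g \<circ> vec_uncopy" and ?g' = "\<lambda>y. vec_copy \<circ> g' (vec_uncopy y) \<circ> vec_uncopy"
  let ?S = "vec_copy ` S"
  have img: "vec_copy ` A = vec_uncopy -` A" for A :: "(real^'n) set"
    by (auto intro!: image_eqI[where x="vec_uncopy _"])
  have ind: "indicator ?S y = (indicator S (vec_uncopy y) :: real)" for y
    unfolding img by (simp add: indicator_def)
  have gi: "?g ` ?S = vec_copy ` g ` S" by (auto simp: image_image)
  have ind2: "indicator (?g ` ?S) y = (indicator (g ` S) (vec_uncopy y) :: real)" for y
    unfolding gi by (simp add: img indicator_def)
  have "(\<integral>\<^sup>+x. ennreal (indicator S x * (\<bar>det (matrix (g' x))\<bar> * F (g x))) \<partial>lborel) =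
     (\<integral>\<^sup>+y. ennreal (indicator S (vec_uncopy y) * (\<bar>det (matrix (g' (vec_uncopy y)))\<bar> * F (g (vec_uncopy y)))) \<partial>lborel)"
    using measurable_compose[OF borel_measurable_vec_uncopy G]
    by (subst distr_lborel_vec_copy[symmetric], subst nn_integral_distr) auto
  also have "\<dots> = (\<integral>\<^sup>+y. ennreal (indicator ?S y * (\<bar>det (matrix (?g' y))\<bar> * F (vec_uncopy (?g y)))) \<partial>lborel)"
    by (simp only: ind det_matrix_copy) simp
  also have "\<dots> = (\<integral>\<^sup>+y. ennreal (indicator (?g ` ?S) y * F (vec_uncopy y)) \<partial>lborel)"
  proof (rule nn_integral_substitution_ordered)
    show "?S \<in> sets borel"
      unfolding img using measurable_sets_borel[OF borel_measurable_vec_uncopy S] .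
    show "?g ` ?S \<in> sets borel"
      unfolding gi using measurable_sets_borel[OF borel_measurable_vec_uncopy gS] by (simp only: img)
    show "(?g has_derivative ?g' y) (at y within ?S)" if "y \<in> ?S" for y
      using that has_derivative_copy[OF der] by auto
    show "inj_on ?g ?S"
      using inj by (auto simp: inj_on_def) (metis vec_copy_uncopy(2))
    show "(\<lambda>x. F (vec_uncopy x)) \<in> borel_measurable borel"
      using measurable_compose[OF borel_measurable_vec_uncopy F] .
    show "(\<lambda>y. indicator ?S y * (\<bar>det (matrix (?g' y))\<bar> * F (vec_uncopy (?g y)))) \<in> borel_measurable borel"
      unfolding ind det_matrix_copy
      using measurable_compose[OF borel_measurable_vec_uncopy G] by simp
  qed (rule F_nonneg)
  also have "\<dots> = (\<integral>\<^sup>+y. ennreal (indicator (g ` S) (vec_uncopy y) * F (vec_uncopy y)) \<partial>lborel)"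
    by (simp only: ind2)
  also have "\<dots> = (\<integral>\<^sup>+y. ennreal (indicator (g ` S) y * F y) \<partial>lborel)"
    using F gS by (subst distr_lborel_vec_copy[symmetric], subst nn_integral_distr) auto
  finally show ?thesis .
qed

text \<open>The equidimensional case of Sard's theorem, valid for maps that are merely
  differentiable. It makes the critical values of \<open>v\<close> and of the chart maps
  null.\<close>

lemma negligible_image_singular:
  fixes g :: "real^'n \<Rightarrow> real^'n"
  assumes der: "\<And>x. x \<in> S \<Longrightarrow> (g has_derivative g' x) (at x within S)"
    and sing: "\<And>x. x \<in> S \<Longrightarrow> det (matrix (g' x)) = 0"
  shows "negligible (g ` S)"
proof -
  let ?g = "vec_copy \<circ> g \<circ> vec_uncopy" and ?g' = "\<lambda>y. vec_copy \<circ> g' (vec_uncopy y) \<circ> vec_uncopy"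
  have "negligible (?g ` vec_copy ` S)"
  proof (rule baby_Sard)
    fix y assume "y \<in> vec_copy ` S"
    then obtain x where x: "x \<in> S" "y = vec_copy x" by auto
    show "(?g has_derivative ?g' y) (at y within vec_copy ` S)"
      using has_derivative_copy[OF der[OF x(1)]] by (simp add: x)
    have "det (matrix (?g' y)) = 0"
      using sing[OF x(1)] det_matrix_copy[of "g' x"] by (simp add: x)
    then show "rank (matrix (?g' y)) < CARD('n ordered_copy)"
      unfolding det_eq_0_rank .
  qed simp
  then have "negligible (vec_uncopy ` ?g ` vec_copy ` S)"
    by (rule negligible_differentiable_image_negligible[rotated])
       (use bij_betw_same_card[OF bij_of_copy[where ?'a='n]] in \<open>auto intro!: linear_imp_differentiable_on bounded_linear.linear bounded_linear_vec_uncopy\<close>)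
  moreover have "vec_uncopy ` ?g ` vec_copy ` S = g ` S"
    by (simp add: image_image)
  ultimately show ?thesis by simp
qed

section \<open>Derivatives on zero sets and local inverses\<close>

text \<open>By translation invariance the measure of \<open>E\<close> is the average over \<tau> in
  [0,1] of the measures of its translates by multiples of \<open>e\<close>. Exchanging the integrals
  leaves inner integrals along lines, which vanish; no basis adapted to \<open>e\<close> has to be
  chosen.\<close>

lemma null_set_if_null_on_lines:
  fixes E :: "'a::euclidean_space set"
  assumes E [measurable]: "E \<in> sets borel"
    and lines: "\<And>p. AE \<tau> in lborel. p + \<tau> *\<^sub>R e \<notin> E"
  shows "E \<in> null_sets lborel"
proof -
  have shift: "(\<integral>\<^sup>+p. indicator E (p + c) \<partial>lborel) = emeasure lborel E" for c
  proof -
    have "emeasure lborel E = (\<integral>\<^sup>+p. indicator E p \<partial>distr lborel borel ((+) c))"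
      by (simp add: lborel_distr_plus)
    also have "\<dots> = (\<integral>\<^sup>+p. indicator E (p + c) \<partial>lborel)"
      by (subst nn_integral_distr) (auto simp: add.commute)
    finally show ?thesis by simp
  qed
  have "emeasure lborel E = (\<integral>\<^sup>+\<tau>. indicator {0..1::real} \<tau> * emeasure lborel E \<partial>lborel)"
    by (simp add: nn_integral_multc)
  also have "\<dots> = (\<integral>\<^sup>+\<tau>. \<integral>\<^sup>+p. indicator {0..1} \<tau> * indicator E (p + \<tau> *\<^sub>R e) \<partial>lborel \<partial>lborel)"
    by (simp add: nn_integral_cmult shift)
  also have "\<dots> = (\<integral>\<^sup>+p. \<integral>\<^sup>+\<tau>. indicator {0..1} \<tau> * indicator E (p + \<tau> *\<^sub>R e) \<partial>lborel \<partial>lborel)"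
    by (rule lborel_pair.Fubini'[symmetric]) (simp add: split_beta')
  also have "\<dots> = (\<integral>\<^sup>+p. 0 \<partial>(lborel :: 'a measure))"
  proof (rule nn_integral_cong)
    fix p
    have "(\<integral>\<^sup>+\<tau>. indicator {0..1::real} \<tau> * indicator E (p + \<tau> *\<^sub>R e) \<partial>lborel) = (\<integral>\<^sup>+\<tau>. 0 \<partial>(lborel :: real measure))"
      using lines[of p] by (intro nn_integral_cong_AE) (auto simp: indicator_def)
    then show "(\<integral>\<^sup>+\<tau>. indicator {0..1::real} \<tau> * indicator E (p + \<tau> *\<^sub>R e) \<partial>lborel) = 0" by simp
  qed
  finally show ?thesis by (simp add: null_sets_def)
qed

text \<open>On each line in direction \<open>e\<close> the offending points are isolated: where the
  directional derivative is nonzero, \<open>H\<close> does not return to 0 nearby, whereas it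
  vanishes on all of \<open>Z\<close>. So each line meets them in a null set.\<close>

lemma AE_derivative_zero_on_zero_set:
  fixes H :: "'a::euclidean_space \<Rightarrow> real"
  assumes Z: "\<And>p. p \<in> Z \<Longrightarrow> H p = 0"
    and der: "\<And>p. p \<in> Z \<Longrightarrow> (H has_derivative H' p) (at p)"
    and meas: "{p \<in> Z. H' p e \<noteq> 0} \<in> sets borel"
  shows "AE p in lborel. p \<in> Z \<longrightarrow> H' p e = 0"
proof -
  let ?E = "{p \<in> Z. H' p e \<noteq> 0}"
  have "AE \<tau> in lborel. p + \<tau> *\<^sub>R e \<notin> ?E" for p
  proof -
    let ?S = "{\<tau>. p + \<tau> *\<^sub>R e \<in> ?E}"
    \<comment> \<open>An isolated point has a ball meeting \<open>?S\<close> in that point alone, so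
      the density criterion for null sets holds with the singleton as cover.\<close>
    have "negligible ?S"
      unfolding negligible_eq_zero_density
    proof (intro ballI allI impI)
      fix \<tau> r \<epsilon> :: real assume \<tau>: "\<tau> \<in> ?S" and r: "0 < r" and \<epsilon>: "0 < \<epsilon>"
      let ?h = "\<lambda>\<tau>. H (p + \<tau> *\<^sub>R e)"
      have line: "((\<lambda>\<tau>. p + \<tau> *\<^sub>R e) has_derivative (\<lambda>s. s *\<^sub>R e)) (at \<tau>)"
        by (auto intro!: derivative_eq_intros)
      have lin: "linear (H' (p + \<tau> *\<^sub>R e))"
        using \<tau> der has_derivative_linear by blast
      have "(?h has_derivative (\<lambda>s. H' (p + \<tau> *\<^sub>R e) (s *\<^sub>R e))) (at \<tau>)"
        using diff_chain_at[OF line der] \<tau> by (simp add: comp_def)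
      then have "(?h has_real_derivative H' (p + \<tau> *\<^sub>R e) e) (at \<tau>)"
        by (simp add: has_field_derivative_def linear_cmul[OF lin] mult.commute[of _ "H' _ _"])
      then have "((\<lambda>\<tau>'. (?h \<tau>' - ?h \<tau>) / (\<tau>' - \<tau>)) \<longlongrightarrow> H' (p + \<tau> *\<^sub>R e) e) (at \<tau>)"
        by (simp add: has_field_derivative_iff)
      then have "\<forall>\<^sub>F \<tau>' in at \<tau>. (?h \<tau>' - ?h \<tau>) / (\<tau>' - \<tau>) \<noteq> 0"
        using \<tau> by (intro tendsto_imp_eventually_ne) auto
      then obtain d where d: "d > 0" "\<And>\<tau>'. \<tau>' \<noteq> \<tau> \<Longrightarrow> dist \<tau>' \<tau> < d \<Longrightarrow> ?h \<tau>' \<noteq> ?h \<tau>"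
        unfolding eventually_at by auto
      have "?S \<inter> ball \<tau> (min d r) \<subseteq> {\<tau>}"
        using d(2) \<tau> Z by (auto simp: dist_commute) metis
      moreover have "measure lebesgue {\<tau>} < \<epsilon> * measure lebesgue (ball \<tau> (min d r))"
        using \<epsilon> d r by (simp add: content_ball_pos)
      ultimately show "\<exists>d>0. d \<le> r \<and> (\<exists>U. ?S \<inter> ball \<tau> d \<subseteq> U \<and> U \<in> lmeasurable \<and>
          measure lebesgue U < \<epsilon> * measure lebesgue (ball \<tau> d))"
        using d(1) r by (intro exI[of _ "min d r"] conjI exI[of _ "{\<tau>}"]) (auto intro: lmeasurable_compact)
    qed
    then have "?S \<in> null_sets lebesgue" by (simp add: negligible_iff_null_sets)
    then have "AE \<tau> in lebesgue. \<tau> \<notin> ?S" by (rule AE_not_in)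
    then show ?thesis by (simp add: AE_completion_iff)
  qed
  then have "AE p in lborel. p \<notin> ?E"
    by (intro AE_not_in null_set_if_null_on_lines[OF meas])
  then show ?thesis by auto
qed

lemma borel_measurable_fst_borel [measurable]: "fst \<in> (borel :: ('a::second_countable_topology \<times> 'b::second_countable_topology) measure) \<rightarrow>\<^sub>M borel"
  and borel_measurable_snd_borel [measurable]: "snd \<in> (borel :: ('a \<times> 'b) measure) \<rightarrow>\<^sub>M borel"
  by (auto intro!: borel_measurable_continuous_onI continuous_intros)

section \<open>Exchanging one coordinate with a level parameter\<close>

definition replace_coord :: "'n \<Rightarrow> real \<Rightarrow> real^'n \<Rightarrow> real^'n" where
  "replace_coord i t y = (\<chi> l. if l = i then t else y $ l)"

lemma replace_coord_nth [simp]: "replace_coord i t y $ l = (if l = i then t else y $ l)"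
  by (simp add: replace_coord_def)

lemma replace_coord_replace_coord [simp]: "replace_coord i t (replace_coord i s y) = replace_coord i t y"
  by (simp add: vec_eq_iff)

lemma replace_coord_same [simp]: "replace_coord i (y $ i) y = y"
  by (simp add: vec_eq_iff)

lemma bounded_linear_replace_coord: "bounded_linear (\<lambda>p. replace_coord i (snd p) (fst p) :: real^'n)"
  by (auto intro!: linear_conv_bounded_linear[THEN iffD1] linearI simp: vec_eq_iff)

lemma continuous_on_replace_coord [continuous_intros]:
  assumes "continuous_on S f" "continuous_on S g"
  shows "continuous_on S (\<lambda>x. replace_coord i (f x) (g x) :: real^'n)"
  using bounded_linear.continuous_on[OF bounded_linear_replace_coord continuous_on_Pair[OF assms(2,1)]] by simp

lemma measurable_replace_coord [measurable (raw)]: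
  assumes [measurable]: "f \<in> borel_measurable M" "g \<in> borel_measurable M"
  shows "(\<lambda>x. replace_coord i (f x) (g x) :: real^'n) \<in> borel_measurable M"
  using measurable_compose[OF borel_measurable_Pair[OF assms(2,1)],
      OF borel_measurable_continuous_onI[OF linear_continuous_on[OF bounded_linear_replace_coord]]] by simp

text \<open>If \<open>fst p\<close> holds the chart coordinates of a point, with its level in place
  \<open>i\<close>, and \<open>snd p\<close> is the level of a second point of the same fibre, then
  this involution yields the coordinates of the second point and the level of the first.\<close>

abbreviation swap_coord :: "'n::finite \<Rightarrow> (real^'n) \<times> real \<Rightarrow> (real^'n) \<times> real" where
  "swap_coord i p \<equiv> (replace_coord i (snd p) (fst p), fst p $ i)"

lemma borel_measurable_swap_coord [measurable]: "swap_coord i \<in> borel_measurable borel"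
  by (intro borel_measurable_continuous_onI continuous_intros)

lemma distr_swap_coord: "distr lborel borel (swap_coord i) = (lborel :: ((real^'n) \<times> real) measure)"
proof (rule lborel_distr_permute_coordinates)
  let ?a = "(axis i 1, 0) :: (real^'n) \<times> real" and ?b = "(0, 1) :: (real^'n) \<times> real"
  have "?a \<in> Basis" "?b \<in> Basis" by (auto simp: Basis_prod_def Basis_vec_def)
  then show "bij_betw (Transposition.transpose ?a ?b) Basis Basis"
    by (auto intro!: bij_betw_byWitness[where f'="Transposition.transpose ?a ?b"] simp: Transposition.transpose_def)
  fix x b :: "(real^'n) \<times> real" assume "b \<in> Basis"
  then have "b = ?b \<or> (\<exists>l. b = (axis l 1, 0))"
    by (auto simp: Basis_prod_def Basis_vec_def)
  then consider "b = ?a" | "b = ?b" | l where "l \<noteq> i" "b = (axis l 1, 0)"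
    by metis
  then show "swap_coord i x \<bullet> b = x \<bullet> Transposition.transpose ?a ?b b"
    by cases (auto simp: inner_prod_def inner_axis Transposition.transpose_def axis_eq_axis split: prod.splits)
qed (rule borel_measurable_swap_coord)

lemma nn_integral_swap_coord:
  assumes "F \<in> borel_measurable borel"
  shows "(\<integral>\<^sup>+p. F (swap_coord i p) \<partial>lborel) = (\<integral>\<^sup>+p. F p \<partial>(lborel :: ((real^'n) \<times> real) measure))"
proof -
  have "(\<integral>\<^sup>+p. F p \<partial>(lborel :: ((real^'n) \<times> real) measure)) = (\<integral>\<^sup>+p. F p \<partial>distr lborel borel (swap_coord i))"
    by (simp only: distr_swap_coord)
  also have "\<dots> = (\<integral>\<^sup>+p. F (swap_coord i p) \<partial>lborel)"
    using assms by (intro nn_integral_distr) (simp_all add: borel_measurable_swap_coord)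
  finally show ?thesis by simp
qed

text \<open>The map is the first component of the measure-preserving \<open>swap_coord i\<close>, so
  the preimage of \<open>N\<close> has the measure of the cylinder over \<open>N\<close>.\<close>

lemma AE_replace_coord_notin:
  fixes N :: "(real^'n) set"
  assumes N: "N \<in> null_sets lborel"
  shows "AE p in lborel. replace_coord i (snd p) (fst p) \<notin> N"
proof -
  have [measurable]: "N \<in> sets borel" using N by auto
  have "(\<integral>\<^sup>+p. indicator N (replace_coord i (snd p) (fst p)) \<partial>lborel) =
      (\<integral>\<^sup>+p. indicator N (fst p) \<partial>(lborel :: ((real^'n) \<times> real) measure))"
    using nn_integral_swap_coord[of "\<lambda>p. indicator N (fst p)" i] by simp
  also have "\<dots> = (\<integral>\<^sup>+t. \<integral>\<^sup>+y. indicator N y \<partial>lborel \<partial>(lborel :: real measure))"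
    unfolding lborel_prod[symmetric]
    by (subst lborel_pair.nn_integral_snd[symmetric]) (auto simp: split_beta')
  also have "\<dots> = 0" using null_setsD1[OF N] by simp
  finally have "AE p in lborel. (indicator N (replace_coord i (snd p) (fst p)) :: ennreal) = 0"
    by (subst (asm) nn_integral_0_iff_AE) auto
  then show ?thesis by eventually_elim (auto simp: indicator_def split: if_splits)
qed

section \<open>Countable families of local inverses\<close>

text \<open>\<open>\<sigma>\<close> is a total Borel function, so that compositions with it stay
  Borel; the equations are required only on \<open>V\<close> and \<open>W\<close>. Only the
  existence of its derivative is recorded, since the chain rule determines what is needed of its
  value.\<close>

definition local_inverse :: "('a::euclidean_space \<Rightarrow> 'a) \<Rightarrow> 'a set \<Rightarrow> 'a set \<Rightarrow> ('a \<Rightarrow> 'a) \<Rightarrow> bool" where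
  "local_inverse f V W \<sigma> \<longleftrightarrow> open V \<and> open W \<and> \<sigma> \<in> borel_measurable borel \<and>
     (\<forall>x\<in>V. f x \<in> W \<and> \<sigma> (f x) = x) \<and>
     (\<forall>y\<in>W. \<sigma> y \<in> V \<and> f (\<sigma> y) = y \<and> (\<exists>D. (\<sigma> has_derivative D) (at y)))"

lemma open_det_nonzero:
  fixes f' :: "real^'n \<Rightarrow> (real^'n) \<Rightarrow>\<^sub>L (real^'n)"
  assumes "open U" "continuous_on U f'"
  shows "continuous_on U (\<lambda>x. det (matrix (blinfun_apply (f' x))))"
    and "open {x \<in> U. det (matrix (blinfun_apply (f' x))) \<noteq> 0}"
proof -
  have [intro!]: "continuous_on U (\<lambda>x. blinfun_apply (f' x) (axis j 1) $ i)" for i j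
    by (intro continuous_intros assms)
  then show *: "continuous_on U (\<lambda>x. det (matrix (blinfun_apply (f' x))))"
    unfolding det_def matrix_def vec_lambda_beta
    by (intro continuous_on_sum continuous_on_mult continuous_on_prod continuous_on_const)
  show "open {x \<in> U. det (matrix (blinfun_apply (f' x))) \<noteq> 0}"
    using continuous_open_preimage[OF * assms(1) open_Compl[OF closed_singleton[of 0]]] by (simp add: vimage_def Int_def)
qed

text \<open>The inverse function theorem covers the set of invertibility by open sets with local
  inverses, and Lindelof's theorem extracts a countable subfamily.\<close>

lemma local_inverse_cover:
  fixes f :: "real^'n \<Rightarrow> real^'n" and f' :: "real^'n \<Rightarrow> (real^'n) \<Rightarrow>\<^sub>L (real^'n)"
  assumes U: "open U"
    and der: "\<And>x. x \<in> U \<Longrightarrow> (f has_derivative blinfun_apply (f' x)) (at x)"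
    and cont: "continuous_on U f'"
  shows "\<exists>V W \<sigma>. (\<forall>n::nat. local_inverse f (V n) (W n) (\<sigma> n)) \<and>
    (\<Union>n. V n) = {x \<in> U. det (matrix (blinfun_apply (f' x))) \<noteq> 0}"
proof -
  define R where "R = {x \<in> U. det (matrix (blinfun_apply (f' x))) \<noteq> 0}"
  have R: "open R" "R \<subseteq> U" using open_det_nonzero[OF U cont] by (auto simp: R_def)
  define \<F> where "\<F> = {V. V \<subseteq> R \<and> (\<exists>W \<sigma>. local_inverse f V W \<sigma>)}"
  have ex: "\<exists>V\<in>\<F>. x \<in> V" if x: "x \<in> R" for x
  proof -
    have "invertible (matrix (blinfun_apply (f' x)))"
      using x by (simp add: R_def invertible_det_nz)
    then obtain B where B: "B ** matrix (blinfun_apply (f' x)) = mat 1"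
      by (auto simp: invertible_def)
    have inv: "Blinfun ((*v) B) o\<^sub>L f' x = id_blinfun"
    proof (rule blinfun_eqI)
      fix z
      have "B *v (blinfun_apply (f' x) z) = B *v (matrix (blinfun_apply (f' x)) *v z)"
        by (simp add: matrix_works bounded_linear.linear blinfun.bounded_linear_right)
      also have "\<dots> = z" by (simp add: matrix_vector_mul_assoc B)
      finally show "blinfun_apply (Blinfun ((*v) B) o\<^sub>L f' x) z = blinfun_apply id_blinfun z"
        by (simp add: bounded_linear_Blinfun_apply linear_linear)
    qed
    have der': "\<And>x. x \<in> R \<Longrightarrow> (f has_derivative blinfun_apply (f' x)) (at x)"
      using der R(2) by auto
    obtain V W g g' where *: "open V" "V \<subseteq> R" "x \<in> V" "open W" "f x \<in> W" "homeomorphism V W f g"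
        "\<And>y. y \<in> W \<Longrightarrow> (g has_derivative (g' y)) (at y)"
        "\<And>y. y \<in> W \<Longrightarrow> g' y = inv (blinfun_apply (f' (g y)))"
        "\<And>y. y \<in> W \<Longrightarrow> bij (blinfun_apply (f' (g y)))"
      by (rule inverse_function_theorem[OF R(1) der' continuous_on_subset[OF cont R(2)] x inv])
         (assumption | rule that; assumption)+
    \<comment> \<open>Setting the inverse to 0 off the open set \<open>W\<close> makes it Borel
      without affecting derivatives inside \<open>W\<close>.\<close>
    let ?\<sigma> = "\<lambda>y. indicator W y *\<^sub>R g y"
    have "continuous_on W g" using *(6) by (simp add: homeomorphism_def)
    then have "?\<sigma> \<in> borel_measurable borel"
      using *(4) by (intro borel_measurable_continuous_on_indicator) auto
    moreover have "(?\<sigma> has_derivative g' y) (at y)" if "y \<in> W" for y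
      by (rule has_derivative_transform_within_open[OF *(7)[OF that] *(4) that]) simp
    ultimately have "local_inverse f V W ?\<sigma>"
      using * by (auto simp: local_inverse_def homeomorphism_def)
    with * show ?thesis by (auto simp: \<F>_def)
  qed
  have "\<And>S. S \<in> \<F> \<Longrightarrow> open S" by (auto simp: \<F>_def local_inverse_def)
  then obtain \<F>' where \<F>': "\<F>' \<subseteq> \<F>" "countable \<F>'" "\<Union>\<F>' = \<Union>\<F>"
    using Lindelof by metis
  \<comment> \<open>The empty chart makes an enumeration by naturals possible even when the subcover
    is empty.\<close>
  have "local_inverse f {} {} (\<lambda>_. 0)" by (simp add: local_inverse_def)
  then have "{} \<in> \<F>" by (auto simp: \<F>_def)
  define V where "V = from_nat_into (insert {} \<F>')"
  have rV: "range V = insert {} \<F>'"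
    unfolding V_def using \<F>'(2) by (intro range_from_nat_into) auto
  then have V\<F>: "V n \<in> \<F>" for n
    using rangeI[of V n] \<open>{} \<in> \<F>\<close> \<F>'(1) unfolding rV by auto
  then have "\<forall>n. \<exists>W \<sigma>. local_inverse f (V n) W \<sigma>" by (auto simp: \<F>_def)
  then obtain W \<sigma> where "\<And>n. local_inverse f (V n) (W n) (\<sigma> n)" by metis
  moreover have "(\<Union>n. V n) = R"
  proof -
    have "(\<Union>n. V n) = \<Union>\<F>" using rV \<F>'(3) by simp
    also have "\<dots> = R" using ex by (auto simp: \<F>_def)
    finally show ?thesis .
  qed
  ultimately show ?thesis unfolding R_def by blast
qed

lemma negligible_local_inverse_preimage:
  assumes "local_inverse f V W \<sigma>" "negligible (f ` (A \<inter> V))"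
  shows "negligible (A \<inter> V)"
proof -
  have "\<sigma> differentiable_on f ` (A \<inter> V)"
    unfolding differentiable_on_def differentiable_def
  proof
    fix y assume "y \<in> f ` (A \<inter> V)"
    then obtain D where "(\<sigma> has_derivative D) (at y)"
      using assms(1) unfolding local_inverse_def by blast
    then show "\<exists>D. (\<sigma> has_derivative D) (at y within f ` (A \<inter> V))"
      using has_derivative_at_withinI by blast
  qed
  then have "negligible (\<sigma> ` f ` (A \<inter> V))"
    by (rule negligible_differentiable_image_negligible[OF order_refl assms(2)])
  moreover have "\<sigma> ` f ` (A \<inter> V) = A \<inter> V"
    using assms(1) by (force simp: local_inverse_def image_image)
  ultimately show ?thesis by simp
qed

text \<open>On each piece the local inverse, being differentiable, carries the null image back to a
  null set. Exceptional sets found in chart coordinates or in the image of \<open>v\<close> thus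
  become null sets of points.\<close>

lemma negligible_if_image_negligible:
  fixes f :: "real^'n \<Rightarrow> real^'n" and f' :: "real^'n \<Rightarrow> (real^'n) \<Rightarrow>\<^sub>L (real^'n)"
  assumes "open U" "\<And>x. x \<in> U \<Longrightarrow> (f has_derivative blinfun_apply (f' x)) (at x)" "continuous_on U f'"
    and A: "A \<subseteq> U" "\<And>x. x \<in> A \<Longrightarrow> det (matrix (blinfun_apply (f' x))) \<noteq> 0"
    and neg: "negligible (f ` A)"
  shows "negligible A"
proof -
  obtain V W \<sigma> where V: "\<And>n::nat. local_inverse f (V n) (W n) (\<sigma> n)"
    "(\<Union>n. V n) = {x \<in> U. det (matrix (blinfun_apply (f' x))) \<noteq> 0}"
    using local_inverse_cover[OF assms(1-3)] by auto
  have "negligible (\<Union>n. A \<inter> V n)"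
    by (intro negligible_Union_nat negligible_local_inverse_preimage[OF V(1)] negligible_subset[OF neg]) auto
  moreover have "A = (\<Union>n. A \<inter> V n)" using V(2) A by blast
  ultimately show ?thesis by simp
qed

section \<open>Lebesgue differentiation and Hausdorff null sets\<close>

text \<open>Vitali's covering theorem yields disjoint short intervals of large average covering
  almost all of the set. They lie in an open \<open>U\<close> that exceeds {\<beta> < r} only by
  little mass, so the integral of \<beta> over them is at most r times their length plus a small
  error, yet at least r' times their length. This forces the length to be small.\<close>

lemma negligible_small_value_large_averages:
  fixes \<beta> :: "real \<Rightarrow> real"
  assumes int: "integrable lborel \<beta>" and r: "r < r'"
  shows "negligible {x. \<beta> x < r \<and> (\<forall>d>0. \<exists>p q. p \<le> x \<and> x \<le> q \<and> p < q \<and> q - p < d \<and>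
           r' * (q - p) < (LINT t:{p..q}|lborel. \<beta> t))}" (is "negligible ?S")
proof -
  have [measurable]: "\<beta> \<in> borel_measurable borel" using int by auto
  have "negligible (?S \<inter> {-R<..<R})" for R
    unfolding negligible_outer
  proof (intro allI impI)
    fix e :: real assume e: "0 < e"
    define B where "B = {x. \<beta> x < r} \<inter> {-R<..<R}"
    have [measurable]: "B \<in> sets borel" unfolding B_def by measurable
    \<comment> \<open>\<open>\<rho>\<close> dominates \<open>\<beta> - r\<close> on the bounded
      window, so its mass controls what the parts of the covering intervals outside \<open>B\<close>
      contribute.\<close>
    define \<rho> where "\<rho> t = \<bar>\<beta> t\<bar> + \<bar>r\<bar> * indicator {-R<..<R} t" for t
    have \<rho>0: "0 \<le> \<rho> t" for t by (simp add: \<rho>_def)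
    have fR: "emeasure lborel {-R<..<R} < \<infinity>"
      by (rule emeasure_bounded_finite, rule bounded_subset[OF bounded_cbox[of "-R" R]]) auto
    have \<rho>_int: "integrable lborel \<rho>"
      unfolding \<rho>_def using int
      by (intro Bochner_Integration.integrable_add integrable_abs integrable_mult_right integrable_real_indicator)
         (use fR in auto)
    then have [measurable]: "\<rho> \<in> borel_measurable borel" by auto
    define M where "M = density lborel (\<lambda>t. ennreal (\<rho> t))"
    have sM: "sets M = sets borel" "space M = UNIV" by (simp_all add: M_def)
    have em: "emeasure M A = (\<integral>\<^sup>+t. ennreal (indicator A t * \<rho> t) \<partial>lborel)" if "A \<in> sets borel" for A
      using that by (auto simp: M_def emeasure_density intro!: nn_integral_cong split: split_indicator)
    have em_int: "emeasure M A = ennreal (LINT t:A|lborel. \<rho> t)" if "A \<in> sets borel" for A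
      unfolding em[OF that] set_lebesgue_integral_def using that \<rho>0
      by (subst nn_integral_eq_integral)
         (auto intro!: integrable_mult_indicator[OF _ \<rho>_int, simplified])
    have fin: "emeasure M A \<noteq> \<infinity>" if "A \<in> sets borel" for A
      using em_int[OF that] by simp
    \<comment> \<open>Chosen so that \<open>(r' - r) * length \<le> \<eta>\<close> makes the length
      at most \<open>e / 2\<close>.\<close>
    define \<eta> where "\<eta> = e * (r' - r) / 2"
    have \<eta>: "0 < \<eta>" using e r by (simp add: \<eta>_def)
    \<comment> \<open>Outer regularity is applied to the finite measure with density \<rho> rather
      than to Lebesgue measure, because the excess of \<open>U\<close> over \<open>B\<close> must be
      small in that mass.\<close>
    have "(INF U\<in>{U. B \<subseteq> U \<and> open U}. emeasure M U) = emeasure M B"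
      using outer_regular[of M B] sM fin[of UNIV] by simp
    moreover have "emeasure M B < emeasure M B + ennreal \<eta>"
      using fin[of B] \<eta> by (simp add: ennreal_less_iff less_top)
    ultimately obtain U0 where U0: "B \<subseteq> U0" "open U0" "emeasure M U0 < emeasure M B + ennreal \<eta>"
      by (metis (no_types, lifting) INF_less_iff mem_Collect_eq)
    define U where "U = U0 \<inter> {-R<..<R}"
    have U: "open U" "B \<subseteq> U" "U \<subseteq> {-R<..<R}" using U0 by (auto simp: U_def B_def)
    then have [measurable]: "U \<in> sets borel" "U0 \<in> sets borel" using U0 by auto
    have "emeasure M (U - B) \<le> emeasure M (U0 - B)"
      using U0 by (intro emeasure_mono) (auto simp: U_def sM)
    also have "\<dots> = emeasure M U0 - emeasure M B"
      using U0 fin[of B] by (intro emeasure_Diff) (auto simp: sM)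
    also have "\<dots> \<le> ennreal \<eta>"
      using U0(3) fin[of B] by (simp add: ennreal_minus_le_iff less_imp_le)
    finally have UB: "(LINT t:U - B|lborel. \<rho> t) \<le> \<eta>"
      using \<eta> by (subst (asm) em_int) auto
    define K where "K = {pq. fst pq < snd pq \<and> {fst pq..snd pq} \<subseteq> U \<and>
       r' * (snd pq - fst pq) < (LINT t:{fst pq..snd pq}|lborel. \<beta> t)}"
    define a rad where "a = (\<lambda>pq::real \<times> real. (fst pq + snd pq) / 2)" and "rad = (\<lambda>pq::real \<times> real. (snd pq - fst pq) / 2)"
    have cb: "cball (a pq) (rad pq) = {fst pq..snd pq}" for pq
      by (simp add: cball_eq_atLeastAtMost a_def rad_def field_simps)
    have cover: "\<exists>i. i \<in> K \<and> x \<in> cball (a i) (rad i) \<and> rad i < d"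
      if x: "x \<in> ?S \<inter> {-R<..<R}" and d: "0 < d" for x d
    proof -
      have "x \<in> U" using x U by (auto simp: B_def)
      then obtain \<delta> where \<delta>: "0 < \<delta>" "ball x \<delta> \<subseteq> U"
        using U(1) open_contains_ball by blast
      have "min \<delta> d > 0" using d \<delta> by simp
      then obtain p q where pq: "p \<le> x" "x \<le> q" "p < q" "q - p < min \<delta> d"
         "r' * (q - p) < (LINT t:{p..q}|lborel. \<beta> t)"
        using x by blast
      have "{p..q} \<subseteq> ball x \<delta>" using pq by (auto simp: dist_real_def)
      then have "(p, q) \<in> K" using pq \<delta> by (auto simp: K_def)
      moreover have "x \<in> cball (a (p, q)) (rad (p, q))" using pq by (simp only: cb) simp
      moreover have "rad (p, q) < d" using pq by (simp add: rad_def)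
      ultimately show ?thesis by blast
    qed
    obtain C where C: "countable C" "C \<subseteq> K"
        "pairwise (\<lambda>i j. disjnt (cball (a i) (rad i)) (cball (a j) (rad j))) C"
        "negligible ((?S \<inter> {-R<..<R}) - (\<Union>i\<in>C. cball (a i) (rad i)))"
      by (rule Vitali_covering_theorem_cballs[of K rad "?S \<inter> {-R<..<R}" a])
         (use cover in \<open>auto simp: K_def rad_def\<close>)
    define T where "T = (\<Union>i\<in>C. cball (a i) (rad i))"
    \<comment> \<open>The estimate is made for finite subfamilies, where integrals over disjoint
      unions add up, and passes to the countable family because the bound \<open>e / 2\<close> is
      uniform.\<close>
    have bound: "measure lebesgue (\<Union>i\<in>C0. cball (a i) (rad i)) \<le> e / 2"
      if C0: "C0 \<subseteq> C" "finite C0" for C0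
    proof -
      let ?I = "\<lambda>pq::real \<times> real. {fst pq..snd pq}" and ?T = "\<Union>i\<in>C0. cball (a i) (rad i)"
      have Tm [measurable]: "?T \<in> sets borel" using C0 by (intro sets.finite_UN) auto
      have TU: "?T \<subseteq> U" using C0 C(2) by (auto simp only: cb K_def)
      then have Tfin: "emeasure lborel ?T < \<infinity>"
        using emeasure_mono[of ?T "{-R<..<R}" lborel] U(3) fR by (simp add: le_less_trans subset_trans[OF _ U(3)])
      have disj: "disjoint_family_on (\<lambda>i. cball (a i) (rad i)) C0"
        using C(3) C0 unfolding disjoint_family_on_def pairwise_def disjnt_def by blast
      have si: "set_integrable lborel A \<beta>" if "A \<in> sets borel" for A
        using int that unfolding set_integrable_def by (intro integrable_mult_indicator) auto
      have "r' * measure lborel ?T = (\<Sum>i\<in>C0. r' * (snd i - fst i))"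
      proof -
        have "measure lborel ?T = (\<Sum>i\<in>C0. measure lborel (cball (a i) (rad i)))"
          using disj C0 by (intro measure_finite_Union) (auto simp: cb emeasure_lborel_Icc_eq)
        also have "\<dots> = (\<Sum>i\<in>C0. snd i - fst i)"
          using C0 C(2) by (intro sum.cong) (auto simp: cb K_def)
        finally show ?thesis by (simp add: sum_distrib_left)
      qed
      also have "\<dots> \<le> (\<Sum>i\<in>C0. LINT t:cball (a i) (rad i)|lborel. \<beta> t)"
        using C0 C(2) by (intro sum_mono) (auto simp: cb K_def)
      also have "\<dots> = (LINT t:?T|lborel. \<beta> t)"
        using C0 disj by (intro set_integral_finite_Union[symmetric] si) auto
      also have "\<dots> \<le> (\<integral>t. r * indicator ?T t + indicator (U - B) t * \<rho> t \<partial>lborel)"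
        unfolding set_lebesgue_integral_def
      proof (rule integral_mono)
        show "integrable lborel (\<lambda>t. indicator ?T t *\<^sub>R \<beta> t)"
          using si[OF Tm] by (simp add: set_integrable_def)
        show "integrable lborel (\<lambda>t. r * indicator ?T t + indicator (U - B) t * \<rho> t)"
          using Tfin integrable_mult_indicator[OF _ \<rho>_int, of "U - B"]
          by (intro Bochner_Integration.integrable_add integrable_mult_right integrable_real_indicator) auto
        fix t
        show "indicator ?T t *\<^sub>R \<beta> t \<le> r * indicator ?T t + indicator (U - B) t * \<rho> t"
        proof (cases "t \<in> ?T")
          case True
          then have "t \<in> U" by (rule TU[THEN subsetD])
          moreover from this have "t \<in> {-R<..<R}" by (rule U(3)[THEN subsetD])
          ultimately show ?thesis using True by (auto simp: B_def \<rho>_def indicator_def)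
        next
          case False
          then show ?thesis using \<rho>0[of t] by (simp add: indicator_def)
        qed
      qed
      also have "\<dots> = r * measure lborel ?T + (LINT t:U - B|lborel. \<rho> t)"
        using Tfin integrable_mult_indicator[OF _ \<rho>_int, of "U - B"]
        by (subst Bochner_Integration.integral_add) (auto simp: set_lebesgue_integral_def)
      finally have "(r' - r) * measure lborel ?T \<le> \<eta>"
        using UB by (simp add: algebra_simps)
      then have "(r' - r) * measure lborel ?T \<le> (r' - r) * (e / 2)"
        unfolding \<eta>_def by (simp add: mult.commute)
      then have "measure lborel ?T \<le> e / 2"
        by (rule mult_left_le_imp_le) (use r in simp)
      then show ?thesis by (simp add: measure_completion)
    qed
    have lm: "cball (a i) (rad i) \<in> lmeasurable" for i by simp
    have T: "T \<in> lmeasurable" "measure lebesgue T \<le> e / 2"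
      unfolding T_def using fmeasurable_UN_bound[OF C(1) lm bound] measure_UN_bound[OF C(1) lm bound] by auto
    let ?N = "(?S \<inter> {-R<..<R}) - T"
    have N: "?N \<in> lmeasurable" "measure lebesgue ?N = 0"
      using C(4) by (auto simp: T_def negligible_iff_measure)
    have le: "measure lebesgue (T \<union> ?N) < e"
      using measure_Un_le[of T lebesgue ?N] T N e by (simp add: fmeasurableD)
    have lm: "T \<union> ?N \<in> lmeasurable" by (intro fmeasurable.Un T N)
    show "\<exists>T. ?S \<inter> {-R<..<R} \<subseteq> T \<and> T \<in> lmeasurable \<and> measure lebesgue T < e"
      by (intro exI[of _ "T \<union> ?N"] conjI lm le) blast
  qed
  then have "negligible (\<Union>n::nat. ?S \<inter> {- real n<..<real n})"
    by (rule negligible_Union_nat)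
  moreover have "?S \<subseteq> (\<Union>n::nat. ?S \<inter> {- real n<..<real n})"
  proof
    fix x assume "x \<in> ?S"
    moreover obtain n :: nat where "\<bar>x\<bar> < real n" using reals_Archimedean2 by blast
    ultimately show "x \<in> (\<Union>n::nat. ?S \<inter> {- real n<..<real n})" by (auto intro!: exI[of _ n])
  qed
  ultimately show ?thesis by (rule negligible_subset)
qed

text \<open>If the bound failed for some \<epsilon>, two rationals between \<open>\<beta> x\<close>
  and \<open>\<beta> x + \<epsilon>\<close> would put \<open>x\<close> into one of countably many
  null sets. The intervals are only required to contain \<open>x\<close>, so that it may later be an
  endpoint.\<close>

lemma AE_averages_eventually_le:
  fixes \<beta> :: "real \<Rightarrow> real"
  assumes int: "integrable lborel \<beta>"
  shows "AE x in lebesgue. \<forall>\<epsilon>>0. \<exists>d>0. \<forall>p q. p \<le> x \<and> x \<le> q \<and> p < q \<and> q - p < d \<longrightarrow>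
           (LINT t:{p..q}|lborel. \<beta> t) \<le> (\<beta> x + \<epsilon>) * (q - p)"
proof -
  define S where "S r r' = {x. \<beta> x < r \<and> (\<forall>d>0. \<exists>p q. p \<le> x \<and> x \<le> q \<and> p < q \<and> q - p < d \<and>
           r' * (q - p) < (LINT t:{p..q}|lborel. \<beta> t))}" for r r'
  have "AE x in lebesgue. x \<notin> S r r'" if "r < r'" for r r'
    using negligible_small_value_large_averages[OF int that]
    by (intro AE_not_in) (simp add: S_def negligible_iff_null_sets)
  then have "AE x in lebesgue. \<forall>r\<in>\<rat>. \<forall>r'\<in>\<rat>. r < r' \<longrightarrow> x \<notin> S r r'"
    by (simp add: AE_ball_countable countable_rat)
  then show ?thesis
  proof eventually_elim
    case (elim x)
    show ?case
    proof (intro allI impI)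
      fix \<epsilon> :: real assume "0 < \<epsilon>"
      then obtain r' where r': "r' \<in> \<rat>" "\<beta> x < r'" "r' < \<beta> x + \<epsilon>"
        using Rats_dense_in_real[of "\<beta> x" "\<beta> x + \<epsilon>"] by auto
      obtain r where r: "r \<in> \<rat>" "\<beta> x < r" "r < r'"
        using Rats_dense_in_real[OF r'(2)] by auto
      with elim r' have "x \<notin> S r r'" by blast
      with r obtain d where d: "d > 0"
        "\<And>p q. p \<le> x \<Longrightarrow> x \<le> q \<Longrightarrow> p < q \<Longrightarrow> q - p < d \<Longrightarrow> (LINT t:{p..q}|lborel. \<beta> t) \<le> r' * (q - p)"
        unfolding S_def mem_Collect_eq by (metis not_le)
      have "r' * (q - p) \<le> (\<beta> x + \<epsilon>) * (q - p)" if "p < q" for p q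
        using r' that by (intro mult_right_mono) auto
      then show "\<exists>d>0. \<forall>p q. p \<le> x \<and> x \<le> q \<and> p < q \<and> q - p < d \<longrightarrow>
           (LINT t:{p..q}|lborel. \<beta> t) \<le> (\<beta> x + \<epsilon>) * (q - p)"
        using d by (meson order_trans)
    qed
  qed
qed

text \<open>The difference quotient at \<open>x\<close> is an average over an interval with
  \<open>x\<close> as an endpoint. Both the almost-everywhere and the continuity-point arguments
  reduce to this criterion.\<close>

lemma has_real_derivative_integral_if_averages:
  fixes \<beta> :: "real \<Rightarrow> real"
  assumes int: "integrable lborel \<beta>"
    and avg: "\<And>\<epsilon>. 0 < \<epsilon> \<Longrightarrow> \<exists>d>0. \<forall>p q. p \<le> x \<and> x \<le> q \<and> p < q \<and> q - p < d \<longrightarrow>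
      \<bar>(LINT t:{p..q}|lborel. \<beta> t) - c * (q - p)\<bar> \<le> \<epsilon> * (q - p)"
  shows "((\<lambda>u. LINT t:{..u}|lborel. \<beta> t) has_real_derivative c) (at x)"
proof -
  let ?F = "\<lambda>u. LINT t:{..u}|lborel. \<beta> t"
  have si: "set_integrable lborel A \<beta>" if "A \<in> sets borel" for A
    using int that unfolding set_integrable_def by (intro integrable_mult_indicator) auto
  have diff: "?F q - ?F p = (LINT t:{p..q}|lborel. \<beta> t)" if "p < q" for p q
  proof -
    have "{..q} = {..p} \<union> {p<..q}" using that by auto
    then have "?F q = ?F p + (LINT t:{p<..q}|lborel. \<beta> t)"
      by (simp only:) (intro set_integral_Un si; auto)
    moreover have "(LINT t:{p<..q}|lborel. \<beta> t) = (LINT t:{p..q}|lborel. \<beta> t)"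
      unfolding set_lebesgue_integral_def
      by (intro integral_cong_AE) (use int AE_lborel_singleton[of p] in \<open>auto simp: indicator_def\<close>)
    ultimately show ?thesis by simp
  qed
  have "((\<lambda>u. (?F u - ?F x) / (u - x)) \<longlongrightarrow> c) (at x)"
  proof (rule tendstoI)
    fix \<epsilon> :: real assume \<epsilon>: "0 < \<epsilon>"
    then have "\<epsilon> / 2 > 0" by simp
    from avg[OF this] obtain d where d: "d > 0"
      "\<And>p q. p \<le> x \<Longrightarrow> x \<le> q \<Longrightarrow> p < q \<Longrightarrow> q - p < d \<Longrightarrow>
        \<bar>(LINT t:{p..q}|lborel. \<beta> t) - c * (q - p)\<bar> \<le> \<epsilon> / 2 * (q - p)"
      by blast
    have main: "\<bar>(LINT t:{p..q}|lborel. \<beta> t) / (q - p) - c\<bar> < \<epsilon>"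
      if "p \<le> x" "x \<le> q" "p < q" "q - p < d" for p q
    proof -
      have "(LINT t:{p..q}|lborel. \<beta> t) / (q - p) - c = ((LINT t:{p..q}|lborel. \<beta> t) - c * (q - p)) / (q - p)"
        using that by (simp add: diff_divide_distrib)
      then have "\<bar>(LINT t:{p..q}|lborel. \<beta> t) / (q - p) - c\<bar> \<le> \<epsilon> / 2"
        using d(2)[OF that] that by (simp add: abs_divide pos_divide_le_eq)
      then show ?thesis using \<epsilon> by linarith
    qed
    have "dist ((?F u - ?F x) / (u - x)) c < \<epsilon>" if "u \<noteq> x" "dist u x < d" for u
    proof (cases "u < x")
      case True
      have "(?F u - ?F x) / (u - x) = (?F x - ?F u) / (x - u)"
        by (metis minus_diff_eq minus_divide_divide)
      then show ?thesis using main[of u x] diff[of u x] that True by (simp add: dist_real_def)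
    next
      case False
      then show ?thesis using main[of x u] diff[of x u] that by (simp add: dist_real_def)
    qed
    then show "\<forall>\<^sub>F u in at x. dist ((?F u - ?F x) / (u - x)) c < \<epsilon>"
      unfolding eventually_at using d by (intro exI[of _ d]) auto
  qed
  then show ?thesis by (simp add: has_field_derivative_iff)
qed

text \<open>Lower bounds for the averages of \<beta> are upper bounds for the averages of
  \<open>- \<beta>\<close>.\<close>

theorem AE_has_real_derivative_integral:
  fixes \<beta> :: "real \<Rightarrow> real"
  assumes int: "integrable lborel \<beta>"
  shows "AE x in lebesgue. ((\<lambda>u. LINT t:{..u}|lborel. \<beta> t) has_real_derivative \<beta> x) (at x)"
  using AE_averages_eventually_le[OF int] AE_averages_eventually_le[OF integrable_minus[OF int]]
proof eventually_elim
  case (elim x)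
  show ?case
  proof (rule has_real_derivative_integral_if_averages[OF int])
    fix \<epsilon> :: real assume \<epsilon>: "0 < \<epsilon>"
    obtain d where d: "d > 0"
      "\<And>p q. p \<le> x \<Longrightarrow> x \<le> q \<Longrightarrow> p < q \<Longrightarrow> q - p < d \<Longrightarrow> (LINT t:{p..q}|lborel. \<beta> t) \<le> (\<beta> x + \<epsilon>) * (q - p)"
      using elim(1)[rule_format, OF \<epsilon>] by blast
    obtain d' where d': "d' > 0"
      "\<And>p q. p \<le> x \<Longrightarrow> x \<le> q \<Longrightarrow> p < q \<Longrightarrow> q - p < d' \<Longrightarrow> (LINT t:{p..q}|lborel. - \<beta> t) \<le> (- \<beta> x + \<epsilon>) * (q - p)"
      using elim(2)[rule_format, OF \<epsilon>] by blast
    have "\<bar>(LINT t:{p..q}|lborel. \<beta> t) - \<beta> x * (q - p)\<bar> \<le> \<epsilon> * (q - p)"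
      if "p \<le> x \<and> x \<le> q \<and> p < q \<and> q - p < min d d'" for p q
    proof -
      have "- (LINT t:{p..q}|lborel. \<beta> t) \<le> (- \<beta> x + \<epsilon>) * (q - p)"
        using d'(2)[of p q] that by (simp add: set_lebesgue_integral_def)
      then show ?thesis
        using d(2)[of p q] that by (simp add: abs_le_iff algebra_simps)
    qed
    then show "\<exists>d>0. \<forall>p q. p \<le> x \<and> x \<le> q \<and> p < q \<and> q - p < d \<longrightarrow>
      \<bar>(LINT t:{p..q}|lborel. \<beta> t) - \<beta> x * (q - p)\<bar> \<le> \<epsilon> * (q - p)"
      using d d' by (intro exI[of _ "min d d'"]) auto
  qed
qed

text \<open>\<open>q\<close> is a measurable, truncated integrand, while \<open>r\<close> is the
  function whose value at \<open>x\<close> is wanted. They agree only almost everywhere below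
  \<open>b\<close>, so it is the continuity of \<open>r\<close> at the point that pins the
  derivative down.\<close>

lemma has_real_derivative_integral_continuous:
  fixes q r :: "real \<Rightarrow> real"
  assumes int: "integrable lborel q" and eq: "AE t in lborel. t < b \<longrightarrow> q t = r t"
    and x: "x < b" and cont: "isCont r x"
  shows "((\<lambda>u. LINT t:{..u}|lborel. q t) has_real_derivative r x) (at x)"
proof (rule has_real_derivative_integral_if_averages[OF int])
  fix \<epsilon> :: real assume "0 < \<epsilon>"
  with cont obtain d where d: "d > 0" "\<And>t. dist t x < d \<Longrightarrow> dist (r t) (r x) < \<epsilon>"
    unfolding continuous_at_eps_delta by blast
  have "\<bar>(LINT t:{p..s}|lborel. q t) - r x * (s - p)\<bar> \<le> \<epsilon> * (s - p)"
    if ps: "p \<le> x \<and> x \<le> s \<and> p < s \<and> s - p < min d (b - x)" for p s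
  proof -
    have near: "AE t in lborel. t \<in> {p..s} \<longrightarrow> \<bar>q t - r x\<bar> \<le> \<epsilon>"
      using eq
    proof eventually_elim
      case (elim t)
      show ?case
      proof
        assume t: "t \<in> {p..s}"
        then have "t < b" "dist t x < d" using ps by (auto simp: dist_real_def)
        then show "\<bar>q t - r x\<bar> \<le> \<epsilon>" using elim d(2)[of t] by (simp add: dist_real_def)
      qed
    qed
    have qi: "integrable lborel (\<lambda>t. indicator {p..s} t * q t)"
      using integrable_mult_indicator[OF _ int, of "{p..s}"] by simp
    have ci: "integrable lborel (\<lambda>t. indicator {p..s} t * c)" for c :: real
      by (intro integrable_mult_left integrable_real_indicator) (auto simp: emeasure_lborel_Icc_eq)
    have cint: "(\<integral>t. indicator {p..s} t * c \<partial>lborel) = c * (s - p)" for c :: real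
      using ps by simp
    have "(\<integral>t. indicator {p..s} t * q t \<partial>lborel) \<le> (\<integral>t. indicator {p..s} t * (r x + \<epsilon>) \<partial>lborel)"
      by (rule integral_mono_AE[OF qi ci]) (use near in eventually_elim, auto simp: indicator_def)
    moreover have "(\<integral>t. indicator {p..s} t * (r x - \<epsilon>) \<partial>lborel) \<le> (\<integral>t. indicator {p..s} t * q t \<partial>lborel)"
      by (rule integral_mono_AE[OF ci qi]) (use near in eventually_elim, auto simp: indicator_def)
    ultimately show ?thesis
      unfolding cint by (simp add: set_lebesgue_integral_def abs_le_iff algebra_simps)
  qed
  then show "\<exists>d>0. \<forall>p s. p \<le> x \<and> x \<le> s \<and> p < s \<and> s - p < d \<longrightarrow>
      \<bar>(LINT t:{p..s}|lborel. q t) - r x * (s - p)\<bar> \<le> \<epsilon> * (s - p)"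
    using d(1) x by (intro exI[of _ "min d (b - x)"]) auto
qed

section \<open>Hausdorff null sets in dimension one and in codimension one\<close>

text \<open>A null set lies in an open set of small length. The components of that set are
  intervals, whose diameters are at most their lengths, so they form a cover by short sets of small
  total gauge.\<close>

lemma hausdorff_measure_vertical_null:
  fixes z :: "'a::euclidean_space" and S :: "real set"
  assumes S: "negligible S"
  shows "hausdorff_measure 1 ({z} \<times> S) = 0"
proof -
  have le_\<epsilon>: "hausdorff_premeasure 1 \<delta> ({z} \<times> S) \<le> ennreal \<epsilon>" if \<delta>: "0 < \<delta>" and \<epsilon>: "0 < \<epsilon>" for \<delta> \<epsilon>
  proof -
    have m: "0 < min \<delta> \<epsilon>" using \<delta> \<epsilon> by simp
    \<comment> \<open>The bound \<delta> limits the diameter of each component, the bound \<epsilon>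
      the sum over all components.\<close>
    obtain U where U: "open U" "S \<subseteq> U" "U \<in> lmeasurable" "measure lebesgue U < min \<delta> \<epsilon>"
    proof -
      have Sl: "S \<in> sets lebesgue" using S by (simp add: negligible_imp_sets)
      obtain U where U: "open U" "S \<subseteq> U" "U - S \<in> lmeasurable" "emeasure lebesgue (U - S) < ennreal (min \<delta> \<epsilon>)"
        using sets_lebesgue_outer_open[OF Sl m] by metis
      have eq: "U = (U - S) \<union> S" using U by auto
      have Sm: "S \<in> lmeasurable" "measure lebesgue S = 0" using S by (auto simp: negligible_iff_measure)
      have "U \<in> lmeasurable" by (subst eq) (intro fmeasurable.Un U Sm)
      moreover have "measure lebesgue U \<le> measure lebesgue (U - S) + measure lebesgue S"
        by (subst eq) (intro measure_Un_le fmeasurableD U Sm)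
      moreover have "measure lebesgue (U - S) < min \<delta> \<epsilon>"
        using U(3,4) m by (simp add: emeasure_eq_measure2 ennreal_less_iff)
      ultimately show thesis using that U Sm by auto
    qed
    \<comment> \<open>The components are numbered through \<open>to_nat_on\<close>; numbers
      belonging to no component give the empty set, whose gauge is 0.\<close>
    define f where "f = to_nat_on (components U)"
    define D where "D n = \<Union>{K \<in> components U. f K = n}" for n
    have cnt: "countable (components U)"
      using open_components[OF U(1)] pairwise_disjoint_components[of U]
      by (intro countable_disjoint_open_subsets) (auto simp: pairwise_def disjnt_def)
    have inj: "inj_on f (components U)" unfolding f_def using cnt by (rule inj_on_to_nat_on)
    have D_cases: "D n = {} \<or> D n \<in> components U" for n
    proof (cases "\<exists>K \<in> components U. f K = n")
      case True
      then obtain K where "K \<in> components U" "f K = n" by blast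
      then have "{K \<in> components U. f K = n} = {K}" using inj by (auto simp: inj_on_def)
      then show ?thesis using \<open>K \<in> components U\<close> by (simp add: D_def)
    qed (auto simp: D_def)
    have UD: "(\<Union>n. D n) = U"
      unfolding D_def using Union_components[of U] by blast
    have oD: "open (D n)" for n using D_cases[of n] open_components[OF U(1)] by auto
    have disj: "disjoint_family D"
      unfolding disjoint_family_on_def D_def using components_nonoverlap[of _ U] by fast
    have len: "\<bar>x - y\<bar> \<le> measure lebesgue (D n)" if "x \<in> D n" "y \<in> D n" for x y n
    proof -
      have "connected (D n)" using D_cases[of n] in_components_connected by fastforce
      then have "{min x y..max x y} \<subseteq> D n"
        using that by (intro connected_contains_Icc) (simp_all add: min_def max_def)
      moreover have "D n \<in> lmeasurable"
        using fmeasurableI2[OF U(3), of "D n"] UD oD[of n] by auto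
      ultimately have "measure lebesgue {min x y..max x y} \<le> measure lebesgue (D n)"
        by (intro measure_mono_fmeasurable) auto
      then show ?thesis by (simp add: min_def max_def abs_if split: if_splits)
    qed
    have meas_le: "measure lebesgue (D n) \<le> measure lebesgue U" for n
      using U(3) UD oD[of n] by (intro measure_mono_fmeasurable) auto
    let ?C = "\<lambda>n. {z} \<times> D n"
    have bd: "bounded (?C n)" for n
    proof -
      have "bounded (D n)"
      proof (cases "D n = {}")
        case False
        then obtain x where "x \<in> D n" by blast
        then have "\<forall>y\<in>D n. dist x y \<le> measure lebesgue (D n)"
          using len by (simp add: dist_real_def)
        then show ?thesis unfolding bounded_def by blast
      qed simp
      then show ?thesis by (intro bounded_Times) auto
    qed
    have diam: "diameter (?C n) \<le> measure lebesgue (D n)" for n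
      by (rule diameter_le) (use len in \<open>auto simp: norm_Pair\<close>)
    have "(\<Sum>n. ennreal (hausdorff_gauge 1 (?C n))) \<le> (\<Sum>n. emeasure lborel (D n))"
    proof (rule suminf_le)
      fix n
      have "D n \<in> lmeasurable"
        using fmeasurableI2[OF U(3), of "D n"] UD oD[of n] by auto
      then have "emeasure lborel (D n) = ennreal (measure lebesgue (D n))"
        using oD[of n] emeasure_eq_measure2[of "D n" lebesgue] by simp
      \<comment> \<open>In dimension 1 the factor \<open>unit_ball_vol 1 = 2\<close> cancels the
        halving of the diameter.\<close>
      moreover have "hausdorff_gauge 1 (?C n) \<le> measure lebesgue (D n)"
        using diam[of n] diameter_ge_0[OF bd[of n]] by (simp add: hausdorff_gauge_def)
      ultimately show "ennreal (hausdorff_gauge 1 (?C n)) \<le> emeasure lborel (D n)"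
        by (simp add: ennreal_leI)
    qed simp_all
    also have "\<dots> = emeasure lborel U"
      using disj oD by (subst suminf_emeasure) (auto simp: UD)
    also have "\<dots> = ennreal (measure lebesgue U)"
      using U(1) emeasure_eq_measure2[OF U(3)] by simp
    also have "\<dots> \<le> ennreal \<epsilon>" using U(4) by (intro ennreal_leI) simp
    finally have le: "(\<Sum>n. ennreal (hausdorff_gauge 1 (?C n))) \<le> ennreal \<epsilon>" .
    have "{z} \<times> S \<subseteq> (\<Union>n. ?C n)" using U(2) UD by auto
    moreover have "bounded (?C n) \<and> diameter (?C n) \<le> \<delta>" for n
      using bd[of n] diam[of n] meas_le[of n] U(4) by simp
    ultimately have "hausdorff_premeasure 1 \<delta> ({z} \<times> S) \<le> (\<Sum>n. ennreal (hausdorff_gauge 1 (?C n)))"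
      unfolding hausdorff_premeasure_def by (intro Inf_lower CollectI exI[of _ ?C]) simp
    with le show ?thesis by (rule order_trans[rotated])
  qed
  have "hausdorff_premeasure 1 \<delta> ({z} \<times> S) \<le> 0" if "0 < \<delta>" for \<delta>
    by (rule ennreal_le_epsilon) (simp add: le_\<epsilon> that)
  then show ?thesis by (simp add: hausdorff_measure_def)
qed

text \<open>A set of diameter d lies in a cube of side 2d around any of its points, so the part of
  the cylinder above it with i-th coordinate in [-R,R] fits into a box of volume 2R (2d)^(m-1), a
  constant multiple of its (m-1)-dimensional gauge. Covers of small total gauge thus give covers of
  small volume.\<close>

lemma negligible_cylinder_hausdorff_null:
  fixes N :: "(real^'n) set" and i :: 'n
  assumes N: "hausdorff_measure (real CARD('n) - 1) N = 0"
  shows "negligible {y. \<exists>z\<in>N. \<forall>j. j \<noteq> i \<longrightarrow> y $ j = z $ j}"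
proof -
  let ?s = "real CARD('n) - 1"
  define k where "k = CARD('n) - 1"
  have sk: "?s = real k" by (simp add: k_def of_nat_diff)
  have "negligible {y. (\<exists>z\<in>N. \<forall>j. j \<noteq> i \<longrightarrow> y $ j = z $ j) \<and> \<bar>y $ i\<bar> \<le> R}" (is "negligible ?Y") if R: "0 < R" for R
    unfolding negligible_outer
  proof (intro allI impI)
    fix e :: real assume e: "0 < e"
    \<comment> \<open>The ratio of the box volume to the gauge:
      \<open>(2 * d) ^ k = 4 ^ k * (d / 2) ^ k\<close>, divided by the normalising ball volume. For
      \<open>k = 0\<close> the gauge of a nonempty set is 1, hence the case distinction.\<close>
    define c where "c = 2 * R * 4 ^ k / (if k = 0 then 1 else unit_ball_vol ?s)"
    have c: "0 < c" using R unfolding c_def sk by simp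
    \<comment> \<open>The scale 1 is arbitrary: the premeasure at every positive scale is bounded by
      the measure.\<close>
    have "hausdorff_premeasure ?s 1 N = 0"
      using SUP_upper[of 1 "{0<..}" "\<lambda>\<delta>. hausdorff_premeasure ?s \<delta> N"] N
      unfolding hausdorff_measure_def by simp
    then have "hausdorff_premeasure ?s 1 N < ennreal (e / (2 * c))" using e c by simp
    then obtain C where C: "N \<subseteq> (\<Union>n. C n)" "\<And>n. bounded (C n)"
        "(\<Sum>n. ennreal (hausdorff_gauge ?s (C n))) < ennreal (e / (2 * c))"
      unfolding hausdorff_premeasure_def Inf_less_iff by auto
    define q where "q n = (SOME x. x \<in> C n)" for n
    define B where "B n = (if C n = {} then {} else
       cbox (replace_coord i (- R) (\<chi> j. q n $ j - diameter (C n))) (replace_coord i R (\<chi> j. q n $ j + diameter (C n))))" for n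
    have B_le: "emeasure lborel (B n) \<le> ennreal c * ennreal (hausdorff_gauge ?s (C n))" for n
    proof (cases "C n = {}")
      case False
      let ?D = "diameter (C n)" and ?l = "replace_coord i (- R) (\<chi> j. q n $ j - diameter (C n))"
        and ?u = "replace_coord i R (\<chi> j. q n $ j + diameter (C n))"
      have D: "0 \<le> ?D" using diameter_ge_0[OF C(2)] .
      have ne: "cbox ?l ?u \<noteq> {}"
        unfolding interval_ne_empty_cart using D R by auto
      have "measure lborel (cbox ?l ?u) = (\<Prod>j\<in>UNIV. ?u $ j - ?l $ j)"
        using content_cbox_cart[OF ne] by simp
      also have "\<dots> = (\<Prod>j\<in>insert i (UNIV - {i}). ?u $ j - ?l $ j)"
        by (rule prod.cong) auto
      also have "\<dots> = 2 * R * (\<Prod>j\<in>UNIV - {i}. 2 * ?D)"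
        by (subst prod.insert) (auto intro!: prod.cong)
      also have "\<dots> = 2 * R * (2 * ?D) ^ k" by (simp add: card_Diff_singleton k_def)
      also have "\<dots> = c * hausdorff_gauge ?s (C n)"
      proof (cases "k = 0")
        case True
        then show ?thesis using False by (simp add: c_def hausdorff_gauge_def sk)
      next
        case k0: False
        have p: "(?D / 2) powr ?s = (?D / 2) ^ k"
          using D k0 by (cases "?D = 0") (auto simp: sk powr_realpow)
        have "(2 * ?D) ^ k = 4 ^ k * (?D / 2) ^ k"
          unfolding power_mult_distrib[symmetric] by simp
        moreover have "unit_ball_vol ?s \<noteq> 0"
          unfolding sk using unit_ball_vol_pos[of "real k", OF of_nat_0_le_iff] by (rule less_imp_neq[THEN not_sym])
        ultimately show ?thesis using k0 False p
          by (simp add: c_def hausdorff_gauge_def sk del: power_divide)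
      qed
      finally have "measure lborel (B n) = c * hausdorff_gauge ?s (C n)"
        using False by (simp add: B_def)
      moreover have "emeasure lborel (B n) = ennreal (measure lborel (B n))"
        using False emeasure_lborel_cbox_finite[of ?l ?u]
        by (intro emeasure_eq_ennreal_measure) (simp add: B_def less_top)
      ultimately show ?thesis using c by (simp add: ennreal_mult')
    qed (simp add: B_def)
    have Bm: "B n \<in> sets borel" for n by (simp add: B_def)
    have "emeasure lborel (\<Union>n. B n) \<le> (\<Sum>n. emeasure lborel (B n))"
      using Bm by (intro emeasure_subadditive_countably) auto
    also have "\<dots> \<le> (\<Sum>n. ennreal c * ennreal (hausdorff_gauge ?s (C n)))"
      by (intro suminf_le B_le) auto
    also have "\<dots> = ennreal c * (\<Sum>n. ennreal (hausdorff_gauge ?s (C n)))"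
      by simp
    also have "\<dots> \<le> ennreal c * ennreal (e / (2 * c))"
      using C(3) by (intro mult_left_mono) auto
    also have "\<dots> = ennreal (e / 2)"
      using c e by (subst ennreal_mult'[symmetric]) auto
    finally have le: "emeasure lborel (\<Union>n. B n) \<le> ennreal (e / 2)" .
    have lm: "(\<Union>n. B n) \<in> lmeasurable"
      using Bm le by (intro fmeasurableI) (auto simp: le_less_trans[OF le])
    moreover have "measure lebesgue (\<Union>n. B n) < e"
    proof -
      have "measure lborel (\<Union>n. B n) \<le> e / 2"
        unfolding measure_def using le e by (intro enn2real_leI) auto
      then show ?thesis using e Bm by (simp add: measure_completion)
    qed
    moreover have "?Y \<subseteq> (\<Union>n. B n)"
    proof
      fix y assume "y \<in> ?Y"
      then obtain w where w: "w \<in> N" "\<And>j. j \<noteq> i \<Longrightarrow> y $ j = w $ j" "\<bar>y $ i\<bar> \<le> R" by auto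
      obtain n where n: "w \<in> C n" using w C(1) by auto
      then have "q n \<in> C n" unfolding q_def by (rule someI)
      then have "dist w (q n) \<le> diameter (C n)" using n C(2) by (intro diameter_bounded_bound)
      then have wq: "\<bar>w $ j - q n $ j\<bar> \<le> diameter (C n)" for j
        using dist_vec_nth_le[of w j "q n"] by (simp add: dist_real_def)
      have "replace_coord i (- R) (\<chi> j. q n $ j - diameter (C n)) $ j \<le> y $ j \<and>
          y $ j \<le> replace_coord i R (\<chi> j. q n $ j + diameter (C n)) $ j" for j
        using w(2)[of j] w(3) wq[of j] by (cases "j = i") (simp_all add: abs_le_iff)
      then have "y \<in> B n"
        using n by (auto simp only: B_def mem_box_cart split: if_splits)
      then show "y \<in> (\<Union>n. B n)" by auto
    qed
    ultimately show "\<exists>T. ?Y \<subseteq> T \<and> T \<in> lmeasurable \<and> measure lebesgue T < e" by blast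
  qed
  then have "negligible (\<Union>m::nat. {y. (\<exists>z\<in>N. \<forall>j. j \<noteq> i \<longrightarrow> y $ j = z $ j) \<and> \<bar>y $ i\<bar> \<le> real (Suc m)})"
    by (intro negligible_Union_nat) auto
  moreover have "{y. \<exists>z\<in>N. \<forall>j. j \<noteq> i \<longrightarrow> y $ j = z $ j} \<subseteq>
      (\<Union>m::nat. {y. (\<exists>z\<in>N. \<forall>j. j \<noteq> i \<longrightarrow> y $ j = z $ j) \<and> \<bar>y $ i\<bar> \<le> real (Suc m)})"
  proof
    fix y assume "y \<in> {y. \<exists>z\<in>N. \<forall>j. j \<noteq> i \<longrightarrow> y $ j = z $ j}"
    moreover obtain m :: nat where "\<bar>y $ i\<bar> \<le> real m" using real_arch_simple by blast
    then have "\<bar>y $ i\<bar> \<le> real (Suc m)" by simp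
    ultimately show "y \<in> (\<Union>m::nat. {y. (\<exists>z\<in>N. \<forall>j. j \<noteq> i \<longrightarrow> y $ j = z $ j) \<and> \<bar>y $ i\<bar> \<le> real (Suc m)})"
      by blast
  qed
  ultimately show ?thesis by (rule negligible_subset)
qed

section \<open>The graph map in local coordinates\<close>

lemma AE_lborel_notin_negligible:
  fixes S :: "'a::euclidean_space set"
  assumes "negligible S"
  shows "AE x in lborel. x \<notin> S"
proof -
  have "S \<in> null_sets lebesgue" using assms by (simp add: negligible_iff_null_sets)
  then have "AE x in lebesgue. x \<notin> S" by (rule AE_not_in)
  then show ?thesis by (simp only: AE_completion_iff)
qed

lemma negligible_if_AE_notin:
  fixes S :: "'a::euclidean_space set"
  assumes "AE x in lborel. x \<notin> S"
  shows "negligible S"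
proof -
  obtain N where "N \<in> null_sets lborel" "S \<subseteq> N"
    using assms unfolding eventually_ae_filter by auto
  then show ?thesis
    unfolding negligible_iff_null_sets by (subst null_sets_completion_iff2) blast
qed

lemma AE_lborel_fst:
  fixes Q :: "'a::euclidean_space \<Rightarrow> bool"
  assumes "AE x in lborel. Q x"
  shows "AE p in (lborel :: ('a \<times> 'b::euclidean_space) measure). Q (fst p)"
proof -
  obtain N where N: "N \<in> null_sets lborel" "{x. \<not> Q x} \<subseteq> N"
    using assms unfolding eventually_ae_filter by auto
  have [measurable]: "N \<in> sets borel" using N(1) by auto
  have "AE x in (lborel :: 'a measure). AE t in (lborel :: 'b measure). fst (x, t) \<notin> N"
    using AE_not_in[OF N(1)] by eventually_elim simp
  then have "AE p in (lborel :: 'a measure) \<Otimes>\<^sub>M (lborel :: 'b measure). fst p \<notin> N"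
    by (rule lborel_pair.AE_pair_measure[rotated]) (unfold lborel_prod, measurable)
  then have "AE p in (lborel :: ('a \<times> 'b) measure). fst p \<notin> N" by (subst (asm) lborel_prod)
  then show ?thesis by (rule eventually_mono) (use N(2) in auto)
qed

lemma borel_measurable_vec_nth_comp [measurable (raw)]:
  fixes f :: "'a \<Rightarrow> real^'n"
  assumes [measurable]: "f \<in> borel_measurable M"
  shows "(\<lambda>x. f x $ i) \<in> borel_measurable M"
  unfolding cart_eq_inner_axis by measurable

section \<open>Minors of D u as Jacobian determinants of coordinate projections\<close>

text \<open>The remaining coordinates are numbered as the rows in \<open>omit_row\<close>, so that
  the minors of D u are, signs included, the Jacobian determinants of the maps
  \<open>\<psi> j\<close>.\<close>

definition coord_proj :: "'n option \<Rightarrow> (real^'n) \<times> real \<Rightarrow> real^'n" where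
  "coord_proj j p = (case j of None \<Rightarrow> fst p | Some i \<Rightarrow> replace_coord i (snd p) (fst p))"

lemma bounded_linear_coord_proj: "bounded_linear (coord_proj j :: _ \<Rightarrow> real^'n)"
  by (cases j) (auto simp: coord_proj_def[abs_def] bounded_linear_fst bounded_linear_replace_coord)

locale chart =
  fixes \<Omega> U :: "(real^'n) set" and v :: "real^'n \<Rightarrow> real^'n" and h :: "real^'n \<Rightarrow> real"
    and u' :: "real^'n \<Rightarrow> (real^'n) \<Rightarrow>\<^sub>L ((real^'n) \<times> real)"
  assumes \<Omega>_borel [measurable]: "\<Omega> \<in> sets borel"
    and U_open: "open U" and \<Omega>U: "\<Omega> \<subseteq> U"
    and u_deriv: "\<And>x. x \<in> U \<Longrightarrow> ((\<lambda>x. (v x, h x)) has_derivative blinfun_apply (u' x)) (at x)"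
    and u'_cont: "continuous_on U u'"
    and u_inj: "inj_on (\<lambda>x. (v x, h x)) \<Omega>"
    and jacobian_nonzero: "AE x in lebesgue. x \<in> \<Omega> \<longrightarrow> jacobian_m (\<lambda>x. (v x, h x)) x \<noteq> 0"
begin

abbreviation u :: "real^'n \<Rightarrow> (real^'n) \<times> real" where "u \<equiv> \<lambda>x. (v x, h x)"

definition \<psi> :: "'n option \<Rightarrow> real^'n \<Rightarrow> real^'n" where "\<psi> j x = coord_proj j (u x)"

definition \<psi>' :: "'n option \<Rightarrow> real^'n \<Rightarrow> (real^'n) \<Rightarrow>\<^sub>L (real^'n)" where
  "\<psi>' j x = Blinfun (coord_proj j) o\<^sub>L u' x"

definition minor :: "'n option \<Rightarrow> real^'n \<Rightarrow> real" where
  "minor j x = indicator U x * det (matrix (blinfun_apply (\<psi>' j x)))"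

text \<open>A globally Borel stand-in for \<open>jacobian_m u\<close>, without the case distinction
  on the rank; both agree almost everywhere on \<Omega> by \<open>AE_jacobian\<close>.\<close>

definition jac :: "real^'n \<Rightarrow> real" where "jac x = sqrt (\<Sum>j\<in>UNIV. (minor j x)\<^sup>2)"

lemma \<psi>'_apply: "blinfun_apply (\<psi>' j x) w = coord_proj j (blinfun_apply (u' x) w)"
  by (simp add: \<psi>'_def bounded_linear_Blinfun_apply bounded_linear_coord_proj)

lemma U_borel [measurable]: "U \<in> sets borel" using U_open by simp

lemma \<psi>_deriv: "x \<in> U \<Longrightarrow> (\<psi> j has_derivative blinfun_apply (\<psi>' j x)) (at x)"
  using bounded_linear.has_derivative[OF bounded_linear_coord_proj u_deriv, of x j]
  by (simp add: \<psi>_def[abs_def] \<psi>'_apply[abs_def])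

lemma \<psi>'_cont: "continuous_on U (\<psi>' j)"
  unfolding \<psi>'_def by (intro continuous_intros u'_cont)

lemma minor_measurable [measurable]: "minor j \<in> borel_measurable borel"
  using borel_measurable_continuous_on_indicator[OF U_borel open_det_nonzero(1)[OF U_open \<psi>'_cont[of j]]]
  by (simp add: minor_def[abs_def])

lemma jac_measurable [measurable]: "jac \<in> borel_measurable borel"
  unfolding jac_def[abs_def] by measurable

lemma u_cont: "continuous_on U u"
  by (intro differentiable_imp_continuous_on differentiable_at_imp_differentiable_on)
     (use u_deriv differentiableI in blast)

lemma v_cont: "continuous_on U v" and h_cont: "continuous_on U h"
  using continuous_on_fst[OF u_cont] continuous_on_snd[OF u_cont] by simp_all

text \<open>Nothing is known about \<open>v\<close> and \<open>h\<close> off \<open>U\<close>;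
  cutting them off there makes them Borel on the whole space.\<close>

definition vU :: "real^'n \<Rightarrow> real^'n" where "vU x = indicator U x *\<^sub>R v x"
definition hU :: "real^'n \<Rightarrow> real" where "hU x = indicator U x * h x"

lemma vU_measurable [measurable]: "vU \<in> borel_measurable borel"
  using borel_measurable_continuous_on_indicator[OF U_borel v_cont] by (simp add: vU_def[abs_def])

lemma hU_measurable [measurable]: "hU \<in> borel_measurable borel"
  using borel_measurable_continuous_on_indicator[OF U_borel h_cont] by (simp add: hU_def[abs_def])

lemma vU_eq [simp]: "x \<in> U \<Longrightarrow> vU x = v x" and hU_eq [simp]: "x \<in> U \<Longrightarrow> hU x = h x"
  by (simp_all add: vU_def hU_def)

lemma omit_row_partials:
  assumes "x \<in> U"
  shows "omit_row j (partials_matrix u x) = matrix (blinfun_apply (\<psi>' j x))"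
proof -
  have fd: "frechet_derivative u (at x) = blinfun_apply (u' x)"
    using frechet_derivative_at[OF u_deriv[OF assms]] by simp
  show ?thesis
    by (cases j) (auto simp: vec_eq_iff omit_row_def partials_matrix_def matrix_def \<psi>'_apply fd coord_proj_def Let_def)
qed

lemma jacobian_eq_jac: "x \<in> U \<Longrightarrow> jacobian_m u x \<noteq> 0 \<Longrightarrow> jacobian_m u x = jac x"
  by (auto simp: jacobian_m_def jac_def minor_def omit_row_partials split: if_splits)

lemma AE_jacobian: "AE x in lebesgue. x \<in> \<Omega> \<longrightarrow> jacobian_m u x = jac x \<and> jac x > 0"
  using jacobian_nonzero
proof eventually_elim
  case (elim x)
  show ?case
  proof
    assume x: "x \<in> \<Omega>"
    then have eq: "jacobian_m u x = jac x" using elim \<Omega>U jacobian_eq_jac by auto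
    moreover have "jac x \<ge> 0" by (simp add: jac_def sum_nonneg)
    ultimately show "jacobian_m u x = jac x \<and> jac x > 0" using elim x by auto
  qed
qed

lemma negligible_image_null:
  assumes "negligible Z" "Z \<subseteq> U"
  shows "negligible (\<psi> j ` Z)"
proof (rule negligible_differentiable_image_negligible[OF order_refl assms(1)])
  show "\<psi> j differentiable_on Z"
    unfolding differentiable_on_def
    using assms(2) \<psi>_deriv differentiableI has_derivative_at_withinI by blast
qed

lemma negligible_image_minor_zero: "negligible (\<psi> j ` {x \<in> U. minor j x = 0})"
  by (rule negligible_image_singular[where g'="\<lambda>x. blinfun_apply (\<psi>' j x)"])
     (auto simp: minor_def intro: has_derivative_at_withinI \<psi>_deriv)

lemma negligible_if_\<psi>_image:
  assumes "negligible (\<psi> j ` A)" "A \<subseteq> U" "\<And>x. x \<in> A \<Longrightarrow> minor j x \<noteq> 0"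
  shows "negligible A"
  by (rule negligible_if_image_negligible[OF U_open \<psi>_deriv[of _ j] \<psi>'_cont[of j] assms(2) _ assms(1)])
     (use assms(3) in \<open>auto simp: minor_def\<close>)

text \<open>Charts come only from minors that keep the last row: the fibre hypothesis makes the
  remaining minor vanish almost everywhere, so in \<open>fibred_chart\<close> these sets cover
  almost all of \<Omega>.\<close>

definition regular :: "'n \<Rightarrow> (real^'n) set" where "regular i = {x \<in> \<Omega>. minor (Some i) x \<noteq> 0}"

lemma regular_measurable [measurable]: "regular i \<in> sets borel"
  unfolding regular_def by measurable

lemma \<psi>_Some: "\<psi> (Some i) x = replace_coord i (h x) (v x)" and \<psi>_None: "\<psi> None x = v x"
  by (simp_all add: \<psi>_def coord_proj_def)

lemma AE_regular_image_notin:
  assumes Y: "negligible Y"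
  shows "AE x in lborel. x \<in> regular i \<longrightarrow> \<psi> (Some i) x \<notin> Y"
proof -
  let ?A = "{x \<in> regular i. \<psi> (Some i) x \<in> Y}"
  have "negligible ?A"
  proof (rule negligible_if_\<psi>_image[where j="Some i"])
    show "negligible (\<psi> (Some i) ` ?A)" by (rule negligible_subset[OF Y]) auto
  qed (use \<Omega>U in \<open>auto simp: regular_def\<close>)
  then have "AE x in lborel. x \<notin> ?A" by (rule AE_lborel_notin_negligible)
  then show ?thesis by eventually_elim simp
qed

text \<open>
  The exceptional set is a null set for the product measure, which gives both orders of
  quantification: for almost all points and almost all levels, and conversely.
\<close>

lemma AE_replace_coord_v_notin:
  assumes N: "negligible N"
  shows "AE p in lborel. fst p \<in> regular i \<longrightarrow> replace_coord i (snd p) (v (fst p)) \<notin> N"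
proof -
  have "N \<in> null_sets lebesgue" using N by (simp add: negligible_iff_null_sets)
  then obtain N' where N': "N' \<in> null_sets lborel" "N \<subseteq> N'"
    by (auto simp only: null_sets_completion_iff2)
  have [measurable]: "N' \<in> sets borel" using N' by auto
  have "AE p in (lborel :: (real^'n) measure) \<Otimes>\<^sub>M (lborel :: real measure). replace_coord i (snd p) (fst p) \<notin> N'"
    unfolding lborel_prod by (rule AE_replace_coord_notin[OF N'(1)])
  from lborel_pair.AE_pair[OF this]
  have "AE y in (lborel :: (real^'n) measure). AE t in (lborel :: real measure). replace_coord i t y \<notin> N'" by simp
  then obtain Y where Y: "Y \<in> null_sets lborel" "{y. \<not> (AE t in (lborel :: real measure). replace_coord i t y \<notin> N')} \<subseteq> Y"
    unfolding eventually_ae_filter by auto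
  have "negligible Y" using Y(1) by (simp add: negligible_iff_null_sets null_sets_completionI)
  from AE_regular_image_notin[OF this, of i]
  have "AE x in lborel. AE t in (lborel :: real measure). \<not> (x \<in> regular i \<and> replace_coord i t (vU x) \<in> N')"
  proof eventually_elim
    case (elim x)
    show ?case
    proof (cases "x \<in> regular i")
      case True
      \<comment> \<open>\<open>\<psi> (Some i) x\<close> and \<open>v x\<close> differ only in
        coordinate \<open>i\<close>, which \<open>replace_coord i t\<close> overwrites.\<close>
      then have "AE t in (lborel :: real measure). replace_coord i t (\<psi> (Some i) x) \<notin> N'"
        using elim Y(2) by blast
      moreover have "vU x = v x" using True \<Omega>U by (auto simp: regular_def)
      ultimately show ?thesis by (simp add: \<psi>_Some)
    qed simp
  qed
  then have "AE p in (lborel :: (real^'n) measure) \<Otimes>\<^sub>M (lborel :: real measure).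
       \<not> (fst p \<in> regular i \<and> replace_coord i (snd p) (vU (fst p)) \<in> N')"
  proof (intro lborel_pair.AE_pair_measure)
    show "{p \<in> space ((lborel :: (real^'n) measure) \<Otimes>\<^sub>M (lborel :: real measure)).
        \<not> (fst p \<in> regular i \<and> replace_coord i (snd p) (vU (fst p)) \<in> N')} \<in> sets (lborel \<Otimes>\<^sub>M lborel)"
      unfolding lborel_prod by measurable
  qed simp
  then show ?thesis
    unfolding lborel_prod
    by eventually_elim (use N' \<Omega>U[THEN subsetD] in \<open>auto simp: regular_def\<close>)
qed

end

section \<open>The map u as a graph over one chart\<close>

locale chart_pieces = chart \<Omega> U v h u'
  for \<Omega> U :: "(real^'n) set" and v h u' +
  fixes i :: 'n and V W :: "nat \<Rightarrow> (real^'n) set" and \<sigma> :: "nat \<Rightarrow> real^'n \<Rightarrow> real^'n"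
  assumes pieces: "\<And>n. local_inverse (\<psi> (Some i)) (V n) (W n) (\<sigma> n)"
    and V_cover: "(\<Union>n. V n) = {x \<in> U. minor (Some i) x \<noteq> 0}"
begin

text \<open>The pieces are disjoint, so a point of \<open>regular i\<close> is counted once although
  the sets \<open>V n\<close> may overlap.\<close>

definition A :: "nat \<Rightarrow> (real^'n) set" where "A n = (\<Omega> \<inter> V n) - (\<Union>k<n. V k)"

lemma VW_open: "open (V n)" "open (W n)" using pieces by (auto simp: local_inverse_def)

lemma V_sub: "V n \<subseteq> U" "x \<in> V n \<Longrightarrow> minor (Some i) x \<noteq> 0" using V_cover by auto

lemma \<sigma>_measurable [measurable]: "\<sigma> n \<in> borel_measurable borel"
  using pieces by (auto simp: local_inverse_def)

lemma \<sigma>_\<psi>: "x \<in> V n \<Longrightarrow> \<psi> (Some i) x \<in> W n \<and> \<sigma> n (\<psi> (Some i) x) = x"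
  and \<psi>_\<sigma>: "y \<in> W n \<Longrightarrow> \<sigma> n y \<in> V n \<and> \<psi> (Some i) (\<sigma> n y) = y"
  and \<sigma>_deriv: "y \<in> W n \<Longrightarrow> \<exists>D. (\<sigma> n has_derivative D) (at y)"
  using pieces by (auto simp: local_inverse_def)

lemma \<sigma>_in_U: "y \<in> W n \<Longrightarrow> \<sigma> n y \<in> U"
  using \<psi>_\<sigma> V_sub(1) by blast

lemma A_measurable [measurable]: "A n \<in> sets borel" and W_measurable [measurable]: "W n \<in> sets borel"
  unfolding A_def using VW_open by auto

lemma A_sub: "A n \<subseteq> V n" "A n \<subseteq> \<Omega>" by (auto simp: A_def)

lemma A_disjoint: "x \<in> A m \<Longrightarrow> x \<in> A n \<Longrightarrow> m = n"
  by (cases m n rule: linorder_cases) (auto simp: A_def)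

lemma A_Union: "(\<Union>n. A n) = regular i"
proof -
  have "(\<Union>n. A n) = \<Omega> \<inter> (\<Union>n. V n)"
  proof (intro set_eqI iffI)
    fix x assume x: "x \<in> \<Omega> \<inter> (\<Union>n. V n)"
    define n where "n = (LEAST n. x \<in> V n)"
    have "x \<in> V n" unfolding n_def using x by (auto intro: LeastI)
    moreover have "x \<notin> V k" if "k < n" for k using not_less_Least that unfolding n_def by blast
    ultimately show "x \<in> (\<Union>n. A n)" using x by (auto simp: A_def)
  qed (auto simp: A_def)
  then show ?thesis using V_cover \<Omega>U by (auto simp: regular_def)
qed

text \<open>Cramer's rule for the coefficients expressing the gradient of \<open>v $ i\<close>
  through the rows of the Jacobian matrix of \<open>\<psi> (Some i)\<close>; by
  \<open>k_deriv\<close> these are the partial derivatives of the graph function \<open>k n\<close>.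
  The determinant formula is Borel in \<open>x\<close> and does not depend on the piece
  \<open>n\<close>.\<close>

definition slope :: "'n \<Rightarrow> real^'n \<Rightarrow> real" where
  "slope j x = indicator U x * det (\<chi> l m. if l = j then fst (blinfun_apply (u' x) (axis m 1)) $ i
       else matrix (blinfun_apply (\<psi>' (Some i) x)) $ l $ m) / minor (Some i) x"

text \<open>On \<open>W n\<close> this is the one coordinate of \<open>u\<close> that
  \<open>\<psi> (Some i)\<close> drops, as a function of the chart coordinates.\<close>

definition k :: "nat \<Rightarrow> real^'n \<Rightarrow> real" where "k n y = vU (\<sigma> n y) $ i"

lemma k_measurable [measurable]: "k n \<in> borel_measurable borel"
  unfolding k_def[abs_def] by measurable

lemma slope_measurable [measurable]: "slope j \<in> borel_measurable borel"
proof -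
  have [intro!]: "continuous_on U (\<lambda>x. fst (blinfun_apply (u' x) (axis m 1)) $ i)" for m
    by (intro continuous_intros u'_cont)
  have [intro!]: "continuous_on U (\<lambda>x. matrix (blinfun_apply (\<psi>' (Some i) x)) $ l $ m)" for l m
    unfolding matrix_def vec_lambda_beta by (intro continuous_intros \<psi>'_cont)
  have "continuous_on U (\<lambda>x. if l = j then fst (blinfun_apply (u' x) (axis m 1)) $ i
       else matrix (blinfun_apply (\<psi>' (Some i) x)) $ l $ m)" for l m
    by (cases "l = j") auto
  then have "continuous_on U (\<lambda>x. det (\<chi> l m. if l = j then fst (blinfun_apply (u' x) (axis m 1)) $ i
       else matrix (blinfun_apply (\<psi>' (Some i) x)) $ l $ m))"
    unfolding det_def vec_lambda_beta
    by (intro continuous_on_sum continuous_on_mult continuous_on_prod continuous_on_const)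
  from borel_measurable_continuous_on_indicator[OF U_borel this]
  have [measurable]: "(\<lambda>x. indicator U x * det (\<chi> l m. if l = j then fst (blinfun_apply (u' x) (axis m 1)) $ i
       else matrix (blinfun_apply (\<psi>' (Some i) x)) $ l $ m)) \<in> borel_measurable borel" by simp
  show ?thesis unfolding slope_def[abs_def] by measurable
qed

text \<open>
  In the coordinates given by \<open>\<psi> (Some i)\<close> the map \<open>u\<close> is a graph with slopes \<open>slope j\<close>, so its Jacobian is
  the one of the coordinate change times the area factor of a graph.
\<close>

lemma jac_eq_slope:
  assumes x: "x \<in> U" "minor (Some i) x \<noteq> 0"
  shows "jac x = \<bar>minor (Some i) x\<bar> * sqrt (1 + (\<Sum>j\<in>UNIV. (slope j x)\<^sup>2))"
proof -
  let ?d = "minor (Some i) x"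
  let ?num = "\<lambda>j. (\<chi> l m. if l = j then fst (blinfun_apply (u' x) (axis m 1)) $ i
       else matrix (blinfun_apply (\<psi>' (Some i) x)) $ l $ m) :: real^'n^'n"
  have num: "det (?num j) = slope j x * ?d" for j
    using x by (simp add: slope_def)
  \<comment> \<open>Omitting the last row means replacing the row of \<open>h\<close> by that of
    \<open>v $ i\<close>, which gives the numerator of \<open>slope i\<close>.\<close>
  have none: "minor None x = slope i x * ?d"
  proof -
    have "matrix (blinfun_apply (\<psi>' None x)) = ?num i"
      by (auto simp: vec_eq_iff matrix_def \<psi>'_apply coord_proj_def)
    then show ?thesis using num[of i] x by (simp add: minor_def)
  qed
  have some: "(minor (Some j) x)\<^sup>2 = (slope j x * ?d)\<^sup>2" if "j \<noteq> i" for j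
  proof -
    \<comment> \<open>The numerator of \<open>slope j\<close> and the minor for
      \<open>Some j\<close> have the same rows with \<open>i\<close> and \<open>j\<close> exchanged;
      the sign disappears in the square.\<close>
    have "det (?num j) = det (\<chi> l. ?num j $ Transposition.transpose i j l) * of_int (sign (Transposition.transpose i j))"
      using det_permute_rows[OF permutes_swap_id[of i UNIV j], of "?num j"]
      by (simp add: sign_swap_id that)
    moreover have "(\<chi> l. ?num j $ Transposition.transpose i j l) = matrix (blinfun_apply (\<psi>' (Some j) x))"
      using that by (auto simp: vec_eq_iff matrix_def \<psi>'_apply coord_proj_def Transposition.transpose_def)
    ultimately have "\<bar>det (?num j)\<bar> = \<bar>minor (Some j) x\<bar>"
      using x by (simp add: minor_def abs_mult sign_swap_id)
    then show ?thesis using num[of j] by (metis power2_abs)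
  qed
  have "(\<Sum>j\<in>UNIV. (minor j x)\<^sup>2) = (minor None x)\<^sup>2 + (\<Sum>j\<in>UNIV. (minor (Some j) x)\<^sup>2)"
    by (simp add: UNIV_option_conv sum.reindex)
  also have "(\<Sum>j\<in>UNIV. (minor (Some j) x)\<^sup>2) = ?d\<^sup>2 + (\<Sum>j\<in>UNIV - {i}. (slope j x * ?d)\<^sup>2)"
    by (subst sum.remove[of UNIV i]) (auto intro!: sum.cong some)
  also have "(minor None x)\<^sup>2 + \<dots> = ?d\<^sup>2 + (\<Sum>j\<in>UNIV. (slope j x * ?d)\<^sup>2)"
    by (simp add: none sum.remove[of UNIV i])
  also have "\<dots> = ?d\<^sup>2 * (1 + (\<Sum>j\<in>UNIV. (slope j x)\<^sup>2))"
    by (simp add: power_mult_distrib sum_distrib_left sum_distrib_right algebra_simps)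
  finally show ?thesis
    by (simp add: jac_def real_sqrt_mult)
qed

text \<open>Differentiating \<open>k n \<circ> \<psi> (Some i) = v $ i\<close> near the point
  expresses the gradient of \<open>v $ i\<close> as a combination of the rows of the chart's
  Jacobian matrix, with the partial derivatives of \<open>k n\<close> as coefficients; Cramer's rule
  identifies them.\<close>

lemma k_deriv:
  assumes y: "y \<in> W n"
  shows "(k n has_derivative (\<lambda>w. \<Sum>j\<in>UNIV. slope j (\<sigma> n y) * w $ j)) (at y)"
proof -
  let ?x = "\<sigma> n y"
  have x: "?x \<in> V n" "?x \<in> U" "\<psi> (Some i) ?x = y" "minor (Some i) ?x \<noteq> 0"
    using \<psi>_\<sigma>[OF y] V_sub by auto
  obtain D where D: "(\<sigma> n has_derivative D) (at y)" using \<sigma>_deriv[OF y] by blast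
  have vi: "((\<lambda>x. v x $ i) has_derivative (\<lambda>w. fst (blinfun_apply (u' ?x) w) $ i)) (at ?x)"
    using bounded_linear.has_derivative[OF bounded_linear_vec_nth
        bounded_linear.has_derivative[OF bounded_linear_fst u_deriv[OF x(2)]], of i] by simp
  let ?E = "\<lambda>w. fst (blinfun_apply (u' ?x) (D w)) $ i"
  have comp: "((\<lambda>y. v (\<sigma> n y) $ i) has_derivative ?E) (at y)"
    using diff_chain_at[OF D vi] by (simp add: comp_def)
  have kE: "(k n has_derivative ?E) (at y)"
    by (rule has_derivative_transform_within_open[OF comp VW_open(2) y])
       (simp add: k_def \<sigma>_in_U)
  have linE: "linear ?E" using kE by (rule has_derivative_linear)
  have "((k n \<circ> \<psi> (Some i)) has_derivative (?E \<circ> blinfun_apply (\<psi>' (Some i) ?x))) (at ?x)"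
    by (rule diff_chain_at[OF \<psi>_deriv[OF x(2)]]) (use kE x(3) in simp)
  moreover have "((k n \<circ> \<psi> (Some i)) has_derivative (\<lambda>w. fst (blinfun_apply (u' ?x) w) $ i)) (at ?x)"
    by (rule has_derivative_transform_within_open[OF vi VW_open(1) x(1)])
       (use \<sigma>_\<psi> V_sub(1)[THEN subsetD] in \<open>auto simp: k_def\<close>)
  ultimately have eq: "?E (blinfun_apply (\<psi>' (Some i) ?x) w) = fst (blinfun_apply (u' ?x) w) $ i" for w
    using has_derivative_unique by (metis comp_apply)
  have expand: "?E w = (\<Sum>l\<in>UNIV. ?E (axis l 1) * w $ l)" for w
  proof -
    have "w = (\<Sum>l\<in>UNIV. w $ l *\<^sub>R axis l 1)"
      by (simp add: vec_eq_iff axis_def if_distrib[of "\<lambda>a. _ * a"] cong: if_cong)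
    then have "?E w = ?E (\<Sum>l\<in>UNIV. w $ l *\<^sub>R axis l 1)" by simp
    also have "\<dots> = (\<Sum>l\<in>UNIV. w $ l *\<^sub>R ?E (axis l 1))"
      by (simp only: linear_sum[OF linE] linear_cmul[OF linE] o_def)
    finally show ?thesis by (simp add: mult.commute)
  qed
  let ?M = "matrix (blinfun_apply (\<psi>' (Some i) ?x))"
  have slope_eq: "slope j ?x = ?E (axis j 1)" for j
  proof -
    let ?c = "(\<chi> l. ?E (axis l 1)) :: real^'n"
    have "sum (\<lambda>l. ?c $ l *s row l ?M) UNIV $ m = fst (blinfun_apply (u' ?x) (axis m 1)) $ i" for m
      using expand[of "blinfun_apply (\<psi>' (Some i) ?x) (axis m 1)"] eq[of "axis m 1"]
      by (simp add: row_def matrix_def)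
    then have "(\<chi> l m. if l = j then fst (blinfun_apply (u' ?x) (axis m 1)) $ i else ?M $ l $ m) =
       (\<chi> l. if l = j then sum (\<lambda>l. ?c $ l *s row l ?M) UNIV else row l ?M)"
      by (simp add: vec_eq_iff row_def)
    then have "det (\<chi> l m. if l = j then fst (blinfun_apply (u' ?x) (axis m 1)) $ i else ?M $ l $ m) =
       ?E (axis j 1) * det ?M"
      using cramer_lemma_transpose[of j ?c ?M] by simp
    then show ?thesis using x by (simp add: slope_def minor_def)
  qed
  have "?E = (\<lambda>w. \<Sum>j\<in>UNIV. slope j ?x * w $ j)"
    unfolding slope_eq by (rule ext, rule expand)
  then show ?thesis using kE by simp
qed

end

section \<open>Symmetry of fibre integrals in one chart\<close>

lemma ennreal_suminf_swap:
  fixes f :: "nat \<Rightarrow> nat \<Rightarrow> ennreal"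
  shows "(\<Sum>m. \<Sum>n. f m n) = (\<Sum>n. \<Sum>m. f m n)"
  using nn_integral_suminf[of f "count_space UNIV"]
  by (simp add: nn_integral_count_space_nat)

lemma nn_integral_lborel_pair:
  fixes f :: "'a::euclidean_space \<times> 'b::euclidean_space \<Rightarrow> ennreal"
  assumes "f \<in> borel_measurable borel"
  shows "(\<integral>\<^sup>+p. f p \<partial>lborel) = (\<integral>\<^sup>+x. \<integral>\<^sup>+y. f (x, y) \<partial>lborel \<partial>lborel)"
    and "(\<integral>\<^sup>+p. f p \<partial>lborel) = (\<integral>\<^sup>+y. \<integral>\<^sup>+x. f (x, y) \<partial>lborel \<partial>lborel)"
proof -
  have f: "f \<in> borel_measurable (lborel \<Otimes>\<^sub>M lborel)" using assms by (simp add: lborel_prod)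
  show "(\<integral>\<^sup>+p. f p \<partial>lborel) = (\<integral>\<^sup>+x. \<integral>\<^sup>+y. f (x, y) \<partial>lborel \<partial>lborel)"
    using lborel.nn_integral_fst[OF f] by (simp add: lborel_prod)
  show "(\<integral>\<^sup>+p. f p \<partial>lborel) = (\<integral>\<^sup>+y. \<integral>\<^sup>+x. f (x, y) \<partial>lborel \<partial>lborel)"
    using lborel_pair.nn_integral_snd[OF f] by (simp add: lborel_prod)
qed

context chart_pieces
begin

section \<open>Pairs of points on a common fibre\<close>

definition pull :: "nat \<Rightarrow> (real^'n \<Rightarrow> real) \<Rightarrow> real^'n \<Rightarrow> real" where
  "pull n F y = (if y \<in> W n \<and> \<sigma> n y \<in> A n then F (\<sigma> n y) else 0)"

lemma pull_measurable [measurable]: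
  assumes [measurable]: "F \<in> borel_measurable borel"
  shows "pull n F \<in> borel_measurable borel"
  unfolding pull_def[abs_def] by measurable

lemma pull_nonneg: "(\<And>x. 0 \<le> F x) \<Longrightarrow> 0 \<le> pull n F y"
  by (simp add: pull_def)

lemma image_A: "\<psi> (Some i) ` A n = {y \<in> W n. \<sigma> n y \<in> A n}"
proof (intro set_eqI iffI)
  fix y assume "y \<in> \<psi> (Some i) ` A n"
  then show "y \<in> {y \<in> W n. \<sigma> n y \<in> A n}" using \<sigma>_\<psi> A_sub(1) by fastforce
next
  fix y assume "y \<in> {y \<in> W n. \<sigma> n y \<in> A n}"
  then show "y \<in> \<psi> (Some i) ` A n" using \<psi>_\<sigma> by (metis (mono_tags, lifting) image_eqI mem_Collect_eq)
qed

definition \<psi>U :: "real^'n \<Rightarrow> real^'n" where "\<psi>U x = replace_coord i (hU x) (vU x)"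

lemma \<psi>U_measurable [measurable]: "\<psi>U \<in> borel_measurable borel"
  unfolding \<psi>U_def[abs_def] by measurable

lemma \<psi>U_eq: "x \<in> U \<Longrightarrow> \<psi>U x = \<psi> (Some i) x"
  by (simp add: \<psi>U_def \<psi>_Some)

lemma A_in: "x \<in> A n \<Longrightarrow> x \<in> U \<and> x \<in> \<Omega> \<and> x \<in> V n \<and> minor (Some i) x \<noteq> 0"
  using A_sub[of n] V_sub by blast

text \<open>Change of variables by \<open>\<psi> (Some i)\<close> on one piece: the absolute minor
  it produces cancels the division. \<open>R\<close> collects the part of the integrand that depends
  on \<open>x\<close> only through its chart coordinates.\<close>

lemma nn_integral_A:
  assumes F [measurable]: "F \<in> borel_measurable borel" and F0: "\<And>x. 0 \<le> F x"
    and R [measurable]: "R \<in> borel_measurable borel" and R0: "\<And>y. 0 \<le> R y"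
  shows "(\<integral>\<^sup>+x. ennreal (indicator (A n) x * (F x * R (\<psi>U x))) \<partial>lborel) =
         (\<integral>\<^sup>+y. ennreal (pull n (\<lambda>x. F x / \<bar>minor (Some i) x\<bar>) y * R y) \<partial>lborel)"
proof -
  let ?P = "\<lambda>y. pull n (\<lambda>x. F x / \<bar>minor (Some i) x\<bar>) y * R y"
  have eq: "indicator (A n) x * (\<bar>det (matrix (blinfun_apply (\<psi>' (Some i) x)))\<bar> * ?P (\<psi> (Some i) x)) =
      indicator (A n) x * (F x * R (\<psi>U x))" for x
  proof (cases "x \<in> A n")
    case True
    then have "pull n (\<lambda>x. F x / \<bar>minor (Some i) x\<bar>) (\<psi> (Some i) x) = F x / \<bar>minor (Some i) x\<bar>"
      using A_in \<sigma>_\<psi> by (simp add: pull_def)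
    then show ?thesis using A_in[OF True] by (simp add: minor_def \<psi>U_eq)
  qed simp
  have "(\<integral>\<^sup>+x. ennreal (indicator (A n) x * (\<bar>det (matrix (blinfun_apply (\<psi>' (Some i) x)))\<bar> * ?P (\<psi> (Some i) x))) \<partial>lborel) =
     (\<integral>\<^sup>+y. ennreal (indicator (\<psi> (Some i) ` A n) y * ?P y) \<partial>lborel)"
  proof (rule nn_integral_substitution)
    show "\<psi> (Some i) ` A n \<in> sets borel" unfolding image_A by measurable
    show "(\<psi> (Some i) has_derivative blinfun_apply (\<psi>' (Some i) x)) (at x within A n)" if "x \<in> A n" for x
      using \<psi>_deriv A_in[OF that] has_derivative_at_withinI by blast
    show "inj_on (\<psi> (Some i)) (A n)"
      using A_in \<sigma>_\<psi> by (metis inj_onI)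
    show "?P \<in> borel_measurable borel" by measurable
    show "0 \<le> ?P y" for y using F0 R0 by (simp add: pull_nonneg)
    show "(\<lambda>x. indicator (A n) x * (\<bar>det (matrix (blinfun_apply (\<psi>' (Some i) x)))\<bar> * ?P (\<psi> (Some i) x))) \<in> borel_measurable borel"
      unfolding eq by measurable
  qed simp
  also have "(\<integral>\<^sup>+y. ennreal (indicator (\<psi> (Some i) ` A n) y * ?P y) \<partial>lborel) = (\<integral>\<^sup>+y. ennreal (?P y) \<partial>lborel)"
    unfolding image_A by (intro nn_integral_cong arg_cong[where f=ennreal]) (auto simp: pull_def)
  finally show ?thesis unfolding eq .
qed

definition kern :: "nat \<Rightarrow> (real^'n \<Rightarrow> real) \<Rightarrow> real^'n \<Rightarrow> real \<Rightarrow> real" where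
  "kern n G y s = (if k n y = s then pull n G y else 0)"

text \<open>The value of \<open>G\<close> at the point of \<open>regular i\<close> with \<open>\<psi> (Some i)\<close>-coordinates \<open>y\<close> and \<open>v $ i = s\<close>, if any.\<close>

definition at_chart :: "(real^'n \<Rightarrow> real) \<Rightarrow> real^'n \<Rightarrow> real \<Rightarrow> ennreal" where
  "at_chart G y s = (\<Sum>n. ennreal (kern n G y s))"

text \<open>\<open>fst p\<close> are the chart coordinates of a first point, in piece
  \<open>m\<close>. A second point on the same fibre at level \<open>snd p\<close> can only have the
  coordinates \<open>replace_coord i (snd p) (fst p)\<close>, and \<open>kern\<close> keeps it, in
  piece \<open>n\<close>, exactly when it also has the same \<open>v $ i\<close>.\<close>

definition pairing :: "nat \<Rightarrow> nat \<Rightarrow> (real^'n \<Rightarrow> real) \<Rightarrow> (real^'n \<Rightarrow> real) \<Rightarrow> ennreal" where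
  "pairing m n F G = (\<integral>\<^sup>+p. ennreal (pull m F (fst p) * kern n G (replace_coord i (snd p) (fst p)) (k m (fst p)))
     \<partial>(lborel :: ((real^'n) \<times> real) measure))"

lemma kern_measurable [measurable (raw)]:
  assumes [measurable]: "G \<in> borel_measurable borel" "f \<in> borel_measurable M" "g \<in> borel_measurable M"
  shows "(\<lambda>x. kern n G (f x) (g x)) \<in> borel_measurable M"
  unfolding kern_def by measurable

text \<open>\<open>swap_coord i\<close> exchanges the two points, and equality of their
  \<open>v $ i\<close> is a symmetric condition.\<close>

lemma pairing_swap:
  assumes [measurable]: "F \<in> borel_measurable borel" "G \<in> borel_measurable borel"
  shows "pairing m n F G = pairing n m G F"
proof -
  have "pairing n m G F = (\<integral>\<^sup>+p. ennreal (pull n G (fst (swap_coord i p)) *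
      kern m F (replace_coord i (snd (swap_coord i p)) (fst (swap_coord i p))) (k n (fst (swap_coord i p)))) \<partial>lborel)"
    unfolding pairing_def
    by (rule nn_integral_swap_coord[symmetric, of "\<lambda>p. ennreal (pull n G (fst p) * kern m F (replace_coord i (snd p) (fst p)) (k n (fst p)))"]) measurable
  also have "\<dots> = pairing m n F G"
    unfolding pairing_def
    by (intro nn_integral_cong) (auto simp: kern_def mult.commute)
  finally show ?thesis ..
qed

lemma AE_slope_eq:
  "AE p in (lborel :: ((real^'n) \<times> real) measure). fst p \<in> W m \<and> replace_coord i (snd p) (fst p) \<in> W n \<and>
     k n (replace_coord i (snd p) (fst p)) = k m (fst p) \<longrightarrow>
     (\<forall>j. slope j (\<sigma> m (fst p)) = slope j (\<sigma> n (replace_coord i (snd p) (fst p))))"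
proof -
  let ?r = "\<lambda>p. replace_coord i (snd p) (fst p)"
  define H where "H p = k m (fst p) - k n (?r p)" for p
  define Z where "Z = {p. fst p \<in> W m \<and> ?r p \<in> W n \<and> H p = 0}"
  define H' where "H' p w = (\<Sum>j\<in>UNIV. slope j (\<sigma> m (fst p)) * fst w $ j) -
      (\<Sum>j\<in>UNIV. slope j (\<sigma> n (?r p)) * ?r w $ j)" for p w :: "(real^'n) \<times> real"
  have [measurable]: "H \<in> borel_measurable borel" unfolding H_def by measurable
  have [measurable]: "Z \<in> sets borel" unfolding Z_def by measurable
  have der: "(H has_derivative H' p) (at p)" if "p \<in> Z" for p
  proof -
    have 1: "(k m has_derivative (\<lambda>w. \<Sum>j\<in>UNIV. slope j (\<sigma> m (fst p)) * w $ j)) (at (fst p))"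
      using that by (intro k_deriv) (simp add: Z_def)
    have 2: "(k n has_derivative (\<lambda>w. \<Sum>j\<in>UNIV. slope j (\<sigma> n (?r p)) * w $ j)) (at (?r p))"
      using that by (intro k_deriv) (simp add: Z_def)
    have 3: "(fst has_derivative fst) (at p)"
      by (rule bounded_linear_imp_has_derivative[OF bounded_linear_fst])
    have 4: "(?r has_derivative ?r) (at p)"
      by (rule bounded_linear_imp_has_derivative[OF bounded_linear_replace_coord])
    show ?thesis
      using has_derivative_diff[OF diff_chain_at[OF 3 1] diff_chain_at[OF 4 2]]
      unfolding H_def[abs_def] H'_def[abs_def] comp_def .
  qed
  have AE: "AE p in lborel. p \<in> Z \<longrightarrow> H' p e = 0" for e
  proof (rule AE_derivative_zero_on_zero_set)
    show "H p = 0" if "p \<in> Z" for p using that by (simp add: Z_def)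
    show "(H has_derivative H' p) (at p)" if "p \<in> Z" for p using der[OF that] .
    show "{p \<in> Z. H' p e \<noteq> 0} \<in> sets borel" unfolding H'_def by measurable
  qed
  have "AE p in lborel. \<forall>j\<in>UNIV. p \<in> Z \<longrightarrow> H' p (axis j 1, 0) = 0"
    by (rule AE_finite_allI[OF finite]) (rule AE)
  with AE[of "(0, 1)"] show ?thesis
  proof eventually_elim
    case (elim p)
    show ?case
    proof
      assume asm: "fst p \<in> W m \<and> ?r p \<in> W n \<and> k n (?r p) = k m (fst p)"
      then have Z: "p \<in> Z" by (simp add: Z_def H_def)
      have sum_axis: "(\<Sum>l\<in>UNIV. c l * (axis j 1 :: real^'n) $ l) = c j" for c j
        by (simp add: axis_def if_distrib[of "\<lambda>a. _ * a"] cong: if_cong)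
      \<comment> \<open>The direction \<open>(0, 1)\<close> moves only coordinate \<open>i\<close>
        of the second point and \<open>(axis i 1, 0)\<close> only that of the first, so both slopes
        in direction \<open>i\<close> vanish. The other directions move both points alike and give
        equality.\<close>
      have "replace_coord i 1 0 = (axis i 1 :: real^'n)" by (simp add: vec_eq_iff axis_def)
      then have n0: "slope i (\<sigma> n (?r p)) = 0"
        using elim(1) Z by (simp add: H'_def sum_axis)
      have "replace_coord i 0 (axis i 1) = (0 :: real^'n)" by (simp add: vec_eq_iff axis_def)
      then have m0: "slope i (\<sigma> m (fst p)) = 0"
        using elim(2)[rule_format, OF UNIV_I Z, of i] by (simp add: H'_def sum_axis)
      have "slope j (\<sigma> m (fst p)) = slope j (\<sigma> n (?r p))" if "j \<noteq> i" for j
      proof -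
        have "replace_coord i 0 (axis j 1) = (axis j 1 :: real^'n)" using that by (auto simp: vec_eq_iff axis_def)
        then show ?thesis using elim(2)[rule_format, OF UNIV_I Z, of j] by (simp add: H'_def sum_axis)
      qed
      with n0 m0 show "\<forall>j. slope j (\<sigma> m (fst p)) = slope j (\<sigma> n (?r p))" by metis
    qed
  qed
qed

text \<open>Both Jacobians are the absolute minor times an area factor that depends only on the
  slopes, which agree for almost all pairs. Hence \<open>jac\<close> and the absolute minor may
  trade places between the two points.\<close>

lemma pairing_weights:
  "pairing m n (\<lambda>x. F x / \<bar>minor (Some i) x\<bar>) (\<lambda>x. G x / jac x) =
   pairing m n (\<lambda>x. F x / jac x) (\<lambda>x. G x / \<bar>minor (Some i) x\<bar>)"
  unfolding pairing_def
proof (rule nn_integral_cong_AE)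
  let ?r = "\<lambda>p. replace_coord i (snd p) (fst p)"
  show "AE p in (lborel :: ((real^'n) \<times> real) measure).
    ennreal (pull m (\<lambda>x. F x / \<bar>minor (Some i) x\<bar>) (fst p) * kern n (\<lambda>x. G x / jac x) (?r p) (k m (fst p))) =
    ennreal (pull m (\<lambda>x. F x / jac x) (fst p) * kern n (\<lambda>x. G x / \<bar>minor (Some i) x\<bar>) (?r p) (k m (fst p)))"
    using AE_slope_eq[of m n]
  proof eventually_elim
    case (elim p)
    show ?case
    proof (cases "fst p \<in> W m \<and> \<sigma> m (fst p) \<in> A m \<and> ?r p \<in> W n \<and> \<sigma> n (?r p) \<in> A n \<and> k n (?r p) = k m (fst p)")
      case True
      let ?x = "\<sigma> m (fst p)" and ?x' = "\<sigma> n (?r p)"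
      define q where "q = sqrt (1 + (\<Sum>j\<in>UNIV. (slope j ?x)\<^sup>2))"
      have q: "jac ?x = \<bar>minor (Some i) ?x\<bar> * q" "jac ?x' = \<bar>minor (Some i) ?x'\<bar> * q"
        using jac_eq_slope[of ?x] jac_eq_slope[of ?x'] A_in True elim by (auto simp: q_def)
      show ?thesis using True by (simp add: pull_def kern_def q field_simps)
    qed (auto simp: pull_def kern_def)
  qed
qed

text \<open>On each piece and for a fixed level the fibre value depends on \<open>x\<close> only
  through its chart coordinates, so the change of variables applies; its Jacobian is the origin of
  the weight on \<open>F\<close>.\<close>

lemma nn_integral_regular_at_chart:
  assumes F [measurable]: "F \<in> borel_measurable borel" and F0: "\<And>x. 0 \<le> F x"
    and G [measurable]: "G \<in> borel_measurable borel" and G0: "\<And>x. 0 \<le> G x"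
  shows "(\<integral>\<^sup>+x. indicator (regular i) x * (ennreal (F x) *
           (\<integral>\<^sup>+t. at_chart G (replace_coord i t (vU x)) (vU x $ i) \<partial>lborel)) \<partial>lborel) =
         (\<Sum>m. \<Sum>n. pairing m n (\<lambda>x. F x / \<bar>minor (Some i) x\<bar>) G)"
proof -
  have k0: "0 \<le> kern n G y s" for n y s using G0 by (simp add: kern_def pull_nonneg)
  have piece: "(\<integral>\<^sup>+x. indicator (A m) x * (ennreal (F x) *
      (\<integral>\<^sup>+t. ennreal (kern n G (replace_coord i t (vU x)) (vU x $ i)) \<partial>lborel)) \<partial>lborel) =
     pairing m n (\<lambda>x. F x / \<bar>minor (Some i) x\<bar>) G" for m n
  proof -
    have "(\<integral>\<^sup>+x. indicator (A m) x * (ennreal (F x) *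
      (\<integral>\<^sup>+t. ennreal (kern n G (replace_coord i t (vU x)) (vU x $ i)) \<partial>lborel)) \<partial>lborel) =
      (\<integral>\<^sup>+x. \<integral>\<^sup>+t. ennreal (indicator (A m) x * (F x * kern n G (replace_coord i t (vU x)) (vU x $ i))) \<partial>lborel \<partial>lborel)"
      using F0 k0 by (simp add: nn_integral_cmult[symmetric] ennreal_mult' ennreal_indicator)
    also have "\<dots> = (\<integral>\<^sup>+t. \<integral>\<^sup>+x. ennreal (indicator (A m) x * (F x * kern n G (replace_coord i t (vU x)) (vU x $ i))) \<partial>lborel \<partial>lborel)"
      by (rule lborel_pair.Fubini'[symmetric]) (simp add: split_beta')
    also have "\<dots> = (\<integral>\<^sup>+t. \<integral>\<^sup>+y. ennreal (pull m (\<lambda>x. F x / \<bar>minor (Some i) x\<bar>) y * kern n G (replace_coord i t y) (k m y)) \<partial>lborel \<partial>lborel)"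
    proof (rule nn_integral_cong)
      fix t
      have "(\<integral>\<^sup>+x. ennreal (indicator (A m) x * (F x * kern n G (replace_coord i t (vU x)) (vU x $ i))) \<partial>lborel) =
         (\<integral>\<^sup>+x. ennreal (indicator (A m) x * (F x * kern n G (replace_coord i t (\<psi>U x)) (k m (\<psi>U x)))) \<partial>lborel)"
      proof (intro nn_integral_cong arg_cong[where f=ennreal])
        fix x
        show "indicator (A m) x * (F x * kern n G (replace_coord i t (vU x)) (vU x $ i)) =
          indicator (A m) x * (F x * kern n G (replace_coord i t (\<psi>U x)) (k m (\<psi>U x)))"
        proof (cases "x \<in> A m")
          case True
          then have "\<psi>U x = \<psi> (Some i) x" "\<sigma> m (\<psi> (Some i) x) = x"
            using A_in \<sigma>_\<psi> by (auto simp: \<psi>U_eq)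
          then have "k m (\<psi>U x) = vU x $ i" by (simp add: k_def)
          moreover have "replace_coord i t (\<psi>U x) = replace_coord i t (vU x)" by (simp add: \<psi>U_def)
          ultimately show ?thesis by simp
        qed simp
      qed
      also have "\<dots> = (\<integral>\<^sup>+y. ennreal (pull m (\<lambda>x. F x / \<bar>minor (Some i) x\<bar>) y * kern n G (replace_coord i t y) (k m y)) \<partial>lborel)"
        by (rule nn_integral_A) (use F0 k0 in auto)
      finally show "(\<integral>\<^sup>+x. ennreal (indicator (A m) x * (F x * kern n G (replace_coord i t (vU x)) (vU x $ i))) \<partial>lborel) = \<dots>" .
    qed
    also have "\<dots> = pairing m n (\<lambda>x. F x / \<bar>minor (Some i) x\<bar>) G"
      unfolding pairing_def by (subst nn_integral_lborel_pair(2)) simp_all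
    finally show ?thesis .
  qed
  have ind: "indicator (regular i) x = (\<Sum>m. indicator (A m) x :: ennreal)" for x
    unfolding A_Union[symmetric]
    by (rule suminf_indicator[symmetric]) (use A_disjoint in \<open>auto simp: disjoint_family_on_def\<close>)
  have "(\<integral>\<^sup>+x. indicator (regular i) x * (ennreal (F x) *
           (\<integral>\<^sup>+t. at_chart G (replace_coord i t (vU x)) (vU x $ i) \<partial>lborel)) \<partial>lborel) =
     (\<integral>\<^sup>+x. (\<Sum>m. \<Sum>n. indicator (A m) x * (ennreal (F x) *
      (\<integral>\<^sup>+t. ennreal (kern n G (replace_coord i t (vU x)) (vU x $ i)) \<partial>lborel))) \<partial>lborel)"
    unfolding at_chart_def ind
    by (simp add: nn_integral_suminf ennreal_suminf_cmult ennreal_suminf_multc del: suminf_indicator)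
  also have "\<dots> = (\<Sum>m. \<integral>\<^sup>+x. (\<Sum>n. indicator (A m) x * (ennreal (F x) *
      (\<integral>\<^sup>+t. ennreal (kern n G (replace_coord i t (vU x)) (vU x $ i)) \<partial>lborel))) \<partial>lborel)"
    by (rule nn_integral_suminf) measurable
  also have "\<dots> = (\<Sum>m. \<Sum>n. \<integral>\<^sup>+x. indicator (A m) x * (ennreal (F x) *
      (\<integral>\<^sup>+t. ennreal (kern n G (replace_coord i t (vU x)) (vU x $ i)) \<partial>lborel)) \<partial>lborel)"
    by (intro arg_cong[where f=suminf] ext nn_integral_suminf) measurable
  also have "\<dots> = (\<Sum>m. \<Sum>n. pairing m n (\<lambda>x. F x / \<bar>minor (Some i) x\<bar>) G)"
    by (simp only: piece)
  finally show ?thesis .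
qed

text \<open>The weights are traded between the two points, then the points are exchanged; summation
  over all pairs of pieces is symmetric.\<close>

lemma at_chart_symmetric:
  assumes F [measurable]: "F \<in> borel_measurable borel" and F0: "\<And>x. 0 \<le> F x"
    and G [measurable]: "G \<in> borel_measurable borel" and G0: "\<And>x. 0 \<le> G x"
  shows "(\<integral>\<^sup>+x. indicator (regular i) x * (ennreal (F x) *
           (\<integral>\<^sup>+t. at_chart (\<lambda>x. G x / jac x) (replace_coord i t (vU x)) (vU x $ i) \<partial>lborel)) \<partial>lborel) =
         (\<integral>\<^sup>+x. indicator (regular i) x * (ennreal (G x) *
           (\<integral>\<^sup>+t. at_chart (\<lambda>x. F x / jac x) (replace_coord i t (vU x)) (vU x $ i) \<partial>lborel)) \<partial>lborel)"
proof -
  have j0: "0 \<le> jac x" for x by (simp add: jac_def sum_nonneg)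
  have "(\<Sum>m. \<Sum>n. pairing m n (\<lambda>x. F x / \<bar>minor (Some i) x\<bar>) (\<lambda>x. G x / jac x)) =
     (\<Sum>m. \<Sum>n. pairing n m (\<lambda>x. G x / \<bar>minor (Some i) x\<bar>) (\<lambda>x. F x / jac x))"
    by (simp add: pairing_weights pairing_swap[of "\<lambda>x. F x / jac x"])
  also have "\<dots> = (\<Sum>n. \<Sum>m. pairing n m (\<lambda>x. G x / \<bar>minor (Some i) x\<bar>) (\<lambda>x. F x / jac x))"
    by (rule ennreal_suminf_swap)
  finally show ?thesis
    using F0 G0 j0 by (simp add: nn_integral_regular_at_chart)
qed

text \<open>Chart coordinates and \<open>v $ i\<close> determine the value of \<open>u\<close>, so
  by injectivity at most one piece contributes to the sum. The condition on \<open>t\<close>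
  excludes that the fibre point at this level is irregular, where the chart would miss it.\<close>

lemma at_chart_eq_at_inverse:
  assumes x: "x \<in> regular i" and G0: "\<And>x. 0 \<le> G x"
    and t: "replace_coord i t (v x) \<notin> \<psi> (Some i) ` (\<Omega> - regular i)"
  shows "at_chart G (replace_coord i t (vU x)) (vU x $ i) = ennreal (at_inverse \<Omega> u G (v x, t))"
proof -
  let ?y = "replace_coord i t (v x)"
  have xU: "x \<in> U" using x \<Omega>U by (auto simp: regular_def)
  have unique: "u (\<sigma> n ?y) = (v x, t) \<and> \<sigma> n ?y \<in> \<Omega>"
    if "?y \<in> W n" "\<sigma> n ?y \<in> A n" "k n ?y = v x $ i" for n
  proof -
    have ps: "\<psi> (Some i) (\<sigma> n ?y) = ?y" using \<psi>_\<sigma> that by blast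
    have sU: "\<sigma> n ?y \<in> U" using A_in that by blast
    have "h (\<sigma> n ?y) = t" using arg_cong[OF ps, of "\<lambda>z. z $ i"] by (simp add: \<psi>_Some)
    moreover have "v (\<sigma> n ?y) $ l = v x $ l" for l
    proof (cases "l = i")
      case True
      then show ?thesis using that(3) sU by (simp add: k_def)
    next
      case False
      then show ?thesis using arg_cong[OF ps, of "\<lambda>z. z $ l"] by (simp add: \<psi>_Some)
    qed
    ultimately show ?thesis using A_in that(2) by (simp add: vec_eq_iff)
  qed
  show ?thesis
  proof (cases "(v x, t) \<in> u ` \<Omega>")
    case True
    then obtain x' where x': "x' \<in> \<Omega>" "u x' = (v x, t)" by auto
    then have "\<psi> (Some i) x' = ?y" by (simp add: \<psi>_Some)
    with t x'(1) have "x' \<in> regular i" by (metis DiffI imageI)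
    then obtain n where n: "x' \<in> A n" using A_Union by auto
    have y: "?y \<in> W n" "\<sigma> n ?y = x'"
      using \<sigma>_\<psi>[of x' n] A_in[OF n] \<open>\<psi> (Some i) x' = ?y\<close> by auto
    have "k n ?y = v x $ i" using y A_in[OF n] x' by (simp add: k_def)
    then have kn: "kern n G ?y (v x $ i) = G x'" using y n by (simp add: kern_def pull_def)
    have km: "kern m G ?y (v x $ i) = 0" if "m \<noteq> n" for m
    proof (rule ccontr)
      assume "kern m G ?y (v x $ i) \<noteq> 0"
      then have m: "?y \<in> W m" "\<sigma> m ?y \<in> A m" "k m ?y = v x $ i"
        by (auto simp: kern_def pull_def split: if_splits)
      have "\<sigma> m ?y = x'" by (rule inj_onD[OF u_inj]) (use unique[OF m] x' in auto)
      then show False using A_disjoint m(2) n that by blast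
    qed
    have "at_chart G ?y (v x $ i) = (\<Sum>m\<in>{n}. ennreal (kern m G ?y (v x $ i)))"
      unfolding at_chart_def by (rule suminf_finite) (use km in auto)
    moreover have "the_inv_into \<Omega> u (v x, t) = x'"
      using the_inv_into_f_f[OF u_inj x'(1)] x'(2) by simp
    ultimately show ?thesis using True xU kn by (simp add: at_inverse_def)
  next
    case False
    have "kern n G ?y (v x $ i) = 0" for n
    proof (rule ccontr)
      assume "kern n G ?y (v x $ i) \<noteq> 0"
      then have m: "?y \<in> W n" "\<sigma> n ?y \<in> A n" "k n ?y = v x $ i"
        by (auto simp: kern_def pull_def split: if_splits)
      show False using unique[OF m] False by (metis (no_types, lifting) image_eqI)
    qed
    then show ?thesis using False xU by (simp add: at_chart_def at_inverse_def)
  qed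
qed

end

section \<open>Symmetry of fibre integrals\<close>

lemma AE_lborel_pairD:
  fixes P :: "'a::euclidean_space \<times> 'b::euclidean_space \<Rightarrow> bool"
  assumes "AE p in lborel. P p"
  shows "AE x in lborel. AE y in lborel. P (x, y)" and "AE y in lborel. AE x in lborel. P (x, y)"
proof -
  have *: "AE p in (lborel :: 'a measure) \<Otimes>\<^sub>M (lborel :: 'b measure). P p"
    using assms by (subst lborel_prod)
  show "AE x in lborel. AE y in lborel. P (x, y)" using lborel_pair.AE_pair[OF *] .
  have "AE p in (lborel :: 'b measure) \<Otimes>\<^sub>M (lborel :: 'a measure). P (case p of (y, x) \<Rightarrow> (x, y))"
  proof (rule AE_distrD[OF measurable_pair_swap'])
    show "AE p in distr ((lborel :: 'b measure) \<Otimes>\<^sub>M (lborel :: 'a measure)) (lborel \<Otimes>\<^sub>M lborel) (\<lambda>(y, x). (x, y)). P p"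
      using * by (subst lborel_pair.distr_pair_swap[symmetric])
  qed
  from lborel_pair.AE_pair[OF this] show "AE y in lborel. AE x in lborel. P (x, y)" by simp
qed

context chart
begin

lemma ex_pieces: "\<exists>V W \<sigma>. (\<forall>n::nat. local_inverse (\<psi> j) (V n) (W n) (\<sigma> n)) \<and> (\<Union>n. V n) = {x \<in> U. minor j x \<noteq> 0}"
proof -
  have "{x \<in> U. minor j x \<noteq> 0} = {x \<in> U. det (matrix (blinfun_apply (\<psi>' j x))) \<noteq> 0}"
    by (auto simp: minor_def)
  then show ?thesis using local_inverse_cover[OF U_open \<psi>_deriv[of _ j] \<psi>'_cont[of j]] by simp
qed

lemma ex_chart_pieces: "\<exists>V W \<sigma>. chart_pieces \<Omega> U v h u' i V W \<sigma>"
  using ex_pieces[of "Some i"] chart_axioms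
  by (auto simp: chart_pieces_def chart_pieces_axioms_def)

text \<open>For a point of \<Omega> paired with a level: what \<open>P\<close> is at the point of
  the same fibre at that level. Using points rather than values of \<open>v\<close> as base keeps
  Lebesgue measure as the only reference measure.\<close>

abbreviation on_fibre :: "(real^'n \<Rightarrow> real) \<Rightarrow> (real^'n) \<times> real \<Rightarrow> real" where
  "on_fibre P p \<equiv> at_inverse \<Omega> u P (v (fst p), snd p)"

lemma at_inverse_u: "x \<in> \<Omega> \<Longrightarrow> at_inverse \<Omega> u P (u x) = P x"
  using the_inv_into_f_f[OF u_inj] by (auto simp: at_inverse_def)

text \<open>The witness is found before \<open>P\<close> is given, so the values of several
  functions refer to the same point of the fibre.\<close>

lemma at_inverse_cases:
  obtains x where "x \<in> \<Omega>" "v x = z" "h x = t" "\<And>P. at_inverse \<Omega> u P (z, t) = P x"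
    | "(z, t) \<notin> u ` \<Omega>" "\<And>P. at_inverse \<Omega> u P (z, t) = 0"
proof (cases "(z, t) \<in> u ` \<Omega>")
  case True
  then obtain x where "x \<in> \<Omega>" "v x = z" "h x = t" by auto
  then show thesis using that(1) at_inverse_u[of x] by auto
qed (use that(2) in \<open>auto simp: at_inverse_def\<close>)

text \<open>If the fibre over \<open>v x\<close> meets \<open>Z\<close> at level \<open>t\<close>,
  then overwriting coordinate \<open>i\<close> of \<open>v x\<close> with \<open>t\<close> gives the
  chart coordinates of that point, which range over a null set.\<close>

lemma AE_regular_fibre_notin:
  assumes "negligible (\<psi> (Some i) ` Z)"
  shows "AE p in lborel. fst p \<in> regular i \<longrightarrow> (v (fst p), snd p) \<notin> u ` Z"
  using AE_replace_coord_v_notin[OF assms, of i]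
proof eventually_elim
  case (elim p)
  show ?case
  proof (intro impI notI)
    assume "fst p \<in> regular i" "(v (fst p), snd p) \<in> u ` Z"
    then obtain x where "x \<in> Z" "v (fst p) = v x" "snd p = h x" by auto
    then show False using elim \<open>fst p \<in> regular i\<close> by (auto simp: \<psi>_Some)
  qed
qed

lemma negligible_image_irregular: "negligible (\<psi> (Some i) ` (\<Omega> - regular i))"
  by (rule negligible_subset[OF negligible_image_minor_zero]) (use \<Omega>U in \<open>auto simp: regular_def\<close>)

text \<open>The fibre integral of the overview, with \<open>jac\<close> in place of
  \<open>jacobian_m\<close> and over the whole line, as \<open>at_inverse\<close> is 0 off the
  fibre.\<close>

definition fibre_int :: "(real^'n \<Rightarrow> real) \<Rightarrow> real^'n \<Rightarrow> ennreal" where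
  "fibre_int G z = (\<integral>\<^sup>+t. ennreal (at_inverse \<Omega> u (\<lambda>x. G x / jac x) (z, t)) \<partial>lborel)"

lemma AE_on_fibre_at_chart:
  assumes "chart_pieces \<Omega> U v h u' i V W \<sigma>" and P0: "\<And>x. 0 \<le> P x"
  shows "AE p in lborel. fst p \<in> regular i \<longrightarrow>
    ennreal (on_fibre P p) = chart_pieces.at_chart \<Omega> U v i V W \<sigma> P (replace_coord i (snd p) (vU (fst p))) (vU (fst p) $ i)"
proof -
  interpret chart_pieces \<Omega> U v h u' i V W \<sigma> by fact
  show ?thesis
    using AE_replace_coord_v_notin[OF negligible_image_irregular, of i i]
  proof eventually_elim
    case (elim p)
    then show ?case using at_chart_eq_at_inverse[OF _ P0] by auto
  qed
qed

text \<open>Joint measurability of \<open>on_fibre\<close> is not evident from its definition; the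
  series \<open>at_chart\<close> of Borel terms supplies a version.\<close>

lemma regular_on_fibre_measurable_version:
  assumes P [measurable]: "P \<in> borel_measurable borel" and P0: "\<And>x. 0 \<le> P x"
  shows "\<exists>\<Lambda> \<in> borel_measurable borel. AE p in lborel. fst p \<in> regular i \<longrightarrow> ennreal (on_fibre P p) = \<Lambda> p"
proof -
  obtain V W \<sigma> where cp: "chart_pieces \<Omega> U v h u' i V W \<sigma>" using ex_chart_pieces by blast
  then interpret chart_pieces \<Omega> U v h u' i V W \<sigma> .
  let ?L = "\<lambda>p. at_chart P (replace_coord i (snd p) (vU (fst p))) (vU (fst p) $ i)"
  have "?L \<in> borel_measurable borel" unfolding at_chart_def by measurable
  then show ?thesis
    by (rule bexI[of _ ?L, rotated]) (rule AE_on_fibre_at_chart[where P=P, OF cp P0])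
qed

lemma regular_fibre_int_symmetric:
  assumes F [measurable]: "F \<in> borel_measurable borel" and F0: "\<And>x. 0 \<le> F x"
    and G [measurable]: "G \<in> borel_measurable borel" and G0: "\<And>x. 0 \<le> G x"
  shows "(\<integral>\<^sup>+x. indicator (regular i) x * (ennreal (F x) * fibre_int G (v x)) \<partial>lborel) =
         (\<integral>\<^sup>+x. indicator (regular i) x * (ennreal (G x) * fibre_int F (v x)) \<partial>lborel)"
proof -
  obtain V W \<sigma> where cp: "chart_pieces \<Omega> U v h u' i V W \<sigma>" using ex_chart_pieces by blast
  then interpret chart_pieces \<Omega> U v h u' i V W \<sigma> .
  have j0: "0 \<le> jac x" for x by (simp add: jac_def sum_nonneg)
  have eq: "(\<integral>\<^sup>+x. indicator (regular i) x * (ennreal (F x) * fibre_int G (v x)) \<partial>lborel) =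
    (\<integral>\<^sup>+x. indicator (regular i) x * (ennreal (F x) *
           (\<integral>\<^sup>+t. at_chart (\<lambda>x. G x / jac x) (replace_coord i t (vU x)) (vU x $ i) \<partial>lborel)) \<partial>lborel)"
    if G0: "\<And>x. 0 \<le> G x" for F G :: "real^'n \<Rightarrow> real"
  proof (rule nn_integral_cong_AE)
    have P0: "\<And>x. 0 \<le> G x / jac x" using G0 j0 by simp
    from AE_lborel_pairD(1)[OF AE_on_fibre_at_chart[where P="\<lambda>x. G x / jac x", OF cp P0]]
    show "AE x in lborel. indicator (regular i) x * (ennreal (F x) * fibre_int G (v x)) =
      indicator (regular i) x * (ennreal (F x) *
           (\<integral>\<^sup>+t. at_chart (\<lambda>x. G x / jac x) (replace_coord i t (vU x)) (vU x $ i) \<partial>lborel))"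
    proof eventually_elim
      case (elim x)
      show ?case
      proof (cases "x \<in> regular i")
        case True
        have "fibre_int G (v x) = (\<integral>\<^sup>+t. at_chart (\<lambda>x. G x / jac x) (replace_coord i t (vU x)) (vU x $ i) \<partial>lborel)"
          unfolding fibre_int_def by (rule nn_integral_cong_AE) (use elim True in simp)
        then show ?thesis by simp
      qed simp
    qed
  qed
  show ?thesis
    unfolding eq[OF F0] eq[OF G0] by (rule at_chart_symmetric[OF F F0 G G0])
qed

end

section \<open>Consequences of the fibre hypothesis\<close>

locale fibred_chart = chart \<Omega> U v h u'
  for \<Omega> U :: "(real^'n) set" and v h u' +
  assumes fibres: "hausdorff_measure (real CARD('n) - 1)
    {z \<in> v ` \<Omega>. \<not> hausdorff_measure 1 ({z} \<times> {t. (z, t) \<in> (\<lambda>x. (v x, h x)) ` \<Omega>}) > 0} = 0"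
begin

definition thin :: "(real^'n) set" where
  "thin = {z \<in> v ` \<Omega>. \<not> hausdorff_measure 1 ({z} \<times> {t. (z, t) \<in> u ` \<Omega>}) > 0}"

lemma negligible_thin_cylinder: "negligible {y. \<exists>z\<in>thin. \<forall>j. j \<noteq> i \<longrightarrow> y $ j = z $ j}"
  using fibres unfolding thin_def[symmetric] by (rule negligible_cylinder_hausdorff_null)

text \<open>
  Where \<open>D v\<close> is invertible the fibres of \<open>v\<close> are countable, up to points over the (null) set of critical values.
\<close>

lemma AE_minor_None: "AE x in lborel. x \<in> \<Omega> \<longrightarrow> minor None x = 0"
proof -
  let ?B = "{x \<in> \<Omega>. minor None x \<noteq> 0}"
  obtain V W \<sigma> where V: "\<And>n::nat. local_inverse (\<psi> None) (V n) (W n) (\<sigma> n)"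
    "(\<Union>n. V n) = {x \<in> U. minor None x \<noteq> 0}"
    using ex_pieces[of None] by auto
  have "\<psi> None ` ?B \<subseteq> thin \<union> \<psi> None ` {x \<in> U. minor None x = 0}"
  proof
    fix z assume "z \<in> \<psi> None ` ?B"
    then obtain x where x: "x \<in> \<Omega>" "z = v x" by (auto simp: \<psi>_None)
    show "z \<in> thin \<union> \<psi> None ` {x \<in> U. minor None x = 0}"
    proof (cases "z \<in> \<psi> None ` {x \<in> U. minor None x = 0}")
      case False
      have "{t. (z, t) \<in> u ` \<Omega>} \<subseteq> range (\<lambda>n. h (\<sigma> n z))"
      proof
        fix t assume "t \<in> {t. (z, t) \<in> u ` \<Omega>}"
        then obtain x' where x': "x' \<in> \<Omega>" "v x' = z" "h x' = t" by auto
        have "x' \<in> U" using x' \<Omega>U by auto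
        moreover have "minor None x' \<noteq> 0"
          using False x' \<open>x' \<in> U\<close> by (auto simp: \<psi>_None)
        ultimately obtain n where "x' \<in> V n" using V(2) by blast
        then have "\<sigma> n z = x'" using V(1)[of n] x' by (auto simp: local_inverse_def \<psi>_None)
        then show "t \<in> range (\<lambda>n. h (\<sigma> n z))" using x' by blast
      qed
      then have "countable {t. (z, t) \<in> u ` \<Omega>}" by (rule countable_subset) simp
      then have "hausdorff_measure 1 ({z} \<times> {t. (z, t) \<in> u ` \<Omega>}) = 0"
        by (intro hausdorff_measure_vertical_null)
           (simp add: negligible_iff_null_sets countable_imp_null_set_lborel null_sets_completionI)
      then show ?thesis using x by (auto simp: thin_def)
    qed simp
  qed
  \<comment> \<open>\<open>thin\<close> lies in its cylinder in any coordinate direction, and that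
    cylinder is Lebesgue null; \<open>undefined\<close> stands for an arbitrary direction.\<close>
  moreover have "negligible thin"
    by (rule negligible_subset[OF negligible_thin_cylinder[of undefined]]) auto
  then have "negligible (thin \<union> \<psi> None ` {x \<in> U. minor None x = 0})"
    by (intro negligible_Un negligible_image_minor_zero)
  ultimately have "negligible (\<psi> None ` ?B)"
    by (rule negligible_subset[rotated])
  then have "negligible ?B"
    by (rule negligible_if_\<psi>_image) (use \<Omega>U in auto)
  from AE_lborel_notin_negligible[OF this] show ?thesis by eventually_elim auto
qed

lemma AE_regular: "AE x in lborel. x \<in> \<Omega> \<longrightarrow> (\<exists>i. x \<in> regular i)"
proof -
  have "AE x in lborel. x \<in> \<Omega> \<longrightarrow> jac x > 0"
    using AE_jacobian by (auto simp: AE_completion_iff elim: eventually_mono)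
  with AE_minor_None show ?thesis
  proof eventually_elim
    case (elim x)
    show ?case
    proof (intro impI, rule ccontr)
      assume x: "x \<in> \<Omega>" "\<nexists>i. x \<in> regular i"
      then have "minor (Some i) x = 0" for i by (auto simp: regular_def)
      then have "jac x = 0" using x elim by (simp add: jac_def UNIV_option_conv sum.reindex)
      then show False using elim x by simp
    qed
  qed
qed

lemma AE_pair_regular: "AE p in (lborel :: ((real^'n) \<times> real) measure). fst p \<in> \<Omega> \<longrightarrow> (\<exists>i. fst p \<in> regular i)"
  by (rule AE_lborel_fst[OF AE_regular])

lemma AE_pair_by_regular:
  assumes "\<And>i. AE p in (lborel :: ((real^'n) \<times> real) measure). fst p \<in> regular i \<longrightarrow> Q p"
  shows "AE p in lborel. fst p \<in> \<Omega> \<longrightarrow> Q p"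
proof -
  have "AE p in lborel. \<forall>i\<in>UNIV. fst p \<in> regular i \<longrightarrow> Q p"
    by (rule AE_finite_allI[OF finite]) (rule assms)
  with AE_pair_regular show ?thesis by eventually_elim blast
qed

lemma AE_by_regular:
  assumes "\<And>i. AE x in lborel. x \<in> regular i \<longrightarrow> Q x"
  shows "AE x in lborel. x \<in> \<Omega> \<longrightarrow> Q x"
proof -
  have "AE x in lborel. \<forall>i\<in>UNIV. x \<in> regular i \<longrightarrow> Q x"
    by (rule AE_finite_allI[OF finite]) (rule assms)
  with AE_regular show ?thesis by eventually_elim blast
qed

lemma AE_fibre_notin:
  assumes Z: "negligible Z" "Z \<subseteq> \<Omega>"
  shows "AE p in lborel. fst p \<in> \<Omega> \<longrightarrow> (v (fst p), snd p) \<notin> u ` Z"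
  by (intro AE_pair_by_regular AE_regular_fibre_notin negligible_image_null Z(1)) (use Z(2) \<Omega>U in blast)

text \<open>A null subset of \<Omega> has null chart images, hence is met by almost no pair of fibre
  and level. So fibre values, and with them fibre integrals, depend only on almost-everywhere
  classes.\<close>

lemma AE_on_fibre_cong:
  assumes "AE x in lborel. x \<in> \<Omega> \<longrightarrow> P x = Q x"
  shows "AE p in lborel. fst p \<in> \<Omega> \<longrightarrow> on_fibre P p = on_fibre Q p"
proof -
  let ?Z = "{x \<in> \<Omega>. P x \<noteq> Q x}"
  have "negligible ?Z"
    by (rule negligible_if_AE_notin) (use assms in eventually_elim, simp)
  from AE_fibre_notin[OF this] have "AE p in lborel. fst p \<in> \<Omega> \<longrightarrow> (v (fst p), snd p) \<notin> u ` ?Z" by simp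
  then show ?thesis
  proof eventually_elim
    case (elim p)
    show ?case
    proof
      assume p: "fst p \<in> \<Omega>"
      show "on_fibre P p = on_fibre Q p"
      proof (cases rule: at_inverse_cases[of "v (fst p)" "snd p"])
        case (1 x)
        have "x \<notin> ?Z"
        proof
          assume "x \<in> ?Z"
          then have "(v (fst p), snd p) \<in> u ` ?Z" by (rule image_eqI[rotated]) (simp add: 1)
          then show False using elim p by blast
        qed
        then have "P x = Q x" using 1(1) by simp
        then show ?thesis by (simp only: 1(4))
      next
        case 2
        then show ?thesis by simp
      qed
    qed
  qed
qed

lemma lebesgue_borel_version:
  fixes P :: "real^'n \<Rightarrow> real"
  assumes "P \<in> borel_measurable lebesgue" "\<And>x. 0 \<le> P x"
  obtains Q where "Q \<in> borel_measurable borel" "\<And>x. 0 \<le> Q x" "AE x in lborel. P x = Q x"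
proof -
  obtain Q where Q: "Q \<in> borel_measurable lborel" "AE x in lborel. P x = Q x"
    using completion_ex_borel_measurable_real[OF assms(1)] by blast
  show thesis
  proof (rule that[of "\<lambda>x. max 0 (Q x)"])
    show "AE x in lborel. P x = max 0 (Q x)"
      using Q(2) by eventually_elim (metis assms(2) max.absorb2)
  qed (use Q(1) in auto)
qed

lemma on_fibre_measurable_version:
  assumes "P \<in> borel_measurable lebesgue" "\<And>x. 0 \<le> P x"
  shows "\<exists>\<Lambda> \<in> borel_measurable borel. AE p in lborel. fst p \<in> \<Omega> \<longrightarrow> ennreal (on_fibre P p) = \<Lambda> p"
proof -
  obtain Q where Q: "Q \<in> borel_measurable borel" "\<And>x. 0 \<le> Q x" "AE x in lborel. P x = Q x"
    using lebesgue_borel_version[OF assms] by blast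
  have "\<forall>i. \<exists>\<Lambda>. \<Lambda> \<in> borel_measurable borel \<and> (AE p in lborel. fst p \<in> regular i \<longrightarrow> ennreal (on_fibre Q p) = \<Lambda> p)"
    using regular_on_fibre_measurable_version[OF Q(1,2)] by blast
  then obtain L :: "'n \<Rightarrow> (real^'n) \<times> real \<Rightarrow> ennreal" where L0: "\<forall>i. L i \<in> borel_measurable borel \<and> (AE p in lborel. fst p \<in> regular i \<longrightarrow> ennreal (on_fibre Q p) = L i p)"
    by (rule choice[THEN exE])
  then have L [measurable]: "\<And>i. L i \<in> borel_measurable borel" and L_eq: "\<And>i. AE p in lborel. fst p \<in> regular i \<longrightarrow> ennreal (on_fibre Q p) = L i p"
    by blast+
  \<comment> \<open>Almost everywhere over \<Omega> each term is 0 or the common value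
    \<open>on_fibre Q p\<close>, so the supremum is that value as soon as some
    \<open>regular i\<close> contains the point. This glues the charts without choosing
    \<open>i\<close> measurably.\<close>
  define \<Lambda> where "\<Lambda> p = (SUP i\<in>UNIV. indicator (regular i) (fst p) * L i p)" for p
  show ?thesis
  proof (rule bexI[of _ \<Lambda>])
    show "\<Lambda> \<in> borel_measurable borel"
      unfolding \<Lambda>_def by (intro borel_measurable_SUP countable_finite[OF finite]) measurable
    have "AE p in lborel. \<forall>i\<in>UNIV. fst p \<in> regular i \<longrightarrow> ennreal (on_fibre Q p) = L i p"
      by (rule AE_finite_allI[OF finite]) (rule L_eq)
    moreover have "AE p in lborel. fst p \<in> \<Omega> \<longrightarrow> on_fibre P p = on_fibre Q p"
      by (rule AE_on_fibre_cong) (use Q(3) in auto)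
    ultimately show "AE p in lborel. fst p \<in> \<Omega> \<longrightarrow> ennreal (on_fibre P p) = \<Lambda> p"
      using AE_pair_regular
    proof eventually_elim
      case (elim p)
      show ?case
      proof
        assume p: "fst p \<in> \<Omega>"
        then obtain i where i: "fst p \<in> regular i" using elim by blast
        have "\<Lambda> p = ennreal (on_fibre Q p)"
          unfolding \<Lambda>_def
        proof (rule antisym)
          show "(SUP i. indicator (regular i) (fst p) * L i p) \<le> ennreal (on_fibre Q p)"
            using elim by (intro SUP_least) (auto simp: indicator_def)
          show "ennreal (on_fibre Q p) \<le> (SUP i. indicator (regular i) (fst p) * L i p)"
            using elim i by (intro SUP_upper2[of i]) auto
        qed
        then show "ennreal (on_fibre P p) = \<Lambda> p" using elim p by simp
      qed
    qed
  qed
qed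

lemma jac_nonneg: "0 \<le> jac x" by (simp add: jac_def sum_nonneg)

lemma measurable_div_jac: "G \<in> borel_measurable lebesgue \<Longrightarrow> (\<lambda>x. G x / jac x) \<in> borel_measurable lebesgue"
  using measurable_completion[of jac lborel borel] by (intro borel_measurable_divide) auto

lemma fibre_int_measurable_version:
  assumes "G \<in> borel_measurable lebesgue" "\<And>x. 0 \<le> G x"
  shows "\<exists>\<Phi> \<in> borel_measurable borel. AE x in lborel. x \<in> \<Omega> \<longrightarrow> fibre_int G (v x) = \<Phi> x"
proof -
  have P0: "\<And>x. 0 \<le> G x / jac x" using assms(2) jac_nonneg by simp
  obtain \<Lambda> where L [measurable]: "\<Lambda> \<in> borel_measurable borel"
    and eq: "AE p in lborel. fst p \<in> \<Omega> \<longrightarrow> ennreal (on_fibre (\<lambda>x. G x / jac x) p) = \<Lambda> p"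
    using on_fibre_measurable_version[OF measurable_div_jac[OF assms(1)] P0] by (elim bexE) (rule that)
  show ?thesis
  proof (rule bexI[of _ "\<lambda>x. \<integral>\<^sup>+t. \<Lambda> (x, t) \<partial>lborel"])
    have "\<Lambda> \<in> borel_measurable (lborel \<Otimes>\<^sub>M lborel)" by (simp add: lborel_prod)
    then show "(\<lambda>x. \<integral>\<^sup>+t. \<Lambda> (x, t) \<partial>lborel) \<in> borel_measurable borel"
      using lborel.borel_measurable_nn_integral_fst by simp
    show "AE x in lborel. x \<in> \<Omega> \<longrightarrow> fibre_int G (v x) = (\<integral>\<^sup>+t. \<Lambda> (x, t) \<partial>lborel)"
      using AE_lborel_pairD(1)[OF eq]
    proof eventually_elim
      case (elim x)
      show ?case unfolding fibre_int_def
        by (intro impI nn_integral_cong_AE) (use elim in simp)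
    qed
  qed
qed

lemma fibre_int_cong:
  assumes "AE x in lborel. x \<in> \<Omega> \<longrightarrow> F x = G x"
  shows "AE x in lborel. x \<in> \<Omega> \<longrightarrow> fibre_int F (v x) = fibre_int G (v x)"
proof -
  have "AE x in lborel. x \<in> \<Omega> \<longrightarrow> F x / jac x = G x / jac x"
    using assms by eventually_elim simp
  from AE_lborel_pairD(1)[OF AE_on_fibre_cong[where P="\<lambda>x. F x / jac x" and Q="\<lambda>x. G x / jac x", OF this]]
  show ?thesis
  proof eventually_elim
    case (elim x)
    show ?case unfolding fibre_int_def
      by (intro impI nn_integral_cong_AE) (use elim in \<open>auto elim!: eventually_mono\<close>)
  qed
qed

text \<open>Points outside \<open>regular i\<close> are not seen from points of \<open>regular i\<close>; by symmetry the converse holds as well.\<close>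

lemma fibre_int_regular_irregular:
  assumes G0: "\<And>x. x \<in> regular i \<Longrightarrow> G x = 0"
  shows "AE x in lborel. x \<in> regular i \<longrightarrow> fibre_int G (v x) = 0"
  using AE_lborel_pairD(1)[OF AE_regular_fibre_notin[OF negligible_image_irregular[of i]]]
proof eventually_elim
  case (elim x)
  show ?case
  proof
    assume x: "x \<in> regular i"
    have "fibre_int G (v x) = (\<integral>\<^sup>+t. 0 \<partial>(lborel :: real measure))"
      unfolding fibre_int_def
    proof (rule nn_integral_cong_AE)
      have "AE t in lborel. (v x, t) \<notin> u ` (\<Omega> - regular i)" using elim x by simp
      then show "AE t in lborel. ennreal (at_inverse \<Omega> u (\<lambda>x. G x / jac x) (v x, t)) = 0"
      proof eventually_elim
        case (elim t)
        show ?case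
        proof (cases rule: at_inverse_cases[of "v x" t])
          case (1 x')
          then have "x' \<in> regular i" using elim by (auto intro: image_eqI[where x=x'])
          then show ?thesis using 1 G0 by simp
        qed simp
      qed
    qed
    then show "fibre_int G (v x) = 0" by simp
  qed
qed

text \<open>Tested against the indicator of \<Omega> minus \<open>regular i\<close> over each
  \<open>regular j\<close>: the symmetry moves the fibre integral to the indicator, and that one
  vanishes almost everywhere on \<open>regular i\<close>, outside of which \<open>F\<close> is
  0.\<close>

lemma fibre_int_irregular_regular:
  assumes F [measurable]: "F \<in> borel_measurable borel" and F0: "\<And>x. 0 \<le> F x"
    and Fi: "\<And>x. x \<notin> regular i \<Longrightarrow> F x = 0"
  shows "AE x in lborel. x \<in> \<Omega> \<longrightarrow> x \<notin> regular i \<longrightarrow> fibre_int F (v x) = 0"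
proof (rule AE_by_regular)
  fix j
  let ?G = "indicator (\<Omega> - regular i) :: real^'n \<Rightarrow> real"
  have F': "F \<in> borel_measurable lebesgue" by (rule measurable_completion) (simp add: F)
  obtain \<Phi> where \<Phi> [measurable]: "\<Phi> \<in> borel_measurable borel"
    and eq: "AE x in lborel. x \<in> \<Omega> \<longrightarrow> fibre_int F (v x) = \<Phi> x"
    using fibre_int_measurable_version[OF F' F0] by blast
  have "(\<integral>\<^sup>+x. indicator (regular j) x * (ennreal (?G x) * \<Phi> x) \<partial>lborel) =
    (\<integral>\<^sup>+x. indicator (regular j) x * (ennreal (?G x) * fibre_int F (v x)) \<partial>lborel)"
    by (rule nn_integral_cong_AE) (use eq in eventually_elim, auto simp: regular_def indicator_def)
  also have "\<dots> = (\<integral>\<^sup>+x. indicator (regular j) x * (ennreal (F x) * fibre_int ?G (v x)) \<partial>lborel)"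
    by (rule regular_fibre_int_symmetric) (use F0 in auto)
  also have "\<dots> = (\<integral>\<^sup>+x. 0 \<partial>(lborel :: (real^'n) measure))"
  proof (rule nn_integral_cong_AE)
    have "AE x in lborel. x \<in> regular i \<longrightarrow> fibre_int ?G (v x) = 0"
      by (rule fibre_int_regular_irregular) simp
    then show "AE x in lborel. indicator (regular j) x * (ennreal (F x) * fibre_int ?G (v x)) = 0"
      by eventually_elim (use Fi in fastforce)
  qed
  finally have "(\<integral>\<^sup>+x. indicator (regular j) x * (ennreal (?G x) * \<Phi> x) \<partial>lborel) = 0" by simp
  then have "AE x in lborel. indicator (regular j) x * (ennreal (?G x) * \<Phi> x) = 0"
    by (subst (asm) nn_integral_0_iff_AE) auto
  with eq show "AE x in lborel. x \<in> regular j \<longrightarrow> x \<notin> regular i \<longrightarrow> fibre_int F (v x) = 0"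
    by eventually_elim (auto simp: indicator_def regular_def split: if_splits)
qed

text \<open>Additivity of the integral over a fibre needs measurable integrands, so Borel versions
  of all summands are used simultaneously on almost every fibre.\<close>

lemma fibre_int_sum:
  assumes F: "\<And>i. F i \<in> borel_measurable lebesgue" and F0: "\<And>i x. 0 \<le> F i x"
  shows "AE x in lborel. x \<in> \<Omega> \<longrightarrow> fibre_int (\<lambda>x. \<Sum>i\<in>UNIV. F i x) (v x) = (\<Sum>i\<in>(UNIV :: 'n set). fibre_int (F i) (v x))"
proof -
  have P0: "\<And>i x. 0 \<le> F i x / jac x" using F0 jac_nonneg by simp
  have "\<forall>i. \<exists>\<Lambda> :: (real^'n) \<times> real \<Rightarrow> ennreal. \<Lambda> \<in> borel_measurable borel \<and>
     (AE p in lborel. fst p \<in> \<Omega> \<longrightarrow> ennreal (on_fibre (\<lambda>x. F i x / jac x) p) = \<Lambda> p)"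
    using on_fibre_measurable_version[OF measurable_div_jac[OF F] P0] unfolding Bex_def by (rule allI)
  then obtain L :: "'n \<Rightarrow> (real^'n) \<times> real \<Rightarrow> ennreal" where L0: "\<forall>i. L i \<in> borel_measurable borel \<and> (AE p in lborel. fst p \<in> \<Omega> \<longrightarrow> ennreal (on_fibre (\<lambda>x. F i x / jac x) p) = L i p)"
    by (rule choice[THEN exE])
  then have L [measurable]: "\<And>i. L i \<in> borel_measurable borel" and L_eq: "\<And>i. AE p in lborel. fst p \<in> \<Omega> \<longrightarrow> ennreal (on_fibre (\<lambda>x. F i x / jac x) p) = L i p"
    by blast+
  have "AE p in lborel. \<forall>i\<in>UNIV. fst p \<in> \<Omega> \<longrightarrow> ennreal (on_fibre (\<lambda>x. F i x / jac x) p) = L i p"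
    by (rule AE_finite_allI[OF finite]) (rule L_eq)
  from AE_lborel_pairD(1)[OF this] show ?thesis
  proof eventually_elim
    case (elim x)
    show ?case
    proof
      assume x: "x \<in> \<Omega>"
      have eq: "AE t in lborel. \<forall>i. ennreal (at_inverse \<Omega> u (\<lambda>x. F i x / jac x) (v x, t)) = L i (x, t)"
        using elim x by simp
      have "fibre_int (\<lambda>x. \<Sum>i\<in>UNIV. F i x) (v x) = (\<integral>\<^sup>+t. (\<Sum>i\<in>UNIV. L i (x, t)) \<partial>lborel)"
        unfolding fibre_int_def
      proof (rule nn_integral_cong_AE)
        show "AE t in lborel. ennreal (at_inverse \<Omega> u (\<lambda>x. (\<Sum>i\<in>UNIV. F i x) / jac x) (v x, t)) = (\<Sum>i\<in>UNIV. L i (x, t))"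
          using eq
        proof eventually_elim
          case (elim t)
          have "ennreal (at_inverse \<Omega> u (\<lambda>x. (\<Sum>i\<in>UNIV. F i x) / jac x) (v x, t)) =
            (\<Sum>i\<in>UNIV. ennreal (at_inverse \<Omega> u (\<lambda>x. F i x / jac x) (v x, t)))"
            by (cases rule: at_inverse_cases[of "v x" t])
               (simp_all add: sum_divide_distrib sum_ennreal F0 jac_nonneg)
          then show ?case using elim by simp
        qed
      qed
      also have "\<dots> = (\<Sum>i\<in>UNIV. \<integral>\<^sup>+t. L i (x, t) \<partial>lborel)"
        by (rule nn_integral_sum) measurable
      also have "\<dots> = (\<Sum>i\<in>UNIV. fibre_int (F i) (v x))"
        unfolding fibre_int_def
        by (intro sum.cong refl nn_integral_cong_AE) (use eq in eventually_elim, simp)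
      finally show "fibre_int (\<lambda>x. \<Sum>i\<in>UNIV. F i x) (v x) = (\<Sum>i\<in>UNIV. fibre_int (F i) (v x))" .
    qed
  qed
qed

section \<open>Gluing the symmetry of the charts\<close>

text \<open>The symmetry in one chart restricts both outer integrals to \<open>regular i\<close>.
  For a function living in \<open>regular i\<close> the other side may be extended to \<Omega>,
  because its fibre integral vanishes at almost all remaining points; a general \<open>F\<close> is
  a finite sum of such functions.\<close>

lemma fibre_int_symmetric_borel:
  assumes F [measurable]: "F \<in> borel_measurable borel" and F0: "\<And>x. 0 \<le> F x"
    and G [measurable]: "G \<in> borel_measurable borel" and G0: "\<And>x. 0 \<le> G x"
  shows "(\<integral>\<^sup>+x. indicator \<Omega> x * (ennreal (F x) * fibre_int G (v x)) \<partial>lborel) =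
         (\<integral>\<^sup>+x. indicator \<Omega> x * (ennreal (G x) * fibre_int F (v x)) \<partial>lborel)"
proof -
  \<comment> \<open>The number of charts containing the point, used as denominator of a partition of
    unity. Within \<Omega> it is 0 only on a null set, where the quotients are 0 as well.\<close>
  define cnt where "cnt x = (\<Sum>i\<in>(UNIV::'n set). indicator (regular i) x :: real)" for x
  define Fi where "Fi i x = indicator (regular i) x * F x / cnt x" for i x
  have [measurable]: "cnt \<in> borel_measurable borel" unfolding cnt_def by measurable
  have Fi_meas [measurable]: "Fi i \<in> borel_measurable borel" for i unfolding Fi_def by measurable
  have cnt0: "0 \<le> cnt x" for x by (simp add: cnt_def sum_nonneg)
  have Fi0: "0 \<le> Fi i x" for i x using F0 cnt0 by (simp add: Fi_def)
  have leb: "H \<in> borel_measurable lebesgue" if "H \<in> borel_measurable borel" for H :: "real^'n \<Rightarrow> real"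
    by (rule measurable_completion) (simp add: that)
  have sumF: "AE x in lborel. x \<in> \<Omega> \<longrightarrow> F x = (\<Sum>i\<in>UNIV. Fi i x)"
    using AE_regular
  proof eventually_elim
    case (elim x)
    show ?case
    proof
      assume "x \<in> \<Omega>"
      then obtain i where i: "x \<in> regular i" using elim by blast
      have "indicator (regular i) x \<le> cnt x"
        unfolding cnt_def by (rule member_le_sum) auto
      then have "cnt x \<noteq> 0" using i by auto
      moreover have "(\<Sum>i\<in>UNIV. Fi i x) = cnt x * F x / cnt x"
        unfolding Fi_def by (simp only: sum_divide_distrib[symmetric] sum_distrib_right[symmetric] cnt_def[symmetric])
      ultimately show "F x = (\<Sum>i\<in>UNIV. Fi i x)" by simp
    qed
  qed
  have piece: "(\<integral>\<^sup>+x. indicator \<Omega> x * (ennreal (Fi i x) * fibre_int G (v x)) \<partial>lborel) =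
      (\<integral>\<^sup>+x. indicator \<Omega> x * (ennreal (G x) * fibre_int (Fi i) (v x)) \<partial>lborel)" for i
  proof -
    have "(\<integral>\<^sup>+x. indicator \<Omega> x * (ennreal (Fi i x) * fibre_int G (v x)) \<partial>lborel) =
      (\<integral>\<^sup>+x. indicator (regular i) x * (ennreal (Fi i x) * fibre_int G (v x)) \<partial>lborel)"
      by (rule nn_integral_cong) (auto simp: Fi_def regular_def indicator_def)
    also have "\<dots> = (\<integral>\<^sup>+x. indicator (regular i) x * (ennreal (G x) * fibre_int (Fi i) (v x)) \<partial>lborel)"
      by (rule regular_fibre_int_symmetric) (use Fi0 G0 in auto)
    also have "\<dots> = (\<integral>\<^sup>+x. indicator \<Omega> x * (ennreal (G x) * fibre_int (Fi i) (v x)) \<partial>lborel)"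
    proof (rule nn_integral_cong_AE)
      have "AE x in lborel. x \<in> \<Omega> \<longrightarrow> x \<notin> regular i \<longrightarrow> fibre_int (Fi i) (v x) = 0"
        by (rule fibre_int_irregular_regular) (use Fi0 in \<open>auto simp: Fi_def\<close>)
      then show "AE x in lborel. indicator (regular i) x * (ennreal (G x) * fibre_int (Fi i) (v x)) =
         indicator \<Omega> x * (ennreal (G x) * fibre_int (Fi i) (v x))"
        by eventually_elim (auto simp: indicator_def regular_def)
    qed
    finally show ?thesis .
  qed
  obtain \<Phi>G where [measurable]: "\<Phi>G \<in> borel_measurable borel"
    and \<Phi>G: "AE x in lborel. x \<in> \<Omega> \<longrightarrow> fibre_int G (v x) = \<Phi>G x"
    using fibre_int_measurable_version[OF leb[OF G] G0] by blast
  have "\<forall>i. \<exists>\<Phi>. \<Phi> \<in> borel_measurable borel \<and> (AE x in lborel. x \<in> \<Omega> \<longrightarrow> fibre_int (Fi i) (v x) = \<Phi> x)"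
    using fibre_int_measurable_version[OF leb[OF Fi_meas] Fi0] unfolding Bex_def by (rule allI)
  then obtain \<Phi>F :: "'n \<Rightarrow> real^'n \<Rightarrow> ennreal" where L0: "\<forall>i. \<Phi>F i \<in> borel_measurable borel \<and> (AE x in lborel. x \<in> \<Omega> \<longrightarrow> fibre_int (Fi i) (v x) = \<Phi>F i x)"
    by (rule choice[THEN exE])
  then have L [measurable]: "\<And>i. \<Phi>F i \<in> borel_measurable borel" and \<Phi>F: "\<And>i. AE x in lborel. x \<in> \<Omega> \<longrightarrow> fibre_int (Fi i) (v x) = \<Phi>F i x"
    by blast+
  have "(\<integral>\<^sup>+x. indicator \<Omega> x * (ennreal (F x) * fibre_int G (v x)) \<partial>lborel) =
     (\<integral>\<^sup>+x. (\<Sum>i\<in>UNIV. indicator \<Omega> x * (ennreal (Fi i x) * \<Phi>G x)) \<partial>lborel)"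
  proof (rule nn_integral_cong_AE)
    show "AE x in lborel. indicator \<Omega> x * (ennreal (F x) * fibre_int G (v x)) = (\<Sum>i\<in>UNIV. indicator \<Omega> x * (ennreal (Fi i x) * \<Phi>G x))"
      using sumF \<Phi>G
    proof eventually_elim
      case (elim x)
      have e: "ennreal (\<Sum>i\<in>UNIV. Fi i x) = (\<Sum>i\<in>UNIV. ennreal (Fi i x))"
        by (rule sum_ennreal[symmetric]) (rule Fi0)
      show ?case
      proof (cases "x \<in> \<Omega>")
        case True
        then have "ennreal (F x) * fibre_int G (v x) = (\<Sum>i\<in>UNIV. ennreal (Fi i x)) * \<Phi>G x"
          using elim e by simp
        then show ?thesis using True by (simp add: sum_distrib_right)
      qed simp
    qed
  qed
  also have "\<dots> = (\<Sum>i\<in>UNIV. \<integral>\<^sup>+x. indicator \<Omega> x * (ennreal (Fi i x) * \<Phi>G x) \<partial>lborel)"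
    by (rule nn_integral_sum) measurable
  also have "\<dots> = (\<Sum>i\<in>UNIV. \<integral>\<^sup>+x. indicator \<Omega> x * (ennreal (Fi i x) * fibre_int G (v x)) \<partial>lborel)"
    by (intro sum.cong refl nn_integral_cong_AE) (use \<Phi>G in eventually_elim, auto simp: indicator_def)
  also have "\<dots> = (\<Sum>i\<in>UNIV. \<integral>\<^sup>+x. indicator \<Omega> x * (ennreal (G x) * fibre_int (Fi i) (v x)) \<partial>lborel)"
    by (simp only: piece)
  also have "\<dots> = (\<Sum>i\<in>UNIV. \<integral>\<^sup>+x. indicator \<Omega> x * (ennreal (G x) * \<Phi>F i x) \<partial>lborel)"
  proof (intro sum.cong refl nn_integral_cong_AE)
    fix i
    show "AE x in lborel. indicator \<Omega> x * (ennreal (G x) * fibre_int (Fi i) (v x)) =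
        indicator \<Omega> x * (ennreal (G x) * \<Phi>F i x)"
      using \<Phi>F[of i] by eventually_elim (auto simp: indicator_def)
  qed
  also have "\<dots> = (\<integral>\<^sup>+x. (\<Sum>i\<in>UNIV. indicator \<Omega> x * (ennreal (G x) * \<Phi>F i x)) \<partial>lborel)"
    by (rule nn_integral_sum[symmetric]) measurable
  also have "\<dots> = (\<integral>\<^sup>+x. indicator \<Omega> x * (ennreal (G x) * fibre_int F (v x)) \<partial>lborel)"
  proof (rule nn_integral_cong_AE)
    have "AE x in lborel. \<forall>i\<in>UNIV. x \<in> \<Omega> \<longrightarrow> fibre_int (Fi i) (v x) = \<Phi>F i x"
      by (rule AE_finite_allI[OF finite]) (rule \<Phi>F)
    then show "AE x in lborel. (\<Sum>i\<in>UNIV. indicator \<Omega> x * (ennreal (G x) * \<Phi>F i x)) = indicator \<Omega> x * (ennreal (G x) * fibre_int F (v x))"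
      using fibre_int_sum[of Fi, OF leb[OF Fi_meas] Fi0] fibre_int_cong[OF sumF]
    proof eventually_elim
      case (elim x)
      show ?case
      proof (cases "x \<in> \<Omega>")
        case True
        then have "fibre_int F (v x) = (\<Sum>i\<in>UNIV. \<Phi>F i x)" using elim by simp
        then show ?thesis using True by (simp add: sum_distrib_left)
      qed simp
    qed
  qed
  finally show ?thesis .
qed

theorem fibre_int_symmetric:
  assumes F: "F \<in> borel_measurable lebesgue" and F0: "\<And>x. 0 \<le> F x"
    and G: "G \<in> borel_measurable lebesgue" and G0: "\<And>x. 0 \<le> G x"
  shows "(\<integral>\<^sup>+x. indicator \<Omega> x * (ennreal (F x) * fibre_int G (v x)) \<partial>lborel) =
         (\<integral>\<^sup>+x. indicator \<Omega> x * (ennreal (G x) * fibre_int F (v x)) \<partial>lborel)"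
proof -
  obtain F' where F': "F' \<in> borel_measurable borel" "\<And>x. 0 \<le> F' x" "AE x in lborel. F x = F' x"
    using lebesgue_borel_version[OF F F0] by blast
  obtain G' where G': "G' \<in> borel_measurable borel" "\<And>x. 0 \<le> G' x" "AE x in lborel. G x = G' x"
    using lebesgue_borel_version[OF G G0] by blast
  have eq: "(\<integral>\<^sup>+x. indicator \<Omega> x * (ennreal (F x) * fibre_int G (v x)) \<partial>lborel) =
     (\<integral>\<^sup>+x. indicator \<Omega> x * (ennreal (F' x) * fibre_int G' (v x)) \<partial>lborel)"
    if "AE x in lborel. F x = F' x" "AE x in lborel. G x = G' x" for F F' G G' :: "real^'n \<Rightarrow> real"
  proof (rule nn_integral_cong_AE)
    have "AE x in lborel. x \<in> \<Omega> \<longrightarrow> fibre_int G (v x) = fibre_int G' (v x)"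
      by (rule fibre_int_cong) (use that(2) in auto)
    with that(1) show "AE x in lborel. indicator \<Omega> x * (ennreal (F x) * fibre_int G (v x)) =
        indicator \<Omega> x * (ennreal (F' x) * fibre_int G' (v x))"
      by eventually_elim (auto simp: indicator_def)
  qed
  show ?thesis
    unfolding eq[OF F'(3) G'(3)] eq[OF G'(3) F'(3)]
    by (rule fibre_int_symmetric_borel[OF F'(1,2) G'(1,2)])
qed

end

section \<open>Disintegration along the fibres\<close>

lemma borel_measurable_completion_AE:
  fixes f g :: "'a \<Rightarrow> 'b::{second_countable_topology, t2_space}"
  assumes f: "f \<in> borel_measurable (completion M)" and eq: "AE x in M. f x = g x"
  shows "g \<in> borel_measurable (completion M)"
proof (rule measurableI)
  fix B :: "'b set" assume B: "B \<in> sets borel"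
  obtain N where N: "N \<in> null_sets M" "{x \<in> space M. f x \<noteq> g x} \<subseteq> N"
    using eq by (auto elim!: AE_E simp: null_sets_def)
  have sub: "C \<in> sets (completion M)" if "C \<subseteq> N" for C
    using null_sets_completionI[OF N(1)] that null_sets_completion_subset[OF that] by (auto simp: null_sets_def)
  let ?F = "f -` B \<inter> space M" and ?G = "g -` B \<inter> space M"
  have "?F \<in> sets (completion M)" using measurable_sets[OF f B] by simp
  moreover have "?G = (?F - (?F - ?G)) \<union> (?G - ?F)" by auto
  moreover have "?F - ?G \<subseteq> N" "?G - ?F \<subseteq> N" using N(2) by auto
  ultimately show "g -` B \<inter> space (completion M) \<in> sets (completion M)"
    using sub by (metis sets.Diff sets.Un space_completion)
qed simp

lemma std_normal_density_pos: "0 < std_normal_density y"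
  by (rule normal_density_pos) simp

context fibred_chart
begin

lemma AE_jac_pos: "AE x in lborel. x \<in> \<Omega> \<longrightarrow> jacobian_m u x = jac x \<and> jac x > 0"
  using AE_jacobian by (simp add: AE_completion_iff)

section \<open>Finiteness and positivity of fibre integrals\<close>

text \<open>A reference weight whose fibre integral is the Gaussian measure of the levels occurring
  in the fibre, apart from points with \<open>jac = 0\<close>. It is at most 1 and almost everywhere
  positive, and pairing with it by symmetry controls all other fibre integrals.\<close>

abbreviation ref :: "real^'n \<Rightarrow> real" where "ref x \<equiv> jac x * std_normal_density (hU x)"

lemma ref_measurable: "ref \<in> borel_measurable lebesgue"
  by (rule measurable_completion) measurable

lemma ref_nonneg: "0 \<le> ref x" by (simp add: jac_nonneg)

lemma fibre_int_ref_le: "fibre_int ref z \<le> 1"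
proof -
  have "fibre_int ref z \<le> (\<integral>\<^sup>+t. ennreal (std_normal_density t) \<partial>lborel)"
    unfolding fibre_int_def
  proof (rule nn_integral_mono, rule ennreal_leI)
    fix t
    show "at_inverse \<Omega> u (\<lambda>x. ref x / jac x) (z, t) \<le> std_normal_density t"
    proof (cases rule: at_inverse_cases[of z t])
      case (1 x)
      then have "hU x = t" using \<Omega>U by auto
      then show ?thesis by (simp add: 1(4))
    qed simp
  qed
  also have "\<dots> = ennreal (\<integral>t. std_normal_density t \<partial>lborel)"
    by (intro nn_integral_eq_integral integrable_normal_density) simp_all
  also have "\<dots> = 1" by (simp add: integral_normal_density)
  finally show ?thesis .
qed

text \<open>If the Gaussian integral vanishes, the levels of the fibre form a null set, so the fibre
  has length 0 and its base point is in \<open>thin\<close>. But \<open>\<psi> (Some i) x\<close>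
  agrees with \<open>v x\<close> off coordinate \<open>i\<close> and avoids the null cylinder over
  \<open>thin\<close> for almost all \<open>x\<close>.\<close>

lemma AE_fibre_int_ref_pos: "AE x in lborel. x \<in> \<Omega> \<longrightarrow> fibre_int ref (v x) \<noteq> 0"
proof (rule AE_by_regular)
  fix i
  let ?P = "\<lambda>x. ref x / jac x"
  \<comment> \<open>Where \<open>jac\<close> is 0 the quotient \<open>ref / jac\<close> is 0 by
    convention and not the Gaussian density, so such points must be kept off almost all
    fibres.\<close>
  have "negligible {x \<in> \<Omega>. jac x = 0}"
    by (rule negligible_if_AE_notin) (use AE_jac_pos in eventually_elim, auto)
  from AE_lborel_pairD(1)[OF AE_fibre_notin[OF this]]
  have 1: "AE x in lborel. AE t in lborel. x \<in> \<Omega> \<longrightarrow> (v x, t) \<notin> u ` {x \<in> \<Omega>. jac x = 0}" by simp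
  have P0: "\<And>x. 0 \<le> ?P x" using ref_nonneg jac_nonneg by simp
  obtain \<Lambda> where [measurable]: "\<Lambda> \<in> borel_measurable borel" and
    \<Lambda>: "AE p in lborel. fst p \<in> \<Omega> \<longrightarrow> ennreal (on_fibre ?P p) = \<Lambda> p"
    using on_fibre_measurable_version[OF measurable_div_jac[OF ref_measurable] P0] by (elim bexE) (rule that)
  have 3: "AE x in lborel. x \<in> regular i \<longrightarrow> \<psi> (Some i) x \<notin> {y. \<exists>z\<in>thin. \<forall>j. j \<noteq> i \<longrightarrow> y $ j = z $ j}"
    by (rule AE_regular_image_notin[OF negligible_thin_cylinder])
  show "AE x in lborel. x \<in> regular i \<longrightarrow> fibre_int ref (v x) \<noteq> 0"
    using 1 AE_lborel_pairD(1)[OF \<Lambda>] 3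
  proof eventually_elim
    case (elim x)
    show ?case
    proof (intro impI notI)
      assume x: "x \<in> regular i" and 0: "fibre_int ref (v x) = 0"
      have x\<Omega>: "x \<in> \<Omega>" using x by (simp add: regular_def)
      have "v x \<notin> thin"
      proof
        assume "v x \<in> thin"
        then have "\<exists>z\<in>thin. \<forall>j. j \<noteq> i \<longrightarrow> \<psi> (Some i) x $ j = z $ j"
          by (intro bexI[of _ "v x"]) (auto simp: \<psi>_Some)
        then show False using elim(3) x by blast
      qed
      have L: "AE t in lborel. ennreal (at_inverse \<Omega> u ?P (v x, t)) = \<Lambda> (x, t)"
        using elim(2) x\<Omega> by simp
      then have "fibre_int ref (v x) = (\<integral>\<^sup>+t. \<Lambda> (x, t) \<partial>lborel)"
        unfolding fibre_int_def by (rule nn_integral_cong_AE)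
      then have "(\<integral>\<^sup>+t. \<Lambda> (x, t) \<partial>lborel) = 0" using 0 by simp
      then have "AE t in lborel. \<Lambda> (x, t) = 0"
        by (subst (asm) nn_integral_0_iff_AE) auto
      moreover have "AE t in lborel. (v x, t) \<notin> u ` {x \<in> \<Omega>. jac x = 0}" using elim(1) x\<Omega> by simp
      ultimately have "AE t in lborel. (v x, t) \<notin> u ` \<Omega>"
        using L
      proof eventually_elim
        case (elim t)
        show ?case
        proof
          assume "(v x, t) \<in> u ` \<Omega>"
          then obtain x' where x': "x' \<in> \<Omega>" "u x' = (v x, t)" by auto
          have "at_inverse \<Omega> u ?P (v x, t) = ?P x'"
            using at_inverse_u[OF x'(1), of ?P] x'(2) by simp
          moreover have "jac x' \<noteq> 0"
          proof
            assume "jac x' = 0"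
            then have "(v x, t) \<in> u ` {x \<in> \<Omega>. jac x = 0}"
              using x' by (intro image_eqI[of _ _ x']) auto
            then show False using elim by blast
          qed
          then have "?P x' > 0" by (simp add: std_normal_density_pos)
          ultimately show False using elim by simp
        qed
      qed
      then have "negligible {t. (v x, t) \<in> u ` \<Omega>}"
        by (intro negligible_if_AE_notin) simp
      from hausdorff_measure_vertical_null[OF this, of "v x"] \<open>v x \<notin> thin\<close> x\<Omega>
      show False by (simp add: thin_def)
    qed
  qed
qed

text \<open>By symmetry the integral of \<open>ref\<close> times the fibre integral of
  \<open>G\<close> equals that of \<open>G\<close> times a fibre integral at most 1, which is
  finite; and \<open>ref\<close> is positive almost everywhere on \<Omega>.\<close>

lemma AE_fibre_int_finite:
  assumes G: "G \<in> borel_measurable lebesgue" and G0: "\<And>x. 0 \<le> G x"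
    and fin: "(\<integral>\<^sup>+x. indicator \<Omega> x * ennreal (G x) \<partial>lborel) < \<infinity>"
  shows "AE x in lborel. x \<in> \<Omega> \<longrightarrow> fibre_int G (v x) < \<infinity>"
proof -
  obtain \<Phi> where [measurable]: "\<Phi> \<in> borel_measurable borel"
    and \<Phi>: "AE x in lborel. x \<in> \<Omega> \<longrightarrow> fibre_int G (v x) = \<Phi> x"
    using fibre_int_measurable_version[OF G G0] by (elim bexE) (rule that)
  have "(\<integral>\<^sup>+x. indicator \<Omega> x * (ennreal (ref x) * \<Phi> x) \<partial>lborel) =
      (\<integral>\<^sup>+x. indicator \<Omega> x * (ennreal (ref x) * fibre_int G (v x)) \<partial>lborel)"
    by (rule nn_integral_cong_AE) (use \<Phi> in eventually_elim, auto simp: indicator_def)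
  also have "\<dots> = (\<integral>\<^sup>+x. indicator \<Omega> x * (ennreal (G x) * fibre_int ref (v x)) \<partial>lborel)"
    by (rule fibre_int_symmetric[OF ref_measurable ref_nonneg G G0])
  also have "\<dots> \<le> (\<integral>\<^sup>+x. indicator \<Omega> x * ennreal (G x) \<partial>lborel)"
  proof (rule nn_integral_mono)
    fix x
    show "indicator \<Omega> x * (ennreal (G x) * fibre_int ref (v x)) \<le> indicator \<Omega> x * ennreal (G x)"
      using mult_left_mono[OF fibre_int_ref_le[of "v x"], of "ennreal (G x)"]
      by (intro mult_left_mono) auto
  qed
  finally have "(\<integral>\<^sup>+x. indicator \<Omega> x * (ennreal (ref x) * \<Phi> x) \<partial>lborel) \<noteq> \<infinity>"
    using fin by (simp add: less_top top_unique)
  then have "AE x in lborel. indicator \<Omega> x * (ennreal (ref x) * \<Phi> x) \<noteq> \<infinity>"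
    by (intro nn_integral_PInf_AE) auto
  then show ?thesis
    using \<Phi> AE_jac_pos
  proof eventually_elim
    case (elim x)
    show ?case
    proof
      assume x: "x \<in> \<Omega>"
      then have "0 < ref x" using elim std_normal_density_pos[of "hU x"] by simp
      then show "fibre_int G (v x) < \<infinity>" using elim x by (auto simp: less_top ennreal_mult_eq_top_iff)
    qed
  qed
qed

text \<open>No measurability of the fibre integral in its base point is available, but composed with
  \<open>v\<close> it has a Borel version on \<Omega>. This makes weights built from it Lebesgue
  measurable.\<close>

lemma masked_measurable:
  assumes F: "F \<in> borel_measurable lebesgue" and F0: "\<And>x. 0 \<le> F x" and H: "H \<in> borel_measurable lebesgue"
    and m: "(\<lambda>(a, b). m a b) \<in> borel_measurable (borel \<Otimes>\<^sub>M borel)"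
  shows "(\<lambda>x. indicator \<Omega> x * m (H x) (fibre_int F (v x)) :: real) \<in> borel_measurable lebesgue"
proof -
  obtain \<Phi> where \<Phi>m: "\<Phi> \<in> borel_measurable borel"
    and \<Phi>: "AE x in lborel. x \<in> \<Omega> \<longrightarrow> fibre_int F (v x) = \<Phi> x"
    using fibre_int_measurable_version[OF F F0] by (elim bexE) (rule that)
  have [measurable]: "\<Phi> \<in> borel_measurable lebesgue" by (rule measurable_completion) (simp add: \<Phi>m)
  have [measurable]: "\<Omega> \<in> sets lebesgue" by simp
  note H[measurable] m[measurable]
  have "(\<lambda>x. (\<lambda>(a, b). m a b) (H x, \<Phi> x)) \<in> borel_measurable lebesgue" by measurable
  then have [measurable]: "(\<lambda>x. m (H x) (\<Phi> x)) \<in> borel_measurable lebesgue" by simp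
  have "(\<lambda>x. indicator \<Omega> x * m (H x) (\<Phi> x)) \<in> borel_measurable lebesgue" by measurable
  then show ?thesis
  proof (rule borel_measurable_completion_AE)
    show "AE x in lborel. indicator \<Omega> x * m (H x) (\<Phi> x) = indicator \<Omega> x * m (H x) (fibre_int F (v x))"
      using \<Phi> by eventually_elim (auto simp: indicator_def)
  qed
qed

text \<open>The part \<open>T\<close> of \<open>F\<close> on fibres of vanishing integral has fibre
  integral 0 itself. Symmetry against \<open>ref\<close>, whose fibre integral is positive almost
  everywhere, makes \<open>T\<close> vanish almost everywhere.\<close>

lemma AE_fibre_int_pos:
  assumes F: "F \<in> borel_measurable lebesgue" and F0: "\<And>x. 0 \<le> F x"
  shows "AE x in lborel. x \<in> \<Omega> \<longrightarrow> F x \<noteq> 0 \<longrightarrow> fibre_int F (v x) \<noteq> 0"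
proof -
  define T where "T x = indicator \<Omega> x * (if fibre_int F (v x) = 0 then F x else 0)" for x
  have Tm: "T \<in> borel_measurable lebesgue"
    unfolding T_def[abs_def]
    by (rule masked_measurable[OF F F0 F, where m="\<lambda>a b. if b = 0 then a else 0"]) measurable
  have T0: "0 \<le> T x" for x using F0 by (simp add: T_def)
  \<comment> \<open>The condition defining \<open>T\<close> depends only on \<open>v x\<close>, so
    on a single fibre \<open>T\<close> is either all of \<open>F\<close> or 0.\<close>
  have zero: "fibre_int T z = 0" if z: "z \<in> v ` \<Omega>" for z
  proof (cases "fibre_int F z = 0")
    case True
    have "at_inverse \<Omega> u (\<lambda>x. T x / jac x) (z, t) = at_inverse \<Omega> u (\<lambda>x. F x / jac x) (z, t)" for t
      by (cases rule: at_inverse_cases[of z t]) (simp_all add: T_def True)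
    then show ?thesis using True by (simp add: fibre_int_def)
  next
    case False
    have "at_inverse \<Omega> u (\<lambda>x. T x / jac x) (z, t) = 0" for t
      by (cases rule: at_inverse_cases[of z t]) (use False in \<open>simp_all add: T_def\<close>)
    then show ?thesis by (simp add: fibre_int_def)
  qed
  obtain \<Phi> where \<Phi>m [measurable]: "\<Phi> \<in> borel_measurable borel"
    and \<Phi>: "AE x in lborel. x \<in> \<Omega> \<longrightarrow> fibre_int ref (v x) = \<Phi> x"
    using fibre_int_measurable_version[OF ref_measurable ref_nonneg] by (elim bexE) (rule that)
  obtain T' where T' [measurable]: "T' \<in> borel_measurable borel" and T'_eq: "AE x in lborel. T x = T' x"
    using lebesgue_borel_version[OF Tm T0] by blast
  have "(\<integral>\<^sup>+x. indicator \<Omega> x * (ennreal (T' x) * \<Phi> x) \<partial>lborel) =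
     (\<integral>\<^sup>+x. indicator \<Omega> x * (ennreal (T x) * fibre_int ref (v x)) \<partial>lborel)"
  proof (rule nn_integral_cong_AE)
    show "AE x in lborel. indicator \<Omega> x * (ennreal (T' x) * \<Phi> x) = indicator \<Omega> x * (ennreal (T x) * fibre_int ref (v x))"
      using \<Phi> T'_eq by eventually_elim (auto simp: indicator_def)
  qed
  also have "\<dots> = (\<integral>\<^sup>+x. indicator \<Omega> x * (ennreal (ref x) * fibre_int T (v x)) \<partial>lborel)"
    by (rule fibre_int_symmetric[OF Tm T0 ref_measurable ref_nonneg])
  also have "\<dots> = (\<integral>\<^sup>+x. 0 \<partial>(lborel :: (real^'n) measure))"
    by (rule nn_integral_cong) (auto simp: indicator_def zero)
  finally have "AE x in lborel. indicator \<Omega> x * (ennreal (T' x) * \<Phi> x) = 0"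
    by (simp add: nn_integral_0_iff_AE)
  with \<Phi> T'_eq AE_fibre_int_ref_pos show ?thesis
  proof eventually_elim
    case (elim x)
    show ?case
    proof (intro impI notI)
      assume x: "x \<in> \<Omega>" "F x \<noteq> 0" "fibre_int F (v x) = 0"
      then have "T x = F x" by (simp add: T_def)
      then have "ennreal (T' x) \<noteq> 0" using elim x F0[of x] by (simp add: ennreal_eq_0_iff)
      then show False using elim x by (simp add: indicator_def)
    qed
  qed
qed

text \<open>The constant is quantified inside the almost-everywhere statement because it will be the
  reciprocal of the fibre integral of \<open>f\<close> at the same \<open>x\<close>.\<close>

lemma AE_fibre_int_cmult:
  assumes G: "G \<in> borel_measurable lebesgue" and G0: "\<And>x. 0 \<le> G x"
  shows "AE x in lborel. x \<in> \<Omega> \<longrightarrow>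
    (\<forall>c. (\<integral>\<^sup>+t. c * ennreal (at_inverse \<Omega> u (\<lambda>x. G x / jac x) (v x, t)) \<partial>lborel) = c * fibre_int G (v x))"
proof -
  have P0: "\<And>x. 0 \<le> G x / jac x" using G0 jac_nonneg by simp
  obtain \<Lambda> where [measurable]: "\<Lambda> \<in> borel_measurable borel" and
    \<Lambda>: "AE p in lborel. fst p \<in> \<Omega> \<longrightarrow> ennreal (on_fibre (\<lambda>x. G x / jac x) p) = \<Lambda> p"
    using on_fibre_measurable_version[OF measurable_div_jac[OF G] P0] by (elim bexE) (rule that)
  from AE_lborel_pairD(1)[OF \<Lambda>] show ?thesis
  proof eventually_elim
    case (elim x)
    show ?case
    proof (intro impI allI)
      fix c :: ennreal assume "x \<in> \<Omega>"
      then have L: "AE t in lborel. ennreal (at_inverse \<Omega> u (\<lambda>x. G x / jac x) (v x, t)) = \<Lambda> (x, t)"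
        using elim by simp
      have "(\<integral>\<^sup>+t. c * ennreal (at_inverse \<Omega> u (\<lambda>x. G x / jac x) (v x, t)) \<partial>lborel) = (\<integral>\<^sup>+t. c * \<Lambda> (x, t) \<partial>lborel)"
        by (rule nn_integral_cong_AE) (use L in eventually_elim, simp)
      also have "\<dots> = c * (\<integral>\<^sup>+t. \<Lambda> (x, t) \<partial>lborel)" by (rule nn_integral_cmult) measurable
      also have "(\<integral>\<^sup>+t. \<Lambda> (x, t) \<partial>lborel) = fibre_int G (v x)"
        unfolding fibre_int_def by (rule nn_integral_cong_AE) (use L in eventually_elim, simp)
      finally show "(\<integral>\<^sup>+t. c * ennreal (at_inverse \<Omega> u (\<lambda>x. G x / jac x) (v x, t)) \<partial>lborel) = c * fibre_int G (v x)" .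
    qed
  qed
qed

text \<open>
  With \<open>f\<close> a density, the conditional law of the last coordinate given \<open>v\<close> has density proportional to \<open>f / jac\<close> on the fibre:
  apply the symmetry to \<open>f\<close> divided by its own fibre integral, whose fibre integral is \<open>1\<close>.
\<close>

lemma fibre_disintegration:
  assumes f: "f \<in> borel_measurable lebesgue" and f0: "\<And>x. 0 \<le> f x"
    and fin: "(\<integral>\<^sup>+x. indicator \<Omega> x * ennreal (f x) \<partial>lborel) < \<infinity>"
    and G: "G \<in> borel_measurable lebesgue" and G0: "\<And>x. 0 \<le> G x"
    and Gf: "\<And>x. x \<in> \<Omega> \<Longrightarrow> f x = 0 \<Longrightarrow> G x = 0"
  shows "(\<integral>\<^sup>+x. indicator \<Omega> x * (ennreal (f x / enn2real (fibre_int f (v x))) * fibre_int G (v x)) \<partial>lborel) =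
         (\<integral>\<^sup>+x. indicator \<Omega> x * ennreal (G x) \<partial>lborel)"
proof -
  define F where "F x = indicator \<Omega> x * (f x / enn2real (fibre_int f (v x)))" for x
  have Fm: "F \<in> borel_measurable lebesgue"
    unfolding F_def[abs_def]
    by (rule masked_measurable[OF f f0 f, where m="\<lambda>a b. a / enn2real b"]) measurable
  have F0: "0 \<le> F x" for x using f0 by (simp add: F_def)
  have "(\<integral>\<^sup>+x. indicator \<Omega> x * (ennreal (f x / enn2real (fibre_int f (v x))) * fibre_int G (v x)) \<partial>lborel) =
     (\<integral>\<^sup>+x. indicator \<Omega> x * (ennreal (F x) * fibre_int G (v x)) \<partial>lborel)"
    by (rule nn_integral_cong) (auto simp: F_def indicator_def)
  also have "\<dots> = (\<integral>\<^sup>+x. indicator \<Omega> x * (ennreal (G x) * fibre_int F (v x)) \<partial>lborel)"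
    by (rule fibre_int_symmetric[OF Fm F0 G G0])
  also have "\<dots> = (\<integral>\<^sup>+x. indicator \<Omega> x * ennreal (G x) \<partial>lborel)"
  proof (rule nn_integral_cong_AE)
    show "AE x in lborel. indicator \<Omega> x * (ennreal (G x) * fibre_int F (v x)) = indicator \<Omega> x * ennreal (G x)"
      using AE_fibre_int_cmult[OF f f0] AE_fibre_int_finite[OF f f0 fin] AE_fibre_int_pos[OF f f0]
    proof eventually_elim
      case (elim x)
      show ?case
      proof (cases "x \<in> \<Omega> \<and> f x \<noteq> 0")
        case True
        \<comment> \<open>\<open>fibre_int f\<close> is the same at all points of the fibre, so the
          denominator in \<open>F\<close> is one finite positive number there and leaves the
          integral as a factor.\<close>
        let ?c = "enn2real (fibre_int f (v x))"
        have c: "fibre_int f (v x) = ennreal ?c" "?c > 0"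
          using elim True by (auto simp: less_top enn2real_positive_iff zero_less_iff_neq_zero)
        have "ennreal (at_inverse \<Omega> u (\<lambda>x. F x / jac x) (v x, t)) =
            ennreal (1 / ?c) * ennreal (at_inverse \<Omega> u (\<lambda>x. f x / jac x) (v x, t))" for t
        proof (cases rule: at_inverse_cases[of "v x" t])
          case (1 x')
          then have "at_inverse \<Omega> u (\<lambda>x. F x / jac x) (v x, t) = (1 / ?c) * at_inverse \<Omega> u (\<lambda>x. f x / jac x) (v x, t)"
            by (simp add: F_def mult.commute)
          then show ?thesis using c(2) by (simp add: ennreal_mult'[symmetric])
        qed simp
        then have "fibre_int F (v x) = ennreal (1 / ?c) * fibre_int f (v x)"
          using elim True by (simp add: fibre_int_def[of F])
        also have "\<dots> = ennreal (1 / ?c) * ennreal ?c" using c(1) by simp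
        also have "\<dots> = 1" using c(2) by (subst ennreal_mult'[symmetric]) auto
        finally show ?thesis by simp
      next
        case False
        then show ?thesis using Gf by (auto simp: indicator_def)
      qed
    qed
  qed
  finally show ?thesis .
qed

section \<open>Signed integrands and a joint density\<close>

lemma on_fibre_real_version:
  assumes P: "P \<in> borel_measurable lebesgue"
  shows "\<exists>\<Lambda> :: (real^'n) \<times> real \<Rightarrow> real. \<Lambda> \<in> borel_measurable borel \<and> (AE p in lborel. fst p \<in> \<Omega> \<longrightarrow> on_fibre P p = \<Lambda> p)"
proof -
  have m: "(\<lambda>x. max 0 (P x)) \<in> borel_measurable lebesgue" "(\<lambda>x. max 0 (- P x)) \<in> borel_measurable lebesgue"
    using P by measurable
  have pos: "\<And>x. 0 \<le> max 0 (P x)" "\<And>x. 0 \<le> max 0 (- P x)" by simp_all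
  obtain L1 where [measurable]: "L1 \<in> borel_measurable borel" and
    L1: "AE p in lborel. fst p \<in> \<Omega> \<longrightarrow> ennreal (on_fibre (\<lambda>x. max 0 (P x)) p) = L1 p"
    using on_fibre_measurable_version[OF m(1) pos(1)] by (elim bexE) (rule that)
  obtain L2 where [measurable]: "L2 \<in> borel_measurable borel" and
    L2: "AE p in lborel. fst p \<in> \<Omega> \<longrightarrow> ennreal (on_fibre (\<lambda>x. max 0 (- P x)) p) = L2 p"
    using on_fibre_measurable_version[OF m(2) pos(2)] by (elim bexE) (rule that)
  have "AE p in lborel. fst p \<in> \<Omega> \<longrightarrow> on_fibre P p = enn2real (L1 p) - enn2real (L2 p)"
    using L1 L2
  proof eventually_elim
    case (elim p)
    show ?case
    proof
      assume p: "fst p \<in> \<Omega>"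
      show "on_fibre P p = enn2real (L1 p) - enn2real (L2 p)"
      proof (cases rule: at_inverse_cases[of "v (fst p)" "snd p"])
        case (1 x)
        then have "L1 p = ennreal (max 0 (P x))" "L2 p = ennreal (max 0 (- P x))"
          using elim p by auto
        then show ?thesis by (cases "0 \<le> P x") (simp_all add: 1(4) ennreal_neg)
      next
        case 2
        then show ?thesis using elim p by (metis diff_self enn2real_0 ennreal_0)
      qed
    qed
  qed
  then show ?thesis by (intro exI[of _ "\<lambda>p. enn2real (L1 p) - enn2real (L2 p)"]) simp
qed

text \<open>For \<open>x\<close> in \<Omega> the integral over levels is the weight of
  \<open>x\<close> times the fibre integral of \<open>G\<close>, because the level of a fibre point
  is its value of \<open>h\<close>; the disintegration then removes the weights.
  \<open>ennreal\<close> keeps the positive part only, and the negative part comes from applying the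
  statement to \<open>- P\<close>.\<close>

lemma nn_integral_weighted_fibre:
  assumes f: "f \<in> borel_measurable lebesgue" and f0: "\<And>x. 0 \<le> f x"
    and fin: "(\<integral>\<^sup>+x. indicator \<Omega> x * ennreal (f x) \<partial>lborel) < \<infinity>"
    and P: "P \<in> borel_measurable lebesgue" and Pf: "\<And>x. x \<in> \<Omega> \<Longrightarrow> f x = 0 \<Longrightarrow> P x = 0"
    and B: "B \<in> sets borel"
    and \<Psi> [measurable]: "\<Psi> \<in> borel_measurable borel"
    and \<Psi>_eq: "AE p in lborel. \<Psi> p = indicator \<Omega> (fst p) * (f (fst p) / enn2real (fibre_int f (v (fst p)))) *
       on_fibre (\<lambda>x. P x / jac x) p"
  shows "(\<integral>\<^sup>+p. ennreal (\<Psi> p * indicator B (snd p)) \<partial>lborel) =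
         (\<integral>\<^sup>+x. ennreal (indicator \<Omega> x * (P x * indicator B (h x))) \<partial>lborel)"
proof -
  note B[measurable]
  define G where "G x = max 0 (P x * indicator B (hU x))" for x
  have hUm: "hU \<in> borel_measurable lebesgue" by (rule measurable_completion) simp
  have "(\<lambda>x. indicator B (hU x) :: real) \<in> borel_measurable lebesgue"
    by (rule measurable_compose[OF hUm]) simp
  then have Gm: "G \<in> borel_measurable lebesgue"
    unfolding G_def[abs_def] using P by measurable
  have G0: "0 \<le> G x" for x by (simp add: G_def)
  let ?c = "\<lambda>x. f x / enn2real (fibre_int f (v x))"
  have "(\<integral>\<^sup>+p. ennreal (\<Psi> p * indicator B (snd p)) \<partial>lborel) =
      (\<integral>\<^sup>+x. \<integral>\<^sup>+t. ennreal (\<Psi> (x, t) * indicator B t) \<partial>lborel \<partial>lborel)"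
    by (subst nn_integral_lborel_pair(1)) simp_all
  also have "\<dots> = (\<integral>\<^sup>+x. indicator \<Omega> x * (ennreal (?c x) * fibre_int G (v x)) \<partial>lborel)"
  proof (rule nn_integral_cong_AE)
    show "AE x in lborel. (\<integral>\<^sup>+t. ennreal (\<Psi> (x, t) * indicator B t) \<partial>lborel) = indicator \<Omega> x * (ennreal (?c x) * fibre_int G (v x))"
      using AE_lborel_pairD(1)[OF \<Psi>_eq] AE_fibre_int_cmult[OF Gm G0]
    proof eventually_elim
      case (elim x)
      have c0: "0 \<le> ?c x" using f0 by simp
      have pw: "ennreal (?c x * at_inverse \<Omega> u (\<lambda>x. P x / jac x) (v x, t) * indicator B t) =
          ennreal (?c x) * ennreal (at_inverse \<Omega> u (\<lambda>x. G x / jac x) (v x, t))" for t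
      proof (cases rule: at_inverse_cases[of "v x" t])
        case (1 x')
        have "x' \<in> U" using 1 \<Omega>U by auto
        then have hx: "hU x' = t" using 1 by simp
        have "ennreal (G x' / jac x') = ennreal (P x' / jac x' * indicator B t)"
          using jac_nonneg[of x'] by (auto simp: G_def hx max_def ennreal_neg divide_nonpos_nonneg indicator_def not_le less_imp_le)
        then show ?thesis using c0 by (simp add: 1(4) ennreal_mult'[symmetric] mult.assoc)
      qed simp
      show ?case
      proof (cases "x \<in> \<Omega>")
        case True
        have "(\<integral>\<^sup>+t. ennreal (\<Psi> (x, t) * indicator B t) \<partial>lborel) =
           (\<integral>\<^sup>+t. ennreal (?c x) * ennreal (at_inverse \<Omega> u (\<lambda>x. G x / jac x) (v x, t)) \<partial>lborel)"
        proof (rule nn_integral_cong_AE)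
          show "AE t in lborel. ennreal (\<Psi> (x, t) * indicator B t) =
              ennreal (?c x) * ennreal (at_inverse \<Omega> u (\<lambda>x. G x / jac x) (v x, t))"
            using elim(1)
          proof eventually_elim
            case (elim t)
            then show ?case using True by (simp only: pw[symmetric]) simp
          qed
        qed
        then show ?thesis using elim(2) True by simp
      next
        case False
        have "(\<integral>\<^sup>+t. ennreal (\<Psi> (x, t) * indicator B t) \<partial>lborel) = (\<integral>\<^sup>+t. 0 \<partial>(lborel :: real measure))"
          by (rule nn_integral_cong_AE) (use elim(1) in eventually_elim, use False in simp)
        then show ?thesis using False by simp
      qed
    qed
  qed
  also have "\<dots> = (\<integral>\<^sup>+x. indicator \<Omega> x * ennreal (G x) \<partial>lborel)"
    by (rule fibre_disintegration[OF f f0 fin Gm G0]) (simp add: G_def Pf)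
  also have "\<dots> = (\<integral>\<^sup>+x. ennreal (indicator \<Omega> x * (P x * indicator B (h x))) \<partial>lborel)"
  proof (rule nn_integral_cong)
    fix x
    show "indicator \<Omega> x * ennreal (G x) = ennreal (indicator \<Omega> x * (P x * indicator B (h x)))"
    proof (cases "x \<in> \<Omega>")
      case True
      then have "hU x = h x" using \<Omega>U by auto
      then show ?thesis using True by (simp add: G_def max_def ennreal_neg)
    qed simp
  qed
  finally show ?thesis .
qed

text \<open>For \<open>P = g * f\<close> the function \<open>\<Psi>\<close> is, almost everywhere,
  \<open>f x\<close> times \<nu> at \<open>v x\<close> and level t. Integrating out the level will
  produce \<open>w\<close>, integrating out the point the derivative of \<alpha>, so one jointly
  Borel version must serve every \<open>B\<close>. Integrability is asked for each \<open>B\<close>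
  separately, since only truncated expectations of g are assumed to exist.\<close>

theorem weighted_fibre_integral:
  assumes f: "f \<in> borel_measurable borel" and f0: "\<And>x. 0 \<le> f x"
    and fin: "(\<integral>\<^sup>+x. indicator \<Omega> x * ennreal (f x) \<partial>lborel) < \<infinity>"
    and P: "P \<in> borel_measurable borel" and Pf: "\<And>x. x \<in> \<Omega> \<Longrightarrow> f x = 0 \<Longrightarrow> P x = 0"
  shows "\<exists>\<Psi> :: (real^'n) \<times> real \<Rightarrow> real. \<Psi> \<in> borel_measurable borel \<and>
    (AE p in lborel. \<Psi> p = indicator \<Omega> (fst p) * (f (fst p) / enn2real (fibre_int f (v (fst p)))) * on_fibre (\<lambda>x. P x / jac x) p) \<and>
    (\<forall>B \<in> sets borel. integrable lborel (\<lambda>x. indicator \<Omega> x * (P x * indicator B (h x))) \<longrightarrow>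
       integrable lborel (\<lambda>p. \<Psi> p * indicator B (snd p)) \<and>
       (\<integral>p. \<Psi> p * indicator B (snd p) \<partial>lborel) = (\<integral>x. indicator \<Omega> x * (P x * indicator B (h x)) \<partial>lborel))"
proof -
  have fm: "f \<in> borel_measurable lebesgue" and Pm: "P \<in> borel_measurable lebesgue"
    by (rule measurable_completion; simp add: f P)+
  obtain \<Lambda> :: "(real^'n) \<times> real \<Rightarrow> real" where L: "\<Lambda> \<in> borel_measurable borel \<and>
     (AE p in lborel. fst p \<in> \<Omega> \<longrightarrow> on_fibre (\<lambda>x. P x / jac x) p = \<Lambda> p)"
    using on_fibre_real_version[OF measurable_div_jac[OF Pm]] by (elim exE) (rule that)
  then have [measurable]: "\<Lambda> \<in> borel_measurable borel" ..
  obtain \<Phi> where [measurable]: "\<Phi> \<in> borel_measurable borel"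
    and \<Phi>: "AE x in lborel. x \<in> \<Omega> \<longrightarrow> fibre_int f (v x) = \<Phi> x"
    using fibre_int_measurable_version[OF fm f0] by (elim bexE) (rule that)
  note f[measurable]
  define \<Psi> where "\<Psi> p = indicator \<Omega> (fst p) * (f (fst p) / enn2real (\<Phi> (fst p))) * \<Lambda> p" for p
  have \<Psi>m: "\<Psi> \<in> borel_measurable borel" unfolding \<Psi>_def[abs_def] by measurable
  have \<Phi>2: "AE p in (lborel :: ((real^'n) \<times> real) measure). fst p \<in> \<Omega> \<longrightarrow> fibre_int f (v (fst p)) = \<Phi> (fst p)"
    using AE_lborel_fst[OF \<Phi>] by simp
  have \<Psi>_eq: "AE p in lborel. \<Psi> p = indicator \<Omega> (fst p) * (f (fst p) / enn2real (fibre_int f (v (fst p)))) * on_fibre (\<lambda>x. P x / jac x) p"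
    using conjunct2[OF L] \<Phi>2 by eventually_elim (auto simp: \<Psi>_def indicator_def)
  have "integrable lborel (\<lambda>p. \<Psi> p * indicator B (snd p)) \<and>
       (\<integral>p. \<Psi> p * indicator B (snd p) \<partial>lborel) = (\<integral>x. indicator \<Omega> x * (P x * indicator B (h x)) \<partial>lborel)"
    if B: "B \<in> sets borel" and int: "integrable lborel (\<lambda>x. indicator \<Omega> x * (P x * indicator B (h x)))" for B
  proof -
    note B[measurable]
    have 1: "(\<integral>\<^sup>+p. ennreal (\<Psi> p * indicator B (snd p)) \<partial>lborel) =
         (\<integral>\<^sup>+x. ennreal (indicator \<Omega> x * (P x * indicator B (h x))) \<partial>lborel)"
      by (rule nn_integral_weighted_fibre[OF fm f0 fin Pm Pf B \<Psi>m \<Psi>_eq])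
    have 2: "(\<integral>\<^sup>+p. ennreal (- \<Psi> p * indicator B (snd p)) \<partial>lborel) =
         (\<integral>\<^sup>+x. ennreal (indicator \<Omega> x * (- P x * indicator B (h x))) \<partial>lborel)"
    proof (rule nn_integral_weighted_fibre[OF fm f0 fin _ _ B])
      show "(\<lambda>x. - P x) \<in> borel_measurable lebesgue" using Pm by simp
      show "(\<lambda>p. - \<Psi> p) \<in> borel_measurable borel" using \<Psi>m by simp
      have neg: "on_fibre (\<lambda>x. - P x / jac x) p = - on_fibre (\<lambda>x. P x / jac x) p" for p
        by (simp add: at_inverse_def)
      show "AE p in lborel. - \<Psi> p = indicator \<Omega> (fst p) * (f (fst p) / enn2real (fibre_int f (v (fst p)))) * on_fibre (\<lambda>x. - P x / jac x) p"
        using \<Psi>_eq unfolding neg by eventually_elim simp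
    qed (use Pf in auto)
    have neg_eq: "(\<integral>\<^sup>+p. ennreal (- (\<Psi> p * indicator B (snd p))) \<partial>lborel) =
         (\<integral>\<^sup>+x. ennreal (- (indicator \<Omega> x * (P x * indicator B (h x)))) \<partial>lborel)"
      using 2 by simp
    have m: "(\<lambda>p. \<Psi> p * indicator B (snd p)) \<in> borel_measurable lborel" using \<Psi>m by measurable
    have int2: "integrable lborel (\<lambda>p. \<Psi> p * indicator B (snd p))"
      using int m unfolding real_integrable_def 1 neg_eq by simp
    show ?thesis
      using int2 by (simp add: real_lebesgue_integral_def[OF int] real_lebesgue_integral_def[OF int2] 1 neg_eq)
  qed
  then show ?thesis using \<Psi>m \<Psi>_eq by blast
qed

end

section \<open>Conditional expectations and their derivatives\<close>

lemma completion_integral_AE: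
  fixes F F' :: "'a \<Rightarrow> real"
  assumes F': "F' \<in> borel_measurable M" and eq: "AE x in M. F x = F' x"
  shows "F \<in> borel_measurable (completion M)"
    and "integrable (completion M) F \<longleftrightarrow> integrable M F'"
    and "(\<integral>x. F x \<partial>completion M) = (\<integral>x. F' x \<partial>M)"
proof -
  have F'c: "F' \<in> borel_measurable (completion M)" using F' by (rule measurable_completion)
  show m: "F \<in> borel_measurable (completion M)"
    by (rule borel_measurable_completion_AE[OF F'c]) (use eq in eventually_elim, simp)
  have eqc: "AE x in completion M. F x = F' x" using eq by (rule AE_completion)
  show "integrable (completion M) F \<longleftrightarrow> integrable M F'"
    using integrable_cong_AE[OF m F'c eqc] integrable_completion[OF F'] by simp
  show "(\<integral>x. F x \<partial>completion M) = (\<integral>x. F' x \<partial>M)"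
    using integral_cong_AE[OF m F'c eqc] integral_completion[OF F'] by simp
qed

text \<open>\<open>\<Psi>\<close> is fixed as a parameter together with its properties, so that
  \<alpha>, w and the derivative all refer to the same version.\<close>

locale conditional_chart = fibred_chart \<Omega> U v h u' + prob_space M
  for \<Omega> U :: "(real^'n) set" and v h u' and M :: "'w measure" +
  fixes X :: "'w \<Rightarrow> real^'n" and f g :: "real^'n \<Rightarrow> real" and c0 c1 :: ereal
    and \<Psi> :: "(real^'n) \<times> real \<Rightarrow> real"
  assumes density: "distributed M lborel X (\<lambda>x. ennreal (f x))"
    and f_measurable [measurable]: "f \<in> borel_measurable borel"
    and f_nonneg: "\<And>x. 0 \<le> f x" and f_support: "\<And>x. x \<notin> \<Omega> \<Longrightarrow> f x = 0"
    and g_measurable [measurable]: "g \<in> borel_measurable borel"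
    and h_range: "\<And>x. x \<in> \<Omega> \<Longrightarrow> c0 < ereal (h x) \<and> ereal (h x) < c1"
    and \<alpha>_exists: "\<And>\<xi>. c0 < ereal \<xi> \<Longrightarrow> ereal \<xi> < c1 \<Longrightarrow>
                      integrable M (\<lambda>\<omega>. g (X \<omega>) * indicator {x. h x \<le> \<xi>} (X \<omega>))"
    and f_finite: "(\<integral>\<^sup>+x. indicator \<Omega> x * ennreal (f x) \<partial>lborel) < \<infinity>"
    and \<Psi>_measurable [measurable]: "\<Psi> \<in> borel_measurable borel"
    and \<Psi>_eq: "AE p in lborel. \<Psi> p = indicator \<Omega> (fst p) * (f (fst p) / enn2real (fibre_int f (v (fst p)))) *
                  at_inverse \<Omega> (\<lambda>x. (v x, h x)) (\<lambda>x. g x * f x / jac x) (v (fst p), snd p)"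
    and \<Psi>_integral: "\<And>B. B \<in> sets borel \<Longrightarrow> integrable lborel (\<lambda>x. indicator \<Omega> x * (g x * f x * indicator B (h x))) \<Longrightarrow>
       integrable lborel (\<lambda>p. \<Psi> p * indicator B (snd p)) \<and>
       (\<integral>p. \<Psi> p * indicator B (snd p) \<partial>lborel) = (\<integral>x. indicator \<Omega> x * (g x * f x * indicator B (h x)) \<partial>lborel)"
begin

abbreviation "\<alpha> \<equiv> \<lambda>\<xi>. \<integral>\<omega>. g (X \<omega>) * indicator {x. h x \<le> \<xi>} (X \<omega>) \<partial>M"
abbreviation "w \<equiv> w_fun \<Omega> (\<lambda>x. (v x, h x)) f g c0 c1"
abbreviation "\<nu> \<equiv> nu_fun \<Omega> (\<lambda>x. (v x, h x)) f g c0 c1"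

lemma f_lebesgue: "f \<in> borel_measurable lebesgue"
  by (rule measurable_completion) simp

lemma AE_X:
  assumes "AE x in lborel. f x \<noteq> 0 \<longrightarrow> Q x"
  shows "AE \<omega> in M. Q (X \<omega>)"
proof -
  have X: "X \<in> measurable M lborel" using density by (rule distributed_measurable)
  have "AE x in density lborel (\<lambda>x. ennreal (f x)). Q x"
    using assms f_nonneg by (subst AE_density) (auto simp: less_le elim!: eventually_mono)
  then have "AE x in distr M lborel X. Q x"
    unfolding distributed_distr_eq_density[OF density] .
  then show ?thesis by (rule AE_distrD[OF X])
qed

lemma integral_X:
  assumes "\<phi> \<in> borel_measurable borel"
  shows "integrable M (\<lambda>\<omega>. \<phi> (X \<omega>)) \<longleftrightarrow> integrable lborel (\<lambda>x. f x * \<phi> x)"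
    and "(\<integral>\<omega>. \<phi> (X \<omega>) \<partial>M) = (\<integral>x. f x * \<phi> x \<partial>lborel)"
  using distributed_integrable[OF density, of \<phi>] distributed_integral[OF density, of \<phi>] assms f_nonneg by simp_all

text \<open>Only the product of \<open>f\<close> and \<open>H\<close> has a Borel version. That
  determines \<open>H (X \<omega>)\<close> almost surely, because the density is almost surely
  nonzero at \<open>X \<omega>\<close>; hence the expectation over the completion.\<close>

lemma integral_X_completion:
  assumes R [measurable]: "R \<in> borel_measurable borel" and eq: "AE x in lborel. R x = f x * H x"
  shows "(\<lambda>\<omega>. H (X \<omega>)) \<in> borel_measurable (completion M)"
    and "integrable (completion M) (\<lambda>\<omega>. H (X \<omega>)) \<longleftrightarrow> integrable lborel R"
    and "(\<integral>\<omega>. H (X \<omega>) \<partial>completion M) = (\<integral>x. R x \<partial>lborel)"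
proof -
  \<comment> \<open>Division by 0 gives 0 where the density vanishes;
    \<open>f x * \<phi> x = R x\<close> still holds almost everywhere, as \<open>R\<close> is 0
    almost everywhere there.\<close>
  define \<phi> where "\<phi> x = R x / f x" for x
  have \<phi> [measurable]: "\<phi> \<in> borel_measurable borel" unfolding \<phi>_def[abs_def] by measurable
  have X: "X \<in> measurable M lborel" using density by (rule distributed_measurable)
  then have \<phi>X: "(\<lambda>\<omega>. \<phi> (X \<omega>)) \<in> borel_measurable M" by (rule measurable_compose) simp
  have H: "AE \<omega> in M. H (X \<omega>) = \<phi> (X \<omega>)"
    by (rule AE_X[where Q="\<lambda>x. H x = \<phi> x"]) (use eq in eventually_elim, simp add: \<phi>_def)
  have f\<phi>: "AE x in lborel. f x * \<phi> x = R x"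
    using eq by eventually_elim (simp add: \<phi>_def)
  have m: "(\<lambda>x. f x * \<phi> x) \<in> borel_measurable lborel" "R \<in> borel_measurable lborel" by simp_all
  show "(\<lambda>\<omega>. H (X \<omega>)) \<in> borel_measurable (completion M)"
    by (rule completion_integral_AE(1)[OF \<phi>X H])
  show "integrable (completion M) (\<lambda>\<omega>. H (X \<omega>)) \<longleftrightarrow> integrable lborel R"
    using completion_integral_AE(2)[OF \<phi>X H] integral_X(1)[OF \<phi>] integrable_cong_AE[OF m f\<phi>] by simp
  show "(\<integral>\<omega>. H (X \<omega>) \<partial>completion M) = (\<integral>x. R x \<partial>lborel)"
    using completion_integral_AE(3)[OF \<phi>X H] integral_X(2)[OF \<phi>] integral_cong_AE[OF m f\<phi>] by simp
qed

lemma \<alpha>_as_integral: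
  assumes "c0 < ereal \<xi>" "ereal \<xi> < c1"
  shows "integrable lborel (\<lambda>p. \<Psi> p * indicator {..\<xi>} (snd p))"
    and "\<alpha> \<xi> = (\<integral>p. \<Psi> p * indicator {..\<xi>} (snd p) \<partial>lborel)"
proof -
  define \<phi> where "\<phi> x = g x * indicator {..\<xi>} (hU x)" for x
  have \<phi> [measurable]: "\<phi> \<in> borel_measurable borel" unfolding \<phi>_def[abs_def] by measurable
  have X: "X \<in> measurable M lborel" using density by (rule distributed_measurable)
  then have \<phi>X: "(\<lambda>\<omega>. \<phi> (X \<omega>)) \<in> borel_measurable M" by (rule measurable_compose) simp
  have eq: "AE \<omega> in M. g (X \<omega>) * indicator {x. h x \<le> \<xi>} (X \<omega>) = \<phi> (X \<omega>)"
  proof (rule AE_X[where Q="\<lambda>x. g x * indicator {x. h x \<le> \<xi>} x = \<phi> x"], rule AE_I2, rule impI)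
    fix x assume "f x \<noteq> 0"
    then have "x \<in> U" using f_support[of x] \<Omega>U by auto
    then show "g x * indicator {x. h x \<le> \<xi>} x = \<phi> x" by (simp add: \<phi>_def indicator_def)
  qed
  have m: "(\<lambda>\<omega>. g (X \<omega>) * indicator {x. h x \<le> \<xi>} (X \<omega>)) \<in> borel_measurable M"
    using \<alpha>_exists[OF assms] by (rule borel_measurable_integrable)
  have "integrable M (\<lambda>\<omega>. \<phi> (X \<omega>))"
    using \<alpha>_exists[OF assms] integrable_cong_AE[OF m \<phi>X eq] by simp
  then have int: "integrable lborel (\<lambda>x. f x * \<phi> x)" using integral_X(1)[OF \<phi>] by simp
  have \<alpha>\<phi>: "\<alpha> \<xi> = (\<integral>x. f x * \<phi> x \<partial>lborel)"
    using integral_cong_AE[OF m \<phi>X eq] integral_X(2)[OF \<phi>] by simp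
  have pw: "f x * \<phi> x = indicator \<Omega> x * (g x * f x * indicator {..\<xi>} (h x))" for x
  proof (cases "x \<in> \<Omega>")
    case True
    then have "x \<in> U" using \<Omega>U by auto
    then show ?thesis using True by (simp add: \<phi>_def)
  qed (simp add: f_support)
  note * = \<Psi>_integral[of "{..\<xi>}", OF _ int[unfolded pw]]
  show "integrable lborel (\<lambda>p. \<Psi> p * indicator {..\<xi>} (snd p))" using * by simp
  show "\<alpha> \<xi> = (\<integral>p. \<Psi> p * indicator {..\<xi>} (snd p) \<partial>lborel)" using * \<alpha>\<phi> unfolding pw by simp
qed

lemma AE_on_fibre_jacobian:
  "AE p in lborel. fst p \<in> \<Omega> \<longrightarrow> on_fibre (\<lambda>x. P x / jacobian_m u x) p = on_fibre (\<lambda>x. P x / jac x) p"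
  by (rule AE_on_fibre_cong) (use AE_jac_pos in eventually_elim, simp)

lemma at_inverse_outside:
  assumes "\<not> (c0 < ereal t \<and> ereal t < c1)"
  shows "at_inverse \<Omega> u P (z, t) = 0"
  using h_range assms by (cases rule: at_inverse_cases[of z t]) auto

text \<open>Restricting the levels to (c0,c1) changes nothing, because \<open>h\<close> takes its
  values there, and \<open>c0 \<le> c1\<close> fixes the orientation of the interval. An infinite
  fibre integral gives 0 on both sides, by the conventions for nonintegrable functions and for
  \<open>enn2real\<close>.\<close>

lemma AE_fibre_mass:
  assumes c: "c0 \<le> c1"
  shows "AE x in lborel. x \<in> \<Omega> \<longrightarrow> fibre_mass \<Omega> u f c0 c1 (v x) = enn2real (fibre_int f (v x))"
proof -
  have P0: "\<And>x. 0 \<le> f x / jac x" using f_nonneg jac_nonneg by simp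
  obtain \<Lambda> where [measurable]: "\<Lambda> \<in> borel_measurable borel" and
    \<Lambda>: "AE p in lborel. fst p \<in> \<Omega> \<longrightarrow> ennreal (on_fibre (\<lambda>x. f x / jac x) p) = \<Lambda> p"
    using on_fibre_measurable_version[OF measurable_div_jac[OF f_lebesgue] P0] by (elim bexE) (rule that)
  show ?thesis
    using AE_lborel_pairD(1)[OF \<Lambda>] AE_lborel_pairD(1)[OF AE_on_fibre_jacobian[of f]]
  proof eventually_elim
    case (elim x)
    show ?case
    proof
      assume x: "x \<in> \<Omega>"
      let ?a = "\<lambda>t. at_inverse \<Omega> u (\<lambda>x. f x / jac x) (v x, t)"
      have a0: "0 \<le> ?a t" for t
        using P0 by (cases rule: at_inverse_cases[of "v x" t]) simp_all
      have L: "AE t in lborel. ennreal (?a t) = \<Lambda> (x, t)" using elim(1) x by simp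
      have eq: "AE t in lborel. indicator (einterval c0 c1) t *\<^sub>R at_inverse \<Omega> u (\<lambda>x. f x / jacobian_m u x) (v x, t) = enn2real (\<Lambda> (x, t))"
        using L elim(2)
      proof eventually_elim
        case (elim t)
        have "at_inverse \<Omega> u (\<lambda>x. f x / jacobian_m u x) (v x, t) = ?a t" using elim(2) x by simp
        moreover have "enn2real (\<Lambda> (x, t)) = ?a t" using elim(1)[symmetric] a0 by simp
        moreover have "indicator (einterval c0 c1) t * ?a t = ?a t"
          using at_inverse_outside[of t] by (auto simp: einterval_def indicator_def)
        ultimately show ?case by simp
      qed
      have "fibre_mass \<Omega> u f c0 c1 (v x) = (\<integral>t. enn2real (\<Lambda> (x, t)) \<partial>lborel)"
        unfolding fibre_mass_def interval_lebesgue_integral_def set_lebesgue_integral_def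
        using c by (simp add: completion_integral_AE(3)[OF _ eq] del: real_scaleR_def)
      also have "\<dots> = enn2real (\<integral>\<^sup>+t. ennreal (enn2real (\<Lambda> (x, t))) \<partial>lborel)"
        by (rule integral_eq_nn_integral) auto
      also have "(\<integral>\<^sup>+t. ennreal (enn2real (\<Lambda> (x, t))) \<partial>lborel) = fibre_int f (v x)"
        unfolding fibre_int_def
      proof (rule nn_integral_cong_AE)
        show "AE t in lborel. ennreal (enn2real (\<Lambda> (x, t))) = ennreal (?a t)"
          using L by eventually_elim (metis a0 enn2real_ennreal)
      qed
      finally show "fibre_mass \<Omega> u f c0 c1 (v x) = enn2real (fibre_int f (v x))" .
    qed
  qed
qed

lemma AE_\<Psi>_eq_\<nu>:
  assumes c: "c0 \<le> c1"
  shows "AE p in lborel. \<Psi> p = f (fst p) * \<nu> (v (fst p)) (snd p)"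
proof -
  have "AE p in (lborel :: ((real^'n) \<times> real) measure). fst p \<in> \<Omega> \<longrightarrow>
      fibre_mass \<Omega> u f c0 c1 (v (fst p)) = enn2real (fibre_int f (v (fst p)))"
    using AE_lborel_fst[OF AE_fibre_mass[OF c]] by simp
  with \<Psi>_eq AE_on_fibre_jacobian[of "\<lambda>x. g x * f x"] show ?thesis
  proof eventually_elim
    case (elim p)
    then show ?case by (cases "fst p \<in> \<Omega>") (simp_all add: nu_fun_def f_support)
  qed
qed

text \<open>The Borel counterpart of \<open>f x * w (v x) \<xi>\<close>, see
  \<open>AE_W_eq_w\<close>.\<close>

definition W :: "real \<Rightarrow> real^'n \<Rightarrow> real" where
  "W \<xi> x = (\<integral>t. \<Psi> (x, t) * indicator {..\<xi>} t \<partial>lborel)"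

lemma \<Psi>_pair [measurable]: "\<Psi> \<in> borel_measurable (borel \<Otimes>\<^sub>M borel)"
  using \<Psi>_measurable by (simp add: borel_prod)

lemma \<Psi>_section [measurable]: "(\<lambda>t. \<Psi> (x, t)) \<in> borel_measurable borel" "(\<lambda>x. \<Psi> (x, t)) \<in> borel_measurable borel"
  by measurable

lemma W_integral:
  assumes "c0 < ereal \<xi>" "ereal \<xi> < c1"
  shows "integrable lborel (W \<xi>)" and "(\<integral>x. W \<xi> x \<partial>lborel) = \<alpha> \<xi>"
    and "AE x in lborel. integrable lborel (\<lambda>t. \<Psi> (x, t) * indicator {..\<xi>} t)"
proof -
  have int: "integrable ((lborel :: (real^'n) measure) \<Otimes>\<^sub>M (lborel :: real measure)) (\<lambda>p. \<Psi> p * indicator {..\<xi>} (snd p))"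
    using \<alpha>_as_integral(1)[OF assms] by (simp add: lborel_prod)
  show "integrable lborel (W \<xi>)"
    unfolding W_def[abs_def] using lborel_pair.integrable_fst'[OF int] by simp
  show "(\<integral>x. W \<xi> x \<partial>lborel) = \<alpha> \<xi>"
    unfolding W_def using lborel_pair.integral_fst'[OF int] \<alpha>_as_integral(2)[OF assms] by (simp add: lborel_prod)
  show "AE x in lborel. integrable lborel (\<lambda>t. \<Psi> (x, t) * indicator {..\<xi>} t)"
    using lborel_pair.AE_integrable_fst'[OF int] by simp
qed

text \<open>One exceptional set serves all \<xi>, which allows differentiation in \<xi> at a fixed
  point. Where \<open>f x\<close> is nonzero the fibre mass is almost everywhere positive and
  finite, so the normalisation of \<open>w\<close> can be undone.\<close>

lemma AE_W_eq_w:
  "AE x in lborel. \<forall>\<xi>. c0 < ereal \<xi> \<and> ereal \<xi> < c1 \<longrightarrow> W \<xi> x = f x * w (v x) \<xi>"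
proof (cases "c0 \<le> c1")
  case c: True
  show ?thesis
    using AE_lborel_pairD(1)[OF AE_\<Psi>_eq_\<nu>[OF c]] AE_fibre_mass[OF c]
      AE_fibre_int_finite[OF f_lebesgue f_nonneg f_finite] AE_fibre_int_pos[OF f_lebesgue f_nonneg]
  proof eventually_elim
    case (elim x)
    show ?case
    proof (intro allI impI, elim conjE)
      fix \<xi> assume \<xi>: "c0 < ereal \<xi>" "ereal \<xi> < c1"
      show "W \<xi> x = f x * w (v x) \<xi>"
      proof (cases "f x = 0")
        case True
        have "W \<xi> x = (\<integral>t. 0 \<partial>(lborel :: real measure))"
          unfolding W_def
        proof (rule integral_cong_AE)
          show "AE t in lborel. \<Psi> (x, t) * indicator {..\<xi>} t = 0"
            using elim(1) by eventually_elim (simp add: True)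
        qed simp_all
        then show ?thesis by (simp add: True)
      next
        case False
        then have x: "x \<in> \<Omega>" using f_support by blast
        define D where "D = fibre_mass \<Omega> u f c0 c1 (v x)"
        have D: "D > 0"
          using elim x False by (auto simp: D_def less_top enn2real_positive_iff zero_less_iff_neq_zero)
        let ?a = "\<lambda>t. at_inverse \<Omega> u (\<lambda>x. g x * f x / jacobian_m u x) (v x, t)"
        \<comment> \<open>\<open>einterval\<close> omits the endpoint \<xi> that
          \<open>{..\<xi>}\<close> contains, hence the appeal to a single level being null.\<close>
        have eq: "AE t in lborel. indicator (einterval c0 (ereal \<xi>)) t *\<^sub>R ?a t = D / f x * (\<Psi> (x, t) * indicator {..\<xi>} t)"
          using elim(1) AE_lborel_singleton[of \<xi>]
        proof eventually_elim
          case (elim t)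
          have "\<Psi> (x, t) = f x * (?a t / D)" using elim(1) by (simp add: nu_fun_def D_def)
          then have "D / f x * \<Psi> (x, t) = ?a t" using False D by simp
          moreover have "indicator (einterval c0 (ereal \<xi>)) t * ?a t = ?a t * indicator {..\<xi>} t"
            using at_inverse_outside[of t] elim(2) by (auto simp: einterval_def indicator_def)
          ultimately show ?case by (simp add: mult.assoc[symmetric])
        qed
        have "interval_lebesgue_integral lebesgue c0 (ereal \<xi>) ?a = (\<integral>t. D / f x * (\<Psi> (x, t) * indicator {..\<xi>} t) \<partial>lborel)"
          unfolding interval_lebesgue_integral_def set_lebesgue_integral_def
          using \<xi> by (simp add: completion_integral_AE(3)[OF _ eq] less_imp_le del: real_scaleR_def times_divide_eq_left)
        also have "\<dots> = D / f x * W \<xi> x" unfolding W_def by (rule integral_mult_right_zero)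
        finally have "w (v x) \<xi> = D / f x * W \<xi> x / D" by (simp add: w_fun_def D_def)
        then show ?thesis using D False by simp
      qed
    qed
  qed
next
  case False
  then have "\<not> (c0 < ereal \<xi> \<and> ereal \<xi> < c1)" for \<xi> by (meson less_trans less_imp_le)
  then show ?thesis by (intro AE_I2) blast
qed

lemma w_integral:
  assumes "c0 < ereal \<xi>" "ereal \<xi> < c1"
  shows "(\<lambda>\<omega>. w (v (X \<omega>)) \<xi>) \<in> borel_measurable (completion M)"
    and "integrable (completion M) (\<lambda>\<omega>. w (v (X \<omega>)) \<xi>)"
    and "(\<integral>\<omega>. w (v (X \<omega>)) \<xi> \<partial>completion M) = \<alpha> \<xi>"
proof -
  have Wm: "W \<xi> \<in> borel_measurable borel" using W_integral(1)[OF assms] by auto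
  have "AE x in lborel. W \<xi> x = f x * w (v x) \<xi>"
    using AE_W_eq_w by eventually_elim (use assms in simp)
  note * = integral_X_completion[OF Wm this]
  show "(\<lambda>\<omega>. w (v (X \<omega>)) \<xi>) \<in> borel_measurable (completion M)" by (rule *(1))
  show "integrable (completion M) (\<lambda>\<omega>. w (v (X \<omega>)) \<xi>)" using *(2) W_integral(1)[OF assms] by simp
  show "(\<integral>\<omega>. w (v (X \<omega>)) \<xi> \<partial>completion M) = \<alpha> \<xi>" using *(3) W_integral(2)[OF assms] by simp
qed

text \<open>Exchanging the order of integration makes \<open>\<alpha>\<close> an indefinite integral.\<close>

lemma AE_derivative_below:
  assumes b: "c0 < ereal b" "ereal b < c1"
  shows "AE \<xi> in lborel. c0 < ereal \<xi> \<and> \<xi> < b \<longrightarrow>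
    integrable (completion M) (\<lambda>\<omega>. \<nu> (v (X \<omega>)) \<xi>) \<and>
    (\<alpha> has_real_derivative (\<integral>\<omega>. \<nu> (v (X \<omega>)) \<xi> \<partial>completion M)) (at \<xi>)"
proof -
  have c: "c0 \<le> c1" using b by (meson less_imp_le less_trans)
  \<comment> \<open>Only expectations truncated below c1 are known to exist, so
    \<open>\<Psi>\<close> is cut off at \<open>b\<close> before the point is integrated out; for
    levels below \<open>b\<close> the cut is invisible.\<close>
  define q where "q t = (\<integral>x. \<Psi> (x, t) * indicator {..b} t \<partial>lborel)" for t
  have intb: "integrable ((lborel :: (real^'n) measure) \<Otimes>\<^sub>M (lborel :: real measure)) (\<lambda>p. \<Psi> p * indicator {..b} (snd p))"
    using \<alpha>_as_integral(1)[OF b] by (simp add: lborel_prod)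
  have q_int: "integrable lborel q"
    unfolding q_def[abs_def] using lborel_pair.integrable_snd[of "\<lambda>x t. \<Psi> (x, t) * indicator {..b} t"] intb
    by (simp add: split_beta')
  have \<alpha>_q: "\<alpha> \<xi> = (LINT t:{..\<xi>}|lborel. q t)" if \<xi>: "c0 < ereal \<xi>" "\<xi> \<le> b" for \<xi>
  proof -
    have \<xi>1: "ereal \<xi> < c1" using \<xi>(2) b(2) by (meson ereal_less_eq(3) le_less_trans)
    have int: "integrable ((lborel :: (real^'n) measure) \<Otimes>\<^sub>M (lborel :: real measure)) (\<lambda>p. \<Psi> p * indicator {..\<xi>} (snd p))"
      using \<alpha>_as_integral(1)[OF \<xi>(1) \<xi>1] by (simp add: lborel_prod)
    have "\<alpha> \<xi> = (\<integral>p. \<Psi> p * indicator {..\<xi>} (snd p) \<partial>((lborel :: (real^'n) measure) \<Otimes>\<^sub>M (lborel :: real measure)))"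
      using \<alpha>_as_integral(2)[OF \<xi>(1) \<xi>1] by (simp add: lborel_prod)
    also have "\<dots> = (\<integral>t. \<integral>x. \<Psi> (x, t) * indicator {..\<xi>} t \<partial>lborel \<partial>lborel)"
      using lborel_pair.integral_snd[of "\<lambda>x t. \<Psi> (x, t) * indicator {..\<xi>} t"] int by (simp add: split_beta')
    also have "\<dots> = (LINT t:{..\<xi>}|lborel. q t)"
      unfolding set_lebesgue_integral_def q_def
      by (rule Bochner_Integration.integral_cong) (use \<xi>(2) in \<open>auto simp: indicator_def\<close>)
    finally show ?thesis .
  qed
  have "AE \<xi> in lborel. ((\<lambda>u. LINT t:{..u}|lborel. q t) has_real_derivative q \<xi>) (at \<xi>)"
    using AE_has_real_derivative_integral[OF q_int] by (simp add: AE_completion_iff)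
  moreover have "AE \<xi> in lborel. integrable lborel (\<lambda>x. \<Psi> (x, \<xi>) * indicator {..b} \<xi>)"
    using lborel_pair.AE_integrable_snd[of "\<lambda>x t. \<Psi> (x, t) * indicator {..b} t"] intb by (simp add: split_beta')
  ultimately show ?thesis
    using AE_lborel_pairD(2)[OF AE_\<Psi>_eq_\<nu>[OF c]]
  proof eventually_elim
    case (elim \<xi>)
    show ?case
    proof (intro impI, elim conjE)
      assume \<xi>: "c0 < ereal \<xi>" "\<xi> < b"
      have \<Psi>\<nu>: "AE x in lborel. \<Psi> (x, \<xi>) = f x * \<nu> (v x) \<xi>" using elim(3) by eventually_elim simp
      note * = integral_X_completion[OF \<Psi>_section(2) \<Psi>\<nu>]
      have "(\<alpha> has_real_derivative q \<xi>) (at \<xi>)"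
      proof (rule has_field_derivative_transform_within_open[OF elim(1)])
        show "open (einterval c0 (ereal b))" by (rule open_einterval)
        show "\<xi> \<in> einterval c0 (ereal b)" using \<xi> by (simp add: einterval_def)
        show "(LINT t:{..y}|lborel. q t) = \<alpha> y" if "y \<in> einterval c0 (ereal b)" for y
          using \<alpha>_q[of y] that by (simp add: einterval_def)
      qed
      moreover have "integrable (completion M) (\<lambda>\<omega>. \<nu> (v (X \<omega>)) \<xi>)" using *(2) elim(2) \<xi> by simp
      moreover have "(\<integral>\<omega>. \<nu> (v (X \<omega>)) \<xi> \<partial>completion M) = q \<xi>" using *(3) \<xi> by (simp add: q_def)
      ultimately show "integrable (completion M) (\<lambda>\<omega>. \<nu> (v (X \<omega>)) \<xi>) \<and>
        (\<alpha> has_real_derivative (\<integral>\<omega>. \<nu> (v (X \<omega>)) \<xi> \<partial>completion M)) (at \<xi>)" by simp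
    qed
  qed
qed

text \<open>Every admissible \<xi> has a rational bound above it and below c1, so countably many
  exceptional sets suffice.\<close>

lemma AE_derivative:
  "AE \<xi> in lebesgue. c0 < ereal \<xi> \<and> ereal \<xi> < c1 \<longrightarrow>
    integrable (completion M) (\<lambda>\<omega>. \<nu> (v (X \<omega>)) \<xi>) \<and>
    (\<alpha> has_real_derivative (\<integral>\<omega>. \<nu> (v (X \<omega>)) \<xi> \<partial>completion M)) (at \<xi>)"
proof -
  let ?B = "{b \<in> \<rat>. c0 < ereal b \<and> ereal b < c1}"
  have "AE \<xi> in lborel. \<forall>b\<in>?B. c0 < ereal \<xi> \<and> \<xi> < b \<longrightarrow>
    integrable (completion M) (\<lambda>\<omega>. \<nu> (v (X \<omega>)) \<xi>) \<and>
    (\<alpha> has_real_derivative (\<integral>\<omega>. \<nu> (v (X \<omega>)) \<xi> \<partial>completion M)) (at \<xi>)"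
    by (subst AE_ball_countable) (auto intro: countable_subset[OF _ countable_rat] AE_derivative_below)
  then have "AE \<xi> in lborel. c0 < ereal \<xi> \<and> ereal \<xi> < c1 \<longrightarrow>
    integrable (completion M) (\<lambda>\<omega>. \<nu> (v (X \<omega>)) \<xi>) \<and>
    (\<alpha> has_real_derivative (\<integral>\<omega>. \<nu> (v (X \<omega>)) \<xi> \<partial>completion M)) (at \<xi>)"
  proof eventually_elim
    case (elim \<xi>)
    show ?case
    proof
      assume \<xi>: "c0 < ereal \<xi> \<and> ereal \<xi> < c1"
      then obtain y where y: "ereal \<xi> < ereal y" "ereal y < c1" using ereal_dense2 by blast
      obtain b where b: "b \<in> \<rat>" "\<xi> < b" "b < y" using Rats_dense_in_real[of \<xi> y] y(1) by auto
      have "b \<in> ?B" using b y \<xi> by (auto intro: less_trans[of c0 "ereal \<xi>"] less_trans[of _ "ereal y"])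
      then show "integrable (completion M) (\<lambda>\<omega>. \<nu> (v (X \<omega>)) \<xi>) \<and>
        (\<alpha> has_real_derivative (\<integral>\<omega>. \<nu> (v (X \<omega>)) \<xi> \<partial>completion M)) (at \<xi>)"
        using elim \<xi> b(2) by blast
    qed
  qed
  then show ?thesis by (rule AE_completion)
qed

lemma derivative_at_continuity:
  assumes \<xi>: "c0 < ereal \<xi>" "ereal \<xi> < c1"
    and lip: "stochastic_lipschitz_at M (\<lambda>\<omega>. w (v (X \<omega>))) \<xi>"
    and cont: "AE \<omega> in M. isCont (\<nu> (v (X \<omega>))) \<xi>"
  shows "integrable (completion M) (\<lambda>\<omega>. \<nu> (v (X \<omega>)) \<xi>) \<and>
    (\<alpha> has_real_derivative (\<integral>\<omega>. \<nu> (v (X \<omega>)) \<xi> \<partial>completion M)) (at \<xi>)"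
proof -
  have c: "c0 \<le> c1" using \<xi> by (meson less_imp_le less_trans)
  obtain b where b: "ereal \<xi> < ereal b" "ereal b < c1" using ereal_dense2 \<xi>(2) by blast
  have b0: "c0 < ereal b" using \<xi>(1) b(1) by (rule less_trans)
  \<comment> \<open>At a continuity point the fundamental theorem of calculus applies on the single
    fibre, to \<open>w (v x)\<close> as an indefinite integral of
    \<open>\<nu> (v x)\<close>.\<close>
  have "AE x in lborel. f x \<noteq> 0 \<longrightarrow> isCont (\<nu> (v x)) \<xi> \<longrightarrow>
     ((\<lambda>y. w (v x) y) has_real_derivative \<nu> (v x) \<xi>) (at \<xi>)"
    using AE_W_eq_w W_integral(3)[OF b0 b(2)] AE_lborel_pairD(1)[OF AE_\<Psi>_eq_\<nu>[OF c]]
  proof eventually_elim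
    case (elim x)
    show ?case
    proof (intro impI)
      assume fx: "f x \<noteq> 0" and cont: "isCont (\<nu> (v x)) \<xi>"
      have "((\<lambda>u. LINT t:{..u}|lborel. \<Psi> (x, t) * indicator {..b} t) has_real_derivative f x * \<nu> (v x) \<xi>) (at \<xi>)"
      proof (rule has_real_derivative_integral_continuous[OF elim(2), where b=b])
        show "AE t in lborel. t < b \<longrightarrow> \<Psi> (x, t) * indicator {..b} t = f x * \<nu> (v x) t"
          using elim(3) by eventually_elim simp
        show "\<xi> < b" using b by simp
        show "isCont (\<lambda>t. f x * \<nu> (v x) t) \<xi>" using cont by (intro continuous_intros)
      qed
      then have "((\<lambda>u. (LINT t:{..u}|lborel. \<Psi> (x, t) * indicator {..b} t) / f x) has_real_derivative f x * \<nu> (v x) \<xi> / f x) (at \<xi>)"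
        by (rule DERIV_cdivide)
      then have d: "((\<lambda>u. (LINT t:{..u}|lborel. \<Psi> (x, t) * indicator {..b} t) / f x) has_real_derivative \<nu> (v x) \<xi>) (at \<xi>)"
        using fx by simp
      show "((\<lambda>y. w (v x) y) has_real_derivative \<nu> (v x) \<xi>) (at \<xi>)"
      proof (rule has_field_derivative_transform_within_open[OF d])
        show "open (einterval c0 (ereal b))" by (rule open_einterval)
        show "\<xi> \<in> einterval c0 (ereal b)" using \<xi> b by (simp add: einterval_def)
        fix y assume y: "y \<in> einterval c0 (ereal b)"
        then have "ereal y < c1" using b(2) by (auto simp: einterval_def intro: less_trans[of _ "ereal b"])
        then have "W y x = f x * w (v x) y" using elim(1) y by (simp add: einterval_def)
        moreover have "(LINT t:{..y}|lborel. \<Psi> (x, t) * indicator {..b} t) = W y x"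
          unfolding W_def set_lebesgue_integral_def
          by (rule Bochner_Integration.integral_cong) (use y in \<open>auto simp: einterval_def indicator_def\<close>)
        ultimately show "(LINT t:{..y}|lborel. \<Psi> (x, t) * indicator {..b} t) / f x = w (v x) y"
          using fx by simp
      qed
    qed
  qed
  from AE_X[where Q="\<lambda>x. isCont (\<nu> (v x)) \<xi> \<longrightarrow> ((\<lambda>y. w (v x) y) has_real_derivative \<nu> (v x) \<xi>) (at \<xi>)", OF this] cont
  have deriv: "AE \<omega> in M. ((\<lambda>y. w (v (X \<omega>)) y) has_real_derivative \<nu> (v (X \<omega>)) \<xi>) (at \<xi>)"
    by eventually_elim simp
  obtain K \<delta> where K: "integrable M K" and \<delta>: "0 < \<delta>"
    and lipK: "\<And>\<Delta>. \<bar>\<Delta>\<bar> < \<delta> \<Longrightarrow> AE \<omega> in M. \<bar>w (v (X \<omega>)) (\<xi> + \<Delta>) - w (v (X \<omega>)) \<xi>\<bar> \<le> K \<omega> * \<bar>\<Delta>\<bar>"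
    using lip unfolding stochastic_lipschitz_at_def by blast
  have Kc: "integrable (completion M) K"
    using K integrable_completion[of K M] by auto
  \<comment> \<open>The window in which \<alpha> gives the expectations of \<open>w\<close> and the
    increments from \<xi> obey the Lipschitz bound.\<close>
  define S where "S = {y. c0 < ereal y \<and> ereal y < c1 \<and> \<bar>y - \<xi>\<bar> < \<delta>}"
  have "open (einterval c0 c1 \<inter> {\<xi> - \<delta><..<\<xi> + \<delta>})" by (intro open_Int open_einterval) simp
  moreover have "einterval c0 c1 \<inter> {\<xi> - \<delta><..<\<xi> + \<delta>} = S" by (auto simp: S_def einterval_def)
  ultimately have S: "open S" "\<xi> \<in> S" using \<xi> \<delta> by (auto simp: S_def)
  let ?s = "\<lambda>y \<omega>. (w (v (X \<omega>)) y - w (v (X \<omega>)) \<xi>) / (y - \<xi>)"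
  have seq: "integrable (completion M) (\<lambda>\<omega>. \<nu> (v (X \<omega>)) \<xi>) \<and>
     (\<lambda>n. (\<alpha> (y n) - \<alpha> \<xi>) / (y n - \<xi>)) \<longlonglongrightarrow> (\<integral>\<omega>. \<nu> (v (X \<omega>)) \<xi> \<partial>completion M)"
    if y: "\<And>n. y n \<noteq> \<xi>" "y \<longlonglongrightarrow> \<xi>" and yS: "\<And>n. y n \<in> S" for y :: "nat \<Rightarrow> real"
  proof -
    have wm: "(\<lambda>\<omega>. w (v (X \<omega>)) z) \<in> borel_measurable (completion M)" "integrable (completion M) (\<lambda>\<omega>. w (v (X \<omega>)) z)"
      "(\<integral>\<omega>. w (v (X \<omega>)) z \<partial>completion M) = \<alpha> z" if "z \<in> S" for z
      using w_integral[of z] that by (auto simp: S_def)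
    have sm: "?s (y n) \<in> borel_measurable (completion M)" for n
      using wm(1)[OF yS[of n]] wm(1)[OF S(2)] by measurable
    have lim: "AE \<omega> in M. (\<lambda>n. ?s (y n) \<omega>) \<longlonglongrightarrow> \<nu> (v (X \<omega>)) \<xi>"
      using deriv
    proof eventually_elim
      case (elim \<omega>)
      have "((\<lambda>z. ?s z \<omega>) \<longlongrightarrow> \<nu> (v (X \<omega>)) \<xi>) (at \<xi>)"
        using elim by (simp add: has_field_derivative_iff)
      then show ?case
        using y by (auto simp: tendsto_at_iff_sequentially comp_def)
    qed
    \<comment> \<open>Measurability of \<nu> at the fixed \<xi> comes from its being the almost sure
      limit of measurable difference quotients.\<close>
    have \<nu>m: "(\<lambda>\<omega>. \<nu> (v (X \<omega>)) \<xi>) \<in> borel_measurable (completion M)"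
    proof (rule borel_measurable_completion_AE)
      show "(\<lambda>\<omega>. lim (\<lambda>n. ?s (y n) \<omega>)) \<in> borel_measurable (completion M)"
        by (rule borel_measurable_lim_metric) (rule sm)
      show "AE \<omega> in M. lim (\<lambda>n. ?s (y n) \<omega>) = \<nu> (v (X \<omega>)) \<xi>"
        using lim by eventually_elim (rule limI)
    qed
    have bound: "AE \<omega> in completion M. norm (?s (y n) \<omega>) \<le> K \<omega>" for n
    proof (rule AE_completion)
      have "\<bar>y n - \<xi>\<bar> < \<delta>" using yS[of n] by (simp add: S_def)
      from lipK[OF this] show "AE \<omega> in M. norm (?s (y n) \<omega>) \<le> K \<omega>"
        by eventually_elim (use y(1)[of n] in \<open>simp add: abs_divide pos_divide_le_eq\<close>)
    qed
    have int: "integrable (completion M) (\<lambda>\<omega>. \<nu> (v (X \<omega>)) \<xi>)"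
      by (rule integrable_dominated_convergence[OF \<nu>m sm Kc AE_completion[OF lim] bound])
    have conv: "(\<lambda>n. \<integral>\<omega>. ?s (y n) \<omega> \<partial>completion M) \<longlonglongrightarrow> (\<integral>\<omega>. \<nu> (v (X \<omega>)) \<xi> \<partial>completion M)"
      by (rule integral_dominated_convergence[OF \<nu>m sm Kc AE_completion[OF lim] bound])
    have sint: "(\<integral>\<omega>. ?s (y n) \<omega> \<partial>completion M) = (\<alpha> (y n) - \<alpha> \<xi>) / (y n - \<xi>)" for n
      using wm[OF yS[of n]] wm[OF S(2)] by (simp add: Bochner_Integration.integral_diff)
    show ?thesis using int conv unfolding sint by (rule conjI)
  qed
  \<comment> \<open>Integrability concerns the limit alone, so one admissible sequence is enough:
    \<xi> plus \<open>e / 2 / real (Suc n)\<close> stays within a ball inside \<open>S\<close> and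
    never equals \<xi>.\<close>
  have "integrable (completion M) (\<lambda>\<omega>. \<nu> (v (X \<omega>)) \<xi>)"
  proof -
    obtain e where e: "e > 0" "ball \<xi> e \<subseteq> S" using S open_contains_ball by blast
    define y where "y n = \<xi> + e / 2 / real (Suc n)" for n
    have "y \<longlonglongrightarrow> \<xi> + 0"
      unfolding y_def[abs_def] by (intro tendsto_intros lim_const_over_n[THEN LIMSEQ_Suc])
    moreover have "y n \<in> S" for n
    proof -
      define a where "a = e / 2 / real (Suc n)"
      have "a \<le> e / 2" "0 \<le> a" using e(1) by (simp_all add: a_def field_simps)
      moreover have "y n = \<xi> + a" by (simp add: y_def a_def)
      ultimately have "y n \<in> ball \<xi> e" using e(1) by (simp add: dist_real_def)
      then show ?thesis using e(2) by blast
    qed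
    moreover have "y n \<noteq> \<xi>" for n using e(1) by (simp add: y_def)
    ultimately show ?thesis using seq[of y] by simp
  qed
  moreover have "(\<alpha> has_real_derivative (\<integral>\<omega>. \<nu> (v (X \<omega>)) \<xi> \<partial>completion M)) (at \<xi>)"
    unfolding has_field_derivative_iff tendsto_at_iff_sequentially
  proof (intro allI impI)
    fix y :: "nat \<Rightarrow> real" assume y: "\<forall>n. y n \<in> UNIV - {\<xi>}" "y \<longlonglongrightarrow> \<xi>"
    then obtain N where N: "\<And>n. n \<ge> N \<Longrightarrow> y n \<in> S"
      using topological_tendstoD[OF y(2) S] unfolding eventually_sequentially by blast
    have "(\<lambda>n. (\<alpha> (y (n + N)) - \<alpha> \<xi>) / (y (n + N) - \<xi>)) \<longlonglongrightarrow> (\<integral>\<omega>. \<nu> (v (X \<omega>)) \<xi> \<partial>completion M)"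
      using seq[of "\<lambda>n. y (n + N)"] y N LIMSEQ_ignore_initial_segment[OF y(2), of N] by simp
    then show "((\<lambda>z. (\<alpha> z - \<alpha> \<xi>) / (z - \<xi>)) \<circ> y) \<longlonglongrightarrow> (\<integral>\<omega>. \<nu> (v (X \<omega>)) \<xi> \<partial>completion M)"
      unfolding comp_def by (rule LIMSEQ_offset)
  qed
  ultimately show ?thesis ..
qed

end

theorem theorem2:
  fixes M :: "'w measure"
    and X :: "'w \<Rightarrow> real^'m"
    and \<Omega> :: "(real^'m) set"
    and f g h :: "real^'m \<Rightarrow> real"
    and v :: "real^'m \<Rightarrow> real^'m"
    and u :: "real^'m \<Rightarrow> (real^'m) \<times> real"
    and c0 c1 :: ereal
    and \<alpha> :: "real \<Rightarrow> real"
    and w \<nu> :: "real^'m \<Rightarrow> real \<Rightarrow> real"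
  assumes "prob_space M"
    and "\<Omega> \<in> sets borel"
    and density: "distributed M lborel X (\<lambda>x. ennreal (f x))"
    and f_nonneg: "\<And>x. f x \<ge> 0"
    and f_support: "\<And>x. x \<notin> \<Omega> \<Longrightarrow> f x = 0"
    and g_measurable: "g \<in> borel_measurable borel"
    and h_continuous: "continuous_on \<Omega> h"
    and h_C1_ae: "\<exists>N\<in>null_sets lebesgue. C1_on h (\<Omega> - N)"
    and h_range: "\<And>x. x \<in> \<Omega> \<Longrightarrow> c0 < ereal (h x) \<and> ereal (h x) < c1"
    and \<alpha>_exists: "\<And>\<xi>. c0 < ereal \<xi> \<Longrightarrow> ereal \<xi> < c1 \<Longrightarrow>
                      integrable M (\<lambda>\<omega>. g (X \<omega>) * indicator {x. h x \<le> \<xi>} (X \<omega>))"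
    and \<alpha>_def: "\<alpha> = (\<lambda>\<xi>. \<integral>\<omega>. g (X \<omega>) * indicator {x. h x \<le> \<xi>} (X \<omega>) \<partial>M)"
    and u_def: "u = (\<lambda>x. (v x, h x))"
    and v_C1: "\<And>i. C1_on (\<lambda>x. v x $ i) \<Omega>"
    and u_inj: "inj_on u \<Omega>"
    and u_C1: "C1_on u \<Omega>"
    and jacobian_nonzero: "AE x in lebesgue. x \<in> \<Omega> \<longrightarrow> jacobian_m u x \<noteq> 0"
    and fibres: "hausdorff_measure (real CARD('m) - 1)
                   {z \<in> fst ` u ` \<Omega>. \<not> hausdorff_measure 1 (fibre \<Omega> u c0 c1 z) > 0} = 0"
    and w_def: "w = w_fun \<Omega> u f g c0 c1"
    and \<nu>_def: "\<nu> = nu_fun \<Omega> u f g c0 c1"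
  shows
    "(\<forall>\<xi>. c0 < ereal \<xi> \<and> ereal \<xi> < c1 \<longrightarrow>
        integrable (completion M) (\<lambda>\<omega>. w (fst (u (X \<omega>))) \<xi>) \<and>
        \<alpha> \<xi> = (\<integral>\<omega>. w (fst (u (X \<omega>))) \<xi> \<partial>completion M))
   \<and> (AE \<xi> in lebesgue. c0 < ereal \<xi> \<and> ereal \<xi> < c1 \<and>
        stochastic_lipschitz_at M (\<lambda>\<omega>. w (fst (u (X \<omega>)))) \<xi> \<longrightarrow>
        integrable (completion M) (\<lambda>\<omega>. \<nu> (fst (u (X \<omega>))) \<xi>) \<and>
        (\<alpha> has_real_derivative (\<integral>\<omega>. \<nu> (fst (u (X \<omega>))) \<xi> \<partial>completion M)) (at \<xi>))
   \<and> (\<forall>\<xi>. c0 < ereal \<xi> \<and> ereal \<xi> < c1 \<and>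
        stochastic_lipschitz_at M (\<lambda>\<omega>. w (fst (u (X \<omega>)))) \<xi> \<and>
        (AE \<omega> in M. isCont (\<nu> (fst (u (X \<omega>)))) \<xi>) \<longrightarrow>
        integrable (completion M) (\<lambda>\<omega>. \<nu> (fst (u (X \<omega>))) \<xi>) \<and>
        (\<alpha> has_real_derivative (\<integral>\<omega>. \<nu> (fst (u (X \<omega>))) \<xi> \<partial>completion M)) (at \<xi>))"
proof -
  obtain U u' where U: "open U" "\<Omega> \<subseteq> U" "\<And>x. x \<in> U \<Longrightarrow> (u has_derivative blinfun_apply (u' x)) (at x)" "continuous_on U u'"
    using u_C1 unfolding C1_on_def by blast
  \<comment> \<open>\<open>h_range\<close> puts every level of the fibre between \<open>c0\<close>
    and \<open>c1\<close>, so \<open>fibre\<close> is the full vertical section of the image of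
    \<open>u\<close>.\<close>
  have fib: "fibre \<Omega> u c0 c1 z = {z} \<times> {t. (z, t) \<in> u ` \<Omega>}" for z
    using h_range by (auto simp: fibre_def u_def)
  interpret P: prob_space M by fact
  interpret fibred_chart \<Omega> U v h u'
  proof unfold_locales
    show "hausdorff_measure (real CARD('m) - 1)
      {z \<in> v ` \<Omega>. \<not> hausdorff_measure 1 ({z} \<times> {t. (z, t) \<in> (\<lambda>x. (v x, h x)) ` \<Omega>}) > 0} = 0"
      using fibres unfolding fib by (simp add: u_def image_image)
  qed (use assms(2) U u_inj jacobian_nonzero in \<open>auto simp: u_def\<close>)
  have fm: "f \<in> borel_measurable borel"
    using distributed_real_measurable[OF _ density] f_nonneg by simp
  have fin: "(\<integral>\<^sup>+x. indicator \<Omega> x * ennreal (f x) \<partial>lborel) < \<infinity>"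
  proof -
    have "(\<integral>\<^sup>+x. indicator \<Omega> x * ennreal (f x) \<partial>lborel) \<le> (\<integral>\<^sup>+x. ennreal (f x) \<partial>lborel)"
      by (rule nn_integral_mono) (simp add: indicator_def)
    also have "\<dots> = emeasure (density lborel (\<lambda>x. ennreal (f x))) UNIV"
      using fm by (simp add: emeasure_density)
    also have "\<dots> = emeasure (distr M lborel X) UNIV"
      using distributed_distr_eq_density[OF density] by simp
    also have "\<dots> = 1"
      using P.emeasure_space_1 distributed_measurable[OF density] by (simp add: emeasure_distr)
    finally show ?thesis by (simp add: le_less_trans)
  qed
  have Pm: "(\<lambda>x. g x * f x) \<in> borel_measurable borel" using g_measurable fm by simp
  obtain \<Psi> :: "(real^'m) \<times> real \<Rightarrow> real" where \<Psi>: "\<Psi> \<in> borel_measurable borel \<and>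
    (AE p in lborel. \<Psi> p = indicator \<Omega> (fst p) * (f (fst p) / enn2real (fibre_int f (v (fst p)))) *
      at_inverse \<Omega> (\<lambda>x. (v x, h x)) (\<lambda>x. g x * f x / jac x) (v (fst p), snd p)) \<and>
    (\<forall>B \<in> sets borel. integrable lborel (\<lambda>x. indicator \<Omega> x * (g x * f x * indicator B (h x))) \<longrightarrow>
       integrable lborel (\<lambda>p. \<Psi> p * indicator B (snd p)) \<and>
       (\<integral>p. \<Psi> p * indicator B (snd p) \<partial>lborel) = (\<integral>x. indicator \<Omega> x * (g x * f x * indicator B (h x)) \<partial>lborel))"
    using weighted_fibre_integral[OF fm f_nonneg fin Pm] by auto
  interpret conditional_chart \<Omega> U v h u' M X f g c0 c1 \<Psi>
  proof unfold_locales
    show "integrable M (\<lambda>\<omega>. g (X \<omega>) * indicator {x. h x \<le> \<xi>} (X \<omega>))" if "c0 < ereal \<xi>" "ereal \<xi> < c1" for \<xi>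
      using \<alpha>_exists[OF that] .
    show "integrable lborel (\<lambda>p. \<Psi> p * indicator B (snd p)) \<and>
       (\<integral>p. \<Psi> p * indicator B (snd p) \<partial>lborel) = (\<integral>x. indicator \<Omega> x * (g x * f x * indicator B (h x)) \<partial>lborel)"
      if "B \<in> sets borel" "integrable lborel (\<lambda>x. indicator \<Omega> x * (g x * f x * indicator B (h x)))" for B
      using \<Psi> that by blast
  qed (use density fm f_nonneg f_support g_measurable h_range fin \<Psi> in blast)+
  show ?thesis
    unfolding w_def \<nu>_def \<alpha>_def u_def fst_conv
    using w_integral(2,3) AE_derivative derivative_at_continuity
    by (auto elim!: eventually_mono)
qed

end
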